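(* Let $\mathbb{K}$ be a field. The primitive part $R$ of a cofree-coassociative right-sided combinatorial Hopf algebra $(T^c(R),*,\Delta)$ is a brace algebra, with operations $\{x;y_1,\ldots,y_q\}=M_{1q}(x;y_1\cdots y_q)$. There is an equivalence of categories between cofree-coassociative right-sided combinatorial Hopf algebras and brace algebras.
   Context: For a vector space $R$, $T^c(R)=\bigoplus_{n\ge 0}R^{\otimes n}$ with deconcatenation coproduct $\Delta(x_1\cdots x_n)=\sum_{i=0}^n x_1\cdots x_i\otimes x_{i+1}\cdots x_n$. A cofree-coassociative combinatorial Hopf algebra (CHA) is a vector space $R$ together with a product $*$ on $T^c(R)$, associative and unital with unit $1\in R^{\otimes 0}$, making $\mathcal{H}=(T^c(R),*,\Delta)$ a Hopf algebra. A morphism is a linear map $\varphi:R\to R'$ such that $T^c(\varphi)$ is a morphism of Hopf algebras. The operation $M_{pq}:R^{\otimes p}\otimes R^{\otimes q}\to R$ is the restriction of $*$ to $R^{\otimes p}\otimes R^{\otimes q}$ followed by the projection $T^c(R)\to R$. The CHA is right-sided if for every integer $q$ the subspace $\bigoplus_{n\ge q}R^{\otimes n}$ is a right ideal of $(T^c(R),* )$. A brace algebra is a vector space $R$ with a $(1+q)$-ary operation $\{-;-,\ldots,-\}$ for each $q\ge1$ such that $$\{\{x;y_1,\ldots,y_n\};z_1,\ldots,z_m\}=\sum\{x;\ldots,\{y_1;\ldots\},\ldots,\{y_n;\ldots\},\ldots\},$$ where on the right the dots are filled in all possible ways with the variables $z_1,\ldots,z_m$ in order (each dot possibly empty), with the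 convention $\{y;\emptyset\}=y$; i.e. the sum is over $0\le i_1\le j_1\le i_2\le j_2\le\cdots\le i_n\le j_n\le m$ of $\{x;z_1,\ldots,z_{i_1},\{y_1;z_{i_1+1},\ldots,z_{j_1}\},z_{j_1+1},\ldots,z_{i_n},\{y_n;z_{i_n+1},\ldots,z_{j_n}\},z_{j_n+1},\ldots,z_m\}$. Morphisms are linear maps preserving all the operations. *)

theory Defs
  imports "HOL-Algebra.Module" "HOL-Algebra.AbelCoset" HOL.Hull
begin

section \<open>Vector spaces and tensor products\<close>

text \<open>
  A vector space over a field \<open>K\<close> is a \<open>module K V\<close> of HOL-Algebra. The record type of
  modules also carries a multiplication and a unit; these are arbitrary for a mere vector space
  and are the multiplication and the unit of an algebra when there is one.
\<close>

definition lin_maps ::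
    "('k, 'm) ring_scheme \<Rightarrow> ('k, 'v, 'n) module_scheme \<Rightarrow> ('k, 'w, 'o) module_scheme \<Rightarrow> ('v \<Rightarrow> 'w) set"
  where "lin_maps K V W = {f \<in> carrier V \<rightarrow> carrier W.
    (\<forall>x \<in> carrier V. \<forall>y \<in> carrier V. f (x \<oplus>\<^bsub>V\<^esub> y) = f x \<oplus>\<^bsub>W\<^esub> f y) \<and>
    (\<forall>a \<in> carrier K. \<forall>x \<in> carrier V. f (a \<odot>\<^bsub>V\<^esub> x) = a \<odot>\<^bsub>W\<^esub> f x)}"

definition scalars :: "('k, 'm) ring_scheme \<Rightarrow> ('k, 'k) module"
  where "scalars K = \<lparr>carrier = carrier K, mult = mult K, one = \<one>\<^bsub>K\<^esub>, zero = \<zero>\<^bsub>K\<^esub>,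
    add = add K, smult = mult K\<rparr>"

definition lin_span ::
    "('k, 'm) ring_scheme \<Rightarrow> ('k, 'v, 'n) module_scheme \<Rightarrow> 'v set \<Rightarrow> 'v set"
  where "lin_span K V S = (\<lambda>N. submodule N K V) hull S"

definition free_space :: "('k, 'm) ring_scheme \<Rightarrow> 'x set \<Rightarrow> ('k, 'x \<Rightarrow> 'k) module"
  where "free_space K X =
    \<lparr>carrier = {f. finite {x. f x \<noteq> \<zero>\<^bsub>K\<^esub>} \<and> (\<forall>x \<in> X. f x \<in> carrier K) \<and> (\<forall>x. x \<notin> X \<longrightarrow> f x = \<zero>\<^bsub>K\<^esub>)},
     mult = undefined, one = undefined,
     zero = (\<lambda>x. \<zero>\<^bsub>K\<^esub>), add = (\<lambda>f g x. f x \<oplus>\<^bsub>K\<^esub> g x), smult = (\<lambda>a f x. a \<otimes>\<^bsub>K\<^esub> f x)\<rparr>"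

definition single :: "('k, 'm) ring_scheme \<Rightarrow> 'x \<Rightarrow> 'x \<Rightarrow> 'k"
  where "single K x = (\<lambda>y. if y = x then \<one>\<^bsub>K\<^esub> else \<zero>\<^bsub>K\<^esub>)"

definition free_ext ::
    "('k, 'm) ring_scheme \<Rightarrow> ('k, 'w, 'o) module_scheme \<Rightarrow> ('x \<Rightarrow> 'w) \<Rightarrow> ('x \<Rightarrow> 'k) \<Rightarrow> 'w"
  where "free_ext K W g f = (\<Oplus>\<^bsub>W\<^esub>x \<in> {x. f x \<noteq> \<zero>\<^bsub>K\<^esub>}. f x \<odot>\<^bsub>W\<^esub> g x)"

text \<open>
  The quotient of \<open>V\<close> by a subspace \<open>N\<close>, as a space of cosets. In the scalar multiplication,
  \<open>N\<close> is added so that \<open>\<zero>\<close> times a coset is the coset \<open>N\<close> and not \<open>{\<zero>}\<close>.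
\<close>

definition quot_space :: "('k, 'v, 'n) module_scheme \<Rightarrow> 'v set \<Rightarrow> ('k, 'v set) module"
  where "quot_space V N =
    \<lparr>carrier = a_rcosets\<^bsub>V\<^esub> N, mult = undefined, one = undefined, zero = N, add = set_add V,
     smult = (\<lambda>a X. N <+>\<^bsub>V\<^esub> ((\<lambda>x. a \<odot>\<^bsub>V\<^esub> x) ` X))\<rparr>"

text \<open>
  The linear map to \<open>W\<close>, defined on a quotient of a free vector space, that sends the class of a
  generator \<open>x\<close> to \<open>g x\<close>. It is only meaningful if the linear extension of \<open>g\<close> kills the subspace
  that is divided out, so that it is constant on cosets.
\<close>

definition lift ::
    "('k, 'm) ring_scheme \<Rightarrow> ('k, 'w, 'o) module_scheme \<Rightarrow> ('x \<Rightarrow> 'w) \<Rightarrow> ('x \<Rightarrow> 'k) set \<Rightarrow> 'w"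
  where "lift K W g X = the_elem (free_ext K W g ` X)"

definition bilinear_rels ::
    "('k, 'm) ring_scheme \<Rightarrow> ('k, 'v, 'n) module_scheme \<Rightarrow> ('k, 'w, 'o) module_scheme \<Rightarrow>
      ('v \<times> 'w \<Rightarrow> 'k) set"
  where "bilinear_rels K V W =
    (let F = free_space K (carrier V \<times> carrier W); e = (\<lambda>v w. single K (v, w)) in
      {e (x \<oplus>\<^bsub>V\<^esub> y) w \<ominus>\<^bsub>F\<^esub> (e x w \<oplus>\<^bsub>F\<^esub> e y w) | x y w.
         x \<in> carrier V \<and> y \<in> carrier V \<and> w \<in> carrier W} \<union>
      {e v (x \<oplus>\<^bsub>W\<^esub> y) \<ominus>\<^bsub>F\<^esub> (e v x \<oplus>\<^bsub>F\<^esub> e v y) | v x y.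
         v \<in> carrier V \<and> x \<in> carrier W \<and> y \<in> carrier W} \<union>
      {e (a \<odot>\<^bsub>V\<^esub> v) w \<ominus>\<^bsub>F\<^esub> (a \<odot>\<^bsub>F\<^esub> e v w) | a v w.
         a \<in> carrier K \<and> v \<in> carrier V \<and> w \<in> carrier W} \<union>
      {e v (a \<odot>\<^bsub>W\<^esub> w) \<ominus>\<^bsub>F\<^esub> (a \<odot>\<^bsub>F\<^esub> e v w) | a v w.
         a \<in> carrier K \<and> v \<in> carrier V \<and> w \<in> carrier W})"

definition tensor ::
    "('k, 'm) ring_scheme \<Rightarrow> ('k, 'v, 'n) module_scheme \<Rightarrow> ('k, 'w, 'o) module_scheme \<Rightarrow>
      ('k, ('v \<times> 'w \<Rightarrow> 'k) set) module"
  where "tensor K V W =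
    (let F = free_space K (carrier V \<times> carrier W)
     in quot_space F (lin_span K F (bilinear_rels K V W)))"

definition pure_tensor ::
    "('k, 'm) ring_scheme \<Rightarrow> ('k, 'v, 'n) module_scheme \<Rightarrow> ('k, 'w, 'o) module_scheme \<Rightarrow>
      'v \<Rightarrow> 'w \<Rightarrow> ('v \<times> 'w \<Rightarrow> 'k) set"
  where "pure_tensor K V W v w =
    (let F = free_space K (carrier V \<times> carrier W)
     in lin_span K F (bilinear_rels K V W) +>\<^bsub>F\<^esub> single K (v, w))"

text \<open>The map \<open>f \<otimes> g\<close> to \<open>V' \<otimes> W'\<close>; its domain does not enter the definition.\<close>

definition tensor_map ::
    "('k, 'm) ring_scheme \<Rightarrow> ('k, 'c, 'n) module_scheme \<Rightarrow> ('k, 'd, 'o) module_scheme \<Rightarrow>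
      ('v \<Rightarrow> 'c) \<Rightarrow> ('w \<Rightarrow> 'd) \<Rightarrow> ('v \<times> 'w \<Rightarrow> 'k) set \<Rightarrow> ('c \<times> 'd \<Rightarrow> 'k) set"
  where "tensor_map K V' W' f g =
    lift K (tensor K V' W') (\<lambda>(v, w). pure_tensor K V' W' (f v) (g w))"

definition tensor_assoc ::
    "('k, 'm) ring_scheme \<Rightarrow> ('k, 'u, 'n) module_scheme \<Rightarrow> ('k, 'v, 'o) module_scheme \<Rightarrow>
      ('k, 'w, 'p) module_scheme \<Rightarrow>
      (('u \<times> 'v \<Rightarrow> 'k) set \<times> 'w \<Rightarrow> 'k) set \<Rightarrow> ('u \<times> ('v \<times> 'w \<Rightarrow> 'k) set \<Rightarrow> 'k) set"
  where "tensor_assoc K U V W =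
    (let VW = tensor K V W; UVW = tensor K U VW in
      lift K UVW (\<lambda>(t, w).
        lift K UVW (\<lambda>(u, v). pure_tensor K U VW u (pure_tensor K V W v w)) t))"

text \<open>The tensor product of two algebras: \<open>(a \<otimes> b) (a' \<otimes> b') = (a a') \<otimes> (b b')\<close>.\<close>

definition tensor_alg ::
    "('k, 'm) ring_scheme \<Rightarrow> ('k, 'v, 'n) module_scheme \<Rightarrow> ('k, 'w, 'o) module_scheme \<Rightarrow>
      ('k, ('v \<times> 'w \<Rightarrow> 'k) set) module"
  where "tensor_alg K A B =
    (let T = tensor K A B in
      T\<lparr>mult := (\<lambda>s t.
           lift K T (\<lambda>(a, b). lift K T (\<lambda>(a', b').
             pure_tensor K A B (a \<otimes>\<^bsub>A\<^esub> a') (b \<otimes>\<^bsub>B\<^esub> b')) t) s),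
         one := pure_tensor K A B \<one>\<^bsub>A\<^esub> \<one>\<^bsub>B\<^esub>\<rparr>)"


section \<open>Hopf algebras\<close>

record ('k, 'h) hopf = "('k, 'h) module" +
  comult :: "'h \<Rightarrow> ('h \<times> 'h \<Rightarrow> 'k) set"
  counit :: "'h \<Rightarrow> 'k"

text \<open>Unlike the locale \<open>algebra\<close> of HOL-Algebra, this does not require commutativity.\<close>

definition unital_assoc_algebra :: "('k, 'm) ring_scheme \<Rightarrow> ('k, 'h, 'n) module_scheme \<Rightarrow> bool"
  where "unital_assoc_algebra K A \<longleftrightarrow> module K A \<and> ring A \<and>
    (\<forall>a \<in> carrier K. \<forall>x \<in> carrier A. \<forall>y \<in> carrier A.
      (a \<odot>\<^bsub>A\<^esub> x) \<otimes>\<^bsub>A\<^esub> y = a \<odot>\<^bsub>A\<^esub> (x \<otimes>\<^bsub>A\<^esub> y) \<and>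
      x \<otimes>\<^bsub>A\<^esub> (a \<odot>\<^bsub>A\<^esub> y) = a \<odot>\<^bsub>A\<^esub> (x \<otimes>\<^bsub>A\<^esub> y))"

definition coalgebra :: "('k, 'm) ring_scheme \<Rightarrow> ('k, 'h, 'n) hopf_scheme \<Rightarrow> bool"
  where "coalgebra K C \<longleftrightarrow> module K C \<and>
    comult C \<in> lin_maps K C (tensor K C C) \<and>
    counit C \<in> lin_maps K C (scalars K) \<and>
    (\<forall>x \<in> carrier C.
      tensor_assoc K C C C (tensor_map K (tensor K C C) C (comult C) (\<lambda>y. y) (comult C x)) =
        tensor_map K C (tensor K C C) (\<lambda>y. y) (comult C) (comult C x) \<and>
      lift K C (\<lambda>(a, b). counit C a \<odot>\<^bsub>C\<^esub> b) (comult C x) = x \<and>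
      lift K C (\<lambda>(a, b). counit C b \<odot>\<^bsub>C\<^esub> a) (comult C x) = x)"

definition bialgebra :: "('k, 'm) ring_scheme \<Rightarrow> ('k, 'h, 'n) hopf_scheme \<Rightarrow> bool"
  where "bialgebra K H \<longleftrightarrow> unital_assoc_algebra K H \<and> coalgebra K H \<and>
    comult H \<in> ring_hom H (tensor_alg K H H) \<and> counit H \<in> ring_hom H K"

definition antipode :: "('k, 'm) ring_scheme \<Rightarrow> ('k, 'h, 'n) hopf_scheme \<Rightarrow> ('h \<Rightarrow> 'h) \<Rightarrow> bool"
  where "antipode K H S \<longleftrightarrow> S \<in> lin_maps K H H \<and>
    (\<forall>x \<in> carrier H.
      lift K H (\<lambda>(a, b). S a \<otimes>\<^bsub>H\<^esub> b) (comult H x) = counit H x \<odot>\<^bsub>H\<^esub> \<one>\<^bsub>H\<^esub> \<and>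
      lift K H (\<lambda>(a, b). a \<otimes>\<^bsub>H\<^esub> S b) (comult H x) = counit H x \<odot>\<^bsub>H\<^esub> \<one>\<^bsub>H\<^esub>)"

definition hopf_algebra :: "('k, 'm) ring_scheme \<Rightarrow> ('k, 'h, 'n) hopf_scheme \<Rightarrow> bool"
  where "hopf_algebra K H \<longleftrightarrow> bialgebra K H \<and> (\<exists>S. antipode K H S)"

definition hopf_morphisms ::
    "('k, 'm) ring_scheme \<Rightarrow> ('k, 'h, 'n) hopf_scheme \<Rightarrow> ('k, 'g, 'o) hopf_scheme \<Rightarrow> ('h \<Rightarrow> 'g) set"
  where "hopf_morphisms K H H' = {f \<in> lin_maps K H H'. f \<in> ring_hom H H' \<and>
    (\<forall>x \<in> carrier H. comult H' (f x) = tensor_map K H' H' f f (comult H x) \<and>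
      counit H' (f x) = counit H x)}"

definition primitives :: "('k, 'm) ring_scheme \<Rightarrow> ('k, 'h, 'n) hopf_scheme \<Rightarrow> 'h set"
  where "primitives K H = {x \<in> carrier H. comult H x =
    pure_tensor K H H x \<one>\<^bsub>H\<^esub> \<oplus>\<^bsub>tensor K H H\<^esub> pure_tensor K H H \<one>\<^bsub>H\<^esub> x}"


section \<open>The tensor coalgebra\<close>

text \<open>
  The space \<open>T\<^sup>c(R)\<close> is presented by the words over \<open>R\<close> subject to multilinearity. All relations
  are homogeneous in the length of words, so this is the direct sum over \<open>n\<close> of the space presented
  by the words of length \<open>n\<close> subject to multilinearity, which is the \<open>n\<close>-th tensor power of \<open>R\<close>.
\<close>

definition multilinear_rels ::
    "('k, 'm) ring_scheme \<Rightarrow> ('k, 'a, 'n) module_scheme \<Rightarrow> ('a list \<Rightarrow> 'k) set"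
  where "multilinear_rels K R =
    (let F = free_space K (lists (carrier R)); e = single K in
      {e (u @ (x \<oplus>\<^bsub>R\<^esub> y) # v) \<ominus>\<^bsub>F\<^esub> (e (u @ x # v) \<oplus>\<^bsub>F\<^esub> e (u @ y # v)) | u v x y.
         u \<in> lists (carrier R) \<and> v \<in> lists (carrier R) \<and> x \<in> carrier R \<and> y \<in> carrier R} \<union>
      {e (u @ (a \<odot>\<^bsub>R\<^esub> x) # v) \<ominus>\<^bsub>F\<^esub> (a \<odot>\<^bsub>F\<^esub> e (u @ x # v)) | u v a x.
         u \<in> lists (carrier R) \<and> v \<in> lists (carrier R) \<and> a \<in> carrier K \<and> x \<in> carrier R})"

definition tensor_words ::
    "('k, 'm) ring_scheme \<Rightarrow> ('k, 'a, 'n) module_scheme \<Rightarrow> ('k, ('a list \<Rightarrow> 'k) set) module"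
  where "tensor_words K R =
    (let F = free_space K (lists (carrier R))
     in quot_space F (lin_span K F (multilinear_rels K R)))"

definition word ::
    "('k, 'm) ring_scheme \<Rightarrow> ('k, 'a, 'n) module_scheme \<Rightarrow> 'a list \<Rightarrow> ('a list \<Rightarrow> 'k) set"
  where "word K R w =
    (let F = free_space K (lists (carrier R))
     in lin_span K F (multilinear_rels K R) +>\<^bsub>F\<^esub> single K w)"

text \<open>The sum of the tensor powers \<open>R\<^sup>\<otimes>\<^sup>n\<close> over all \<open>n \<in> N\<close>, as a subspace of \<open>T\<^sup>c(R)\<close>.\<close>

definition tensor_part ::
    "('k, 'm) ring_scheme \<Rightarrow> ('k, 'a, 'n) module_scheme \<Rightarrow> nat set \<Rightarrow> ('a list \<Rightarrow> 'k) set set"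
  where "tensor_part K R N =
    lin_span K (tensor_words K R) {word K R w | w. w \<in> lists (carrier R) \<and> length w \<in> N}"

definition deconcatenation ::
    "('k, 'm) ring_scheme \<Rightarrow> ('k, 'a, 'n) module_scheme \<Rightarrow> ('a list \<Rightarrow> 'k) set \<Rightarrow>
      (('a list \<Rightarrow> 'k) set \<times> ('a list \<Rightarrow> 'k) set \<Rightarrow> 'k) set"
  where "deconcatenation K R =
    (let T = tensor_words K R in
      lift K (tensor K T T) (\<lambda>w. \<Oplus>\<^bsub>tensor K T T\<^esub>i \<in> {..length w}.
        pure_tensor K T T (word K R (take i w)) (word K R (drop i w))))"

definition T_counit ::
    "('k, 'm) ring_scheme \<Rightarrow> ('k, 'a, 'n) module_scheme \<Rightarrow> ('a list \<Rightarrow> 'k) set \<Rightarrow> 'k"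
  where "T_counit K R = lift K (scalars K) (\<lambda>w. if w = [] then \<one>\<^bsub>K\<^esub> else \<zero>\<^bsub>K\<^esub>)"

definition T_proj ::
    "('k, 'm) ring_scheme \<Rightarrow> ('k, 'a, 'n) module_scheme \<Rightarrow> ('a list \<Rightarrow> 'k) set \<Rightarrow> 'a"
  where "T_proj K R = lift K R (\<lambda>w. if length w = 1 then hd w else \<zero>\<^bsub>R\<^esub>)"

definition T_map ::
    "('k, 'm) ring_scheme \<Rightarrow> ('k, 'b, 'n) module_scheme \<Rightarrow> ('a \<Rightarrow> 'b) \<Rightarrow>
      ('a list \<Rightarrow> 'k) set \<Rightarrow> ('b list \<Rightarrow> 'k) set"
  where "T_map K R' \<phi> = lift K (tensor_words K R') (\<lambda>w. word K R' (map \<phi> w))"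


section \<open>Combinatorial Hopf algebras\<close>

type_synonym ('k, 'a) T_product =
  "('a list \<Rightarrow> 'k) set \<Rightarrow> ('a list \<Rightarrow> 'k) set \<Rightarrow> ('a list \<Rightarrow> 'k) set"

text \<open>The tensor coalgebra equipped with a product; its unit is the empty word.\<close>

definition T_hopf ::
    "('k, 'm) ring_scheme \<Rightarrow> ('k, 'a, 'n) module_scheme \<Rightarrow> ('k, 'a) T_product \<Rightarrow>
      ('k, ('a list \<Rightarrow> 'k) set) hopf"
  where "T_hopf K R mul =
    (let T = tensor_words K R in
      \<lparr>carrier = carrier T, mult = mul, one = word K R [], zero = zero T, add = add T,
       smult = smult T, comult = deconcatenation K R, counit = T_counit K R\<rparr>)"

definition CHA ::
    "('k, 'm) ring_scheme \<Rightarrow> ('k, 'a, 'n) module_scheme \<Rightarrow> ('k, 'a) T_product \<Rightarrow> bool"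
  where "CHA K R mul \<longleftrightarrow> module K R \<and> hopf_algebra K (T_hopf K R mul)"

definition right_ideal :: "('h, 'm) ring_scheme \<Rightarrow> 'h set \<Rightarrow> bool"
  where "right_ideal A I \<longleftrightarrow> additive_subgroup I A \<and>
    (\<forall>x \<in> I. \<forall>y \<in> carrier A. x \<otimes>\<^bsub>A\<^esub> y \<in> I)"

definition right_sided_CHA ::
    "('k, 'm) ring_scheme \<Rightarrow> ('k, 'a, 'n) module_scheme \<Rightarrow> ('k, 'a) T_product \<Rightarrow> bool"
  where "right_sided_CHA K R mul \<longleftrightarrow> CHA K R mul \<and>
    (\<forall>q::int. right_ideal (T_hopf K R mul) (tensor_part K R {n. q \<le> int n}))"

text \<open>\<open>M_op K R mul p q\<close> is the operation \<open>M\<^sub>p\<^sub>q\<close> on \<open>R\<^sup>\<otimes>\<^sup>p \<times> R\<^sup>\<otimes>\<^sup>q\<close>, as a bilinear map.\<close>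

definition M_op ::
    "('k, 'm) ring_scheme \<Rightarrow> ('k, 'a, 'n) module_scheme \<Rightarrow> ('k, 'a) T_product \<Rightarrow> nat \<Rightarrow> nat \<Rightarrow>
      ('a list \<Rightarrow> 'k) set \<Rightarrow> ('a list \<Rightarrow> 'k) set \<Rightarrow> 'a"
  where "M_op K R mul p q =
    (\<lambda>u \<in> tensor_part K R {p}. \<lambda>v \<in> tensor_part K R {q}. T_proj K R (mul u v))"

definition CHA_brace ::
    "('k, 'm) ring_scheme \<Rightarrow> ('k, 'a, 'n) module_scheme \<Rightarrow> ('k, 'a) T_product \<Rightarrow> 'a \<Rightarrow> 'a list \<Rightarrow> 'a"
  where "CHA_brace K R mul x ys = M_op K R mul 1 (length ys) (word K R [x]) (word K R ys)"


section \<open>Brace algebras\<close>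

text \<open>
  The operations of a brace algebra are given by a single function on lists, with
  \<open>br x [y\<^sub>1, \<dots>, y\<^sub>q]\<close> for \<open>{x; y\<^sub>1, \<dots>, y\<^sub>q}\<close>. In \<open>brace_term\<close> the lists \<open>is\<close> and \<open>js\<close> are
  \<open>[i\<^sub>1, \<dots>, i\<^sub>n]\<close> and \<open>[j\<^sub>1, \<dots>, j\<^sub>n]\<close>, so that \<open>(0 # js) ! k\<close> is the position in \<open>zs\<close> at which the
  block preceding the \<open>k\<close>-th (counted from 0) inner brace starts.
\<close>

definition slice :: "nat \<Rightarrow> nat \<Rightarrow> 'a list \<Rightarrow> 'a list"
  where "slice i j zs = take (j - i) (drop i zs)"

definition brace_indices :: "nat \<Rightarrow> nat \<Rightarrow> (nat list \<times> nat list) set"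
  where "brace_indices n m = {(is, js). length is = n \<and> length js = n \<and>
    (\<forall>k < n. (0 # js) ! k \<le> is ! k \<and> is ! k \<le> js ! k \<and> js ! k \<le> m)}"

definition brace_term ::
    "('a \<Rightarrow> 'a list \<Rightarrow> 'a) \<Rightarrow> 'a \<Rightarrow> 'a list \<Rightarrow> 'a list \<Rightarrow> nat list \<Rightarrow> nat list \<Rightarrow> 'a"
  where "brace_term br x ys zs is js = br x
    (concat (map (\<lambda>k. slice ((0 # js) ! k) (is ! k) zs @ [br (ys ! k) (slice (is ! k) (js ! k) zs)])
       [0..<length ys])
     @ drop ((0 # js) ! length ys) zs)"

text \<open>
  The clause \<open>br x [] = x\<close> is the convention \<open>{y; \<emptyset>} = y\<close>; there is no operation for \<open>q = 0\<close>.
\<close>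

definition brace_algebra ::
    "('k, 'm) ring_scheme \<Rightarrow> ('k, 'a, 'n) module_scheme \<Rightarrow> ('a \<Rightarrow> 'a list \<Rightarrow> 'a) \<Rightarrow> bool"
  where "brace_algebra K R br \<longleftrightarrow> module K R \<and>
    (\<forall>x \<in> carrier R. br x [] = x) \<and>
    (\<forall>ys \<in> lists (carrier R). ys \<noteq> [] \<longrightarrow> (\<lambda>x. br x ys) \<in> lin_maps K R R) \<and>
    (\<forall>x \<in> carrier R. \<forall>us \<in> lists (carrier R). \<forall>vs \<in> lists (carrier R).
      (\<lambda>y. br x (us @ y # vs)) \<in> lin_maps K R R) \<and>
    (\<forall>x \<in> carrier R. \<forall>ys \<in> lists (carrier R). \<forall>zs \<in> lists (carrier R). ys \<noteq> [] \<longrightarrow> zs \<noteq> [] \<longrightarrow>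
      br (br x ys) zs =
        (\<Oplus>\<^bsub>R\<^esub>p \<in> brace_indices (length ys) (length zs).
          brace_term br x ys zs (fst p) (snd p)))"


section \<open>Categories\<close>

text \<open>
  Hom-sets need not be disjoint; the composite of \<open>f\<close> from \<open>A\<close> to \<open>B\<close> and \<open>g\<close> from \<open>B\<close> to \<open>C\<close> is
  \<open>Cmp \<C> A B C g f\<close>.
\<close>

record ('o, 'm) cat =
  Obj :: "'o set"
  Hom :: "'o \<Rightarrow> 'o \<Rightarrow> 'm set"
  Idt :: "'o \<Rightarrow> 'm"
  Cmp :: "'o \<Rightarrow> 'o \<Rightarrow> 'o \<Rightarrow> 'm \<Rightarrow> 'm \<Rightarrow> 'm"

definition category :: "('o, 'm) cat \<Rightarrow> bool"
  where "category \<C> \<longleftrightarrow>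
    (\<forall>A \<in> Obj \<C>. Idt \<C> A \<in> Hom \<C> A A) \<and>
    (\<forall>A \<in> Obj \<C>. \<forall>B \<in> Obj \<C>. \<forall>C \<in> Obj \<C>. \<forall>f \<in> Hom \<C> A B. \<forall>g \<in> Hom \<C> B C.
      Cmp \<C> A B C g f \<in> Hom \<C> A C) \<and>
    (\<forall>A \<in> Obj \<C>. \<forall>B \<in> Obj \<C>. \<forall>f \<in> Hom \<C> A B.
      Cmp \<C> A A B f (Idt \<C> A) = f \<and> Cmp \<C> A B B (Idt \<C> B) f = f) \<and>
    (\<forall>A \<in> Obj \<C>. \<forall>B \<in> Obj \<C>. \<forall>C \<in> Obj \<C>. \<forall>D \<in> Obj \<C>.
      \<forall>f \<in> Hom \<C> A B. \<forall>g \<in> Hom \<C> B C. \<forall>h \<in> Hom \<C> C D.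
        Cmp \<C> A C D h (Cmp \<C> A B C g f) = Cmp \<C> A B D (Cmp \<C> B C D h g) f)"

text \<open>A functor is given by its object map and its maps \<open>Hom A B \<rightarrow> Hom (F A) (F B)\<close>.\<close>

type_synonym ('o, 'm, 'p, 'n) func = "('o \<Rightarrow> 'p) \<times> ('o \<Rightarrow> 'o \<Rightarrow> 'm \<Rightarrow> 'n)"

definition is_functor :: "('o, 'm) cat \<Rightarrow> ('p, 'n) cat \<Rightarrow> ('o, 'm, 'p, 'n) func \<Rightarrow> bool"
  where "is_functor \<C> \<D> F \<longleftrightarrow>
    (\<forall>A \<in> Obj \<C>. fst F A \<in> Obj \<D>) \<and>
    (\<forall>A \<in> Obj \<C>. \<forall>B \<in> Obj \<C>. \<forall>f \<in> Hom \<C> A B. snd F A B f \<in> Hom \<D> (fst F A) (fst F B)) \<and>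
    (\<forall>A \<in> Obj \<C>. snd F A A (Idt \<C> A) = Idt \<D> (fst F A)) \<and>
    (\<forall>A \<in> Obj \<C>. \<forall>B \<in> Obj \<C>. \<forall>C \<in> Obj \<C>. \<forall>f \<in> Hom \<C> A B. \<forall>g \<in> Hom \<C> B C.
      snd F A C (Cmp \<C> A B C g f) =
        Cmp \<D> (fst F A) (fst F B) (fst F C) (snd F B C g) (snd F A B f))"

definition id_func :: "('o, 'm, 'o, 'm) func"
  where "id_func = ((\<lambda>A. A), (\<lambda>A B f. f))"

definition comp_func ::
    "('p, 'n, 'q, 'l) func \<Rightarrow> ('o, 'm, 'p, 'n) func \<Rightarrow> ('o, 'm, 'q, 'l) func"
  where "comp_func G F =
    ((\<lambda>A. fst G (fst F A)), (\<lambda>A B f. snd G (fst F A) (fst F B) (snd F A B f)))"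

definition is_iso :: "('o, 'm) cat \<Rightarrow> 'o \<Rightarrow> 'o \<Rightarrow> 'm \<Rightarrow> bool"
  where "is_iso \<C> A B f \<longleftrightarrow> f \<in> Hom \<C> A B \<and>
    (\<exists>g \<in> Hom \<C> B A. Cmp \<C> A B A g f = Idt \<C> A \<and> Cmp \<C> B A B f g = Idt \<C> B)"

definition naturally_isomorphic ::
    "('o, 'm) cat \<Rightarrow> ('p, 'n) cat \<Rightarrow> ('o, 'm, 'p, 'n) func \<Rightarrow> ('o, 'm, 'p, 'n) func \<Rightarrow> bool"
  where "naturally_isomorphic \<C> \<D> F G \<longleftrightarrow> (\<exists>\<eta>.
    (\<forall>A \<in> Obj \<C>. is_iso \<D> (fst F A) (fst G A) (\<eta> A)) \<and>
    (\<forall>A \<in> Obj \<C>. \<forall>B \<in> Obj \<C>. \<forall>f \<in> Hom \<C> A B.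
      Cmp \<D> (fst F A) (fst F B) (fst G B) (\<eta> B) (snd F A B f) =
        Cmp \<D> (fst F A) (fst G A) (fst G B) (snd G A B f) (\<eta> A)))"

definition is_equivalence :: "('o, 'm) cat \<Rightarrow> ('p, 'n) cat \<Rightarrow> ('o, 'm, 'p, 'n) func \<Rightarrow> bool"
  where "is_equivalence \<C> \<D> F \<longleftrightarrow> category \<C> \<and> category \<D> \<and> is_functor \<C> \<D> F \<and>
    (\<exists>G. is_functor \<D> \<C> G \<and>
      naturally_isomorphic \<C> \<C> id_func (comp_func G F) \<and>
      naturally_isomorphic \<D> \<D> (comp_func F G) id_func)"


text \<open>
  The objects of the two categories are the structures whose underlying set is contained in the
  type \<open>'a\<close>, which plays the role of a universe. Morphisms are functions of type \<open>'a \<Rightarrow> 'a\<close>;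
  requiring them to be \<open>extensional\<close> makes equality of morphisms the equality on the domain.
\<close>

definition CHA_cat ::
    "('k, 'm) ring_scheme \<Rightarrow> (('k, 'a) module \<times> ('k, 'a) T_product, 'a \<Rightarrow> 'a) cat"
  where "CHA_cat K =
    \<lparr>Obj = {(R, mul). right_sided_CHA K R mul},
     Hom = (\<lambda>(R, mul) (R', mul'). {\<phi> \<in> lin_maps K R R'. \<phi> \<in> extensional (carrier R) \<and>
       T_map K R' \<phi> \<in> hopf_morphisms K (T_hopf K R mul) (T_hopf K R' mul')}),
     Idt = (\<lambda>(R, mul). \<lambda>x \<in> carrier R. x),
     Cmp = (\<lambda>A B C \<psi> \<phi>. compose (carrier (fst A)) \<psi> \<phi>)\<rparr>"

definition brace_cat ::
    "('k, 'm) ring_scheme \<Rightarrow> (('k, 'a) module \<times> ('a \<Rightarrow> 'a list \<Rightarrow> 'a), 'a \<Rightarrow> 'a) cat"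
  where "brace_cat K =
    \<lparr>Obj = {(R, br). brace_algebra K R br},
     Hom = (\<lambda>(R, br) (R', br'). {\<phi> \<in> lin_maps K R R'. \<phi> \<in> extensional (carrier R) \<and>
       (\<forall>x \<in> carrier R. \<forall>ys \<in> lists (carrier R). ys \<noteq> [] \<longrightarrow>
         \<phi> (br x ys) = br' (\<phi> x) (map \<phi> ys))}),
     Idt = (\<lambda>(R, br). \<lambda>x \<in> carrier R. x),
     Cmp = (\<lambda>A B C \<psi> \<phi>. compose (carrier (fst A)) \<psi> \<phi>)\<rparr>"

definition brace_functor ::
    "('k, 'm) ring_scheme \<Rightarrow>
      (('k, 'a) module \<times> ('k, 'a) T_product, 'a \<Rightarrow> 'a,
       ('k, 'a) module \<times> ('a \<Rightarrow> 'a list \<Rightarrow> 'a), 'a \<Rightarrow> 'a) func"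
  where "brace_functor K = ((\<lambda>(R, mul). (R, CHA_brace K R mul)), (\<lambda>A B \<phi>. \<phi>))"

end

theory Submission
  imports Defs "HOL-Library.Multiset"
begin

text \<open>
  An element \<open>t\<close> of \<open>T\<^sup>c(R)\<close> is recovered from its counit and its coproduct: if \<open>\<pi>\<close> is the projection
  to \<open>R\<close> and \<open>\<kappa> (a \<otimes> b) = \<pi>(a) b\<close> (concatenation), then \<open>t = \<epsilon>(t) 1 + \<kappa>(\<Delta> t)\<close>. Hence primitive elements have
  length one, and a product compatible with \<open>\<Delta>\<close> satisfies
  \<open>u * v = \<epsilon>(u) \<epsilon>(v) 1 + \<Sum> \<pi>(u' * v') (u'' * v'')\<close>, summed over the splittings of the words \<open>u\<close> and \<open>v\<close>. In the
  right-sided case \<open>\<pi>(u' * v')\<close> vanishes if \<open>u'\<close> has length at least two, and this recursion expresses the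
  product of words by the braces \<open>{x; v'} = \<pi>(x * v')\<close>:
  \<open>x u * z v = z (x u * v) + \<Sum> {x; v'} (u * v'')\<close>, summed over the splittings \<open>v' v''\<close> of \<open>z v\<close>. Unfolding it
  gives the sum in the brace identity, which is the projection of \<open>(x * ys) * zs = x * (ys * zs)\<close> to \<open>R\<close>.
  Conversely, the recursion defines a product from the braces; it is compatible with \<open>\<Delta>\<close> for
  purely combinatorial reasons, associative by induction on the total length of the words, and has an
  antipode because \<open>T\<^sup>c(R)\<close> is conilpotent. Both constructions are the identity on morphisms.
\<close>

section \<open>Splittings and products of words\<close>

text \<open>The coefficients in the coproduct and in the product of words are natural numbers, so
  multisets can carry the combinatorics; a sign enters only with the antipode. What holds for words
  alone, with an arbitrary function \<open>br\<close>, is proved for multisets: coassociativity,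
  multiplicativity of the coproduct (\<open>splits_wprods\<close>) and the translation of the index
  sum in the brace identity. Associativity cannot be of this kind, since the brace identity equates
  a letter with a sum of letters in R; it is proved only after \<open>E\<close> has mapped multisets
  of words to T^c(R). The obstacle on that side is that T^c(R) is a quotient of a free space with no
  basis at hand: a function of words descends to it only if it is linear in every letter, and for
  the recursively defined product this has to be shown for each letter of both words
  (\<open>E_ml_fst\<close>, \<open>E_ml_snd\<close>). Moreover, products and braces are fixed by
  their axioms on the carriers only. The two constructions are therefore inverse only there, and the
  functors compose to the identity up to natural isomorphisms whose components are identity
  maps.\<close>

text \<open>
  Sums of words with multiplicities are encoded as multisets: \<open>splits w\<close> encodes the coproduct of
  \<open>w\<close>, and \<open>wprods br u v\<close> the product of \<open>u\<close> and \<open>v\<close>. In the latter, the first letter of a word is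
  either the first letter of \<open>v\<close>, or the brace of the first letter of \<open>u\<close> with a prefix of \<open>v\<close>.
\<close>

fun splits :: "'a list \<Rightarrow> ('a list \<times> 'a list) multiset"
  where "splits [] = {#([], [])#}"
  | "splits (x # w) = add_mset ([], x # w) (image_mset (\<lambda>p. (x # fst p, snd p)) (splits w))"

fun wprods :: "('a \<Rightarrow> 'a list \<Rightarrow> 'a) \<Rightarrow> 'a list \<Rightarrow> 'a list \<Rightarrow> 'a list multiset"
  where "wprods br [] v = {#v#}"
  | "wprods br (x # u) [] = image_mset ((#) (br x [])) (wprods br u [])"
  | "wprods br (x # u) (z # v) = image_mset ((#) z) (wprods br (x # u) v) +
       (\<Sum>p \<in># splits (z # v). image_mset ((#) (br x (fst p))) (wprods br u (snd p)))"

lemma sum_mset_sum_mset: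
  fixes f :: "'i \<Rightarrow> 'b::comm_monoid_add"
  shows "(\<Sum>i \<in># (\<Sum>x \<in># M. N x). f i) = (\<Sum>x \<in># M. \<Sum>i \<in># N x. f i)"
  by (induction M) auto

lemma image_mset_sum_mset: "image_mset f (\<Sum>x \<in># M. N x) = (\<Sum>x \<in># M. image_mset f (N x))"
  by (induction M) auto

lemma sum_mset_add_mset: "(\<Sum>x \<in># M. add_mset (f x) (g x)) = image_mset f M + (\<Sum>x \<in># M. g x)"
  by (induction M) auto

lemma wprods_Nil2: "(\<And>x. x \<in> set u \<Longrightarrow> br x [] = x) \<Longrightarrow> wprods br u [] = {#u#}"
  by (induction u) auto

lemma splits_append:
  "splits (u @ y # v) = image_mset (\<lambda>p. (fst p, snd p @ y # v)) (splits u) +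
     image_mset (\<lambda>p. (u @ y # fst p, snd p)) (splits v)"
  by (induction u) (auto simp: multiset.map_comp comp_def)

lemma splits_coassoc:
  "(\<Sum>p \<in># splits w. image_mset (\<lambda>q. (fst q, snd q, snd p)) (splits (fst p))) =
   (\<Sum>p \<in># splits w. image_mset (\<lambda>q. (fst p, fst q, snd q)) (splits (snd p)))"
proof (induction w)
  case (Cons x w)
  show ?case
    using arg_cong[OF Cons, of "image_mset (\<lambda>t. (x # fst t, snd t))"]
    by (simp add: image_mset_sum_mset multiset.map_comp comp_def sum_mset_add_mset)
qed simp

lemma splits_pair:
  "p \<in># splits w \<Longrightarrow> fst p @ snd p = w"
  by (induction w arbitrary: p) auto

lemma splits_mem: "(a, b) \<in># splits (a @ b)"
proof (induction a)
  case Nil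
  show ?case by (cases b) auto
qed force

lemma splits_length_snd: "p \<in># splits w \<Longrightarrow> length (snd p) \<le> length w"
  using splits_pair by fastforce

lemma splits_take_drop: "splits w = image_mset (\<lambda>i. (take i w, drop i w)) (mset_set {..length w})"
proof (induction w)
  case (Cons x w)
  have "{..length (x # w)} = insert 0 (Suc ` {..length w})"
    by (simp only: list.size(4) add_Suc_right add_0_right atMost_Suc_eq_insert_0)
  moreover have "mset_set (Suc ` {..length w}) = image_mset Suc (mset_set {..length w})"
    by (simp add: image_mset_mset_set)
  ultimately show ?case
    by (simp add: Cons multiset.map_comp comp_def)
qed simp

text \<open>Formal counterpart of the tensor product of two sums of words: \<open>msum_pairs\<close>
  maps it to the pure tensor of \<open>E M\<close> and \<open>E N\<close>. This is how
  \<open>splits_wprods\<close> turns into multiplicativity of \<Delta>.\<close>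

definition pairs :: "'a multiset \<Rightarrow> 'b multiset \<Rightarrow> ('a \<times> 'b) multiset"
  where "pairs M N = (\<Sum>a \<in># M. image_mset (Pair a) N)"

lemma pairs_simps [simp]:
  "pairs {#} N = {#}"
  "pairs (add_mset a M) N = image_mset (Pair a) N + pairs M N"
  "pairs (M + M') N = pairs M N + pairs M' N"
  "pairs M {#} = {#}"
  "pairs M (add_mset b N) = image_mset (\<lambda>a. (a, b)) M + pairs M N"
  "pairs M (N + N') = pairs M N + pairs M N'"
  by (induction M) (auto simp: pairs_def)

lemma pairs_image:
  "pairs (image_mset f M) N = image_mset (\<lambda>q. (f (fst q), snd q)) (pairs M N)"
  by (induction M) (auto simp: multiset.map_comp comp_def)

lemma pairs_sum:
  "pairs (\<Sum>x \<in># A. M x) N = (\<Sum>x \<in># A. pairs (M x) N)"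
  by (induction A) auto

lemma splits_coassoc_sum:
  fixes F :: "'a list \<Rightarrow> 'a list \<Rightarrow> 'a list \<Rightarrow> 'b::comm_monoid_add"
  shows "(\<Sum>p \<in># splits w. \<Sum>q \<in># splits (fst p). F (fst q) (snd q) (snd p)) =
     (\<Sum>p \<in># splits w. \<Sum>q \<in># splits (snd p). F (fst p) (fst q) (snd q))"
  using arg_cong[OF splits_coassoc[of w], of "\<lambda>M. \<Sum>t \<in># M. F (fst t) (fst (snd t)) (snd (snd t))"]
  by (simp add: sum_mset_sum_mset multiset.map_comp comp_def)

text \<open>Multiplicativity of the coproduct, for an arbitrary function \<open>br\<close>. A cut of
  a product word lies either in front of it or behind its first letter. In the second case that
  letter is produced by the same clause of the recursion for the left factor, and the induction
  hypothesis cuts the remaining word. If the letter is a brace, the word \<open>z # v\<close> is cut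
  twice, into the arguments of the brace, the rest of the left part and the right part;
  coassociativity exchanges the order of the two cuts.\<close>

lemma splits_wprods:
  "(\<Sum>w \<in># wprods br u v. splits w) =
     (\<Sum>p \<in># splits u. \<Sum>q \<in># splits v. pairs (wprods br (fst p) (fst q)) (wprods br (snd p) (snd q)))"
proof (induction br u v rule: wprods.induct)
  case (1 br v)
  have "M = (\<Sum>p \<in># M. {#(fst p, snd p)#})" for M :: "('a list \<times> 'a list) multiset"
    by (induction M) auto
  then show ?case by simp
next
  case (2 br x u)
  have "(\<Sum>w \<in># wprods br (x # u) []. splits w) = image_mset (Pair []) (wprods br (x # u) []) +
     image_mset (\<lambda>p. (br x [] # fst p, snd p)) (\<Sum>w \<in># wprods br u []. splits w)"
    by (simp add: image_mset_sum_mset multiset.map_comp comp_def sum_mset_add_mset)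
  then show ?case
    unfolding 2 by (simp add: pairs_image image_mset_sum_mset multiset.map_comp comp_def)
next
  case (3 br x u z v)
  let ?P = "\<lambda>a b. pairs (wprods br (fst a) (fst b)) (wprods br (snd a) (snd b))"
  let ?c = "\<lambda>c. image_mset (\<lambda>p. (c # fst p, snd p))"
  have cons: "(\<Sum>w \<in># image_mset ((#) c) M. splits w) =
      image_mset (Pair []) (image_mset ((#) c) M) + ?c c (\<Sum>w \<in># M. splits w)" for c :: 'a and M
    by (induction M) auto
  have pc: "pairs (image_mset ((#) c) M) N = ?c c (pairs M N)" for c :: 'a and M and N :: "'a list multiset"
    by (rule pairs_image)
  have csum: "?c c (\<Sum>x \<in># A. M x) = (\<Sum>x \<in># A. ?c c (M x))" for c and A :: "('a list \<times> 'a list) multiset" and M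
    by (rule image_mset_sum_mset)
  \<comment> \<open>On one side the brace takes a prefix of \<open>z # v\<close> and the rest is cut
    again; on the other \<open>z # v\<close> is cut first and the brace takes a prefix of the left
    part. Both orders run over the same cuts into three.\<close>
  have cs: "(\<Sum>p\<in>#splits (z # v). \<Sum>q\<in>#splits (snd p). \<Sum>a\<in>#splits u. ?c (br x (fst p)) (?P a q)) =
    (\<Sum>q\<in>#splits (z # v). \<Sum>r\<in>#splits (fst q). \<Sum>a\<in>#splits u.
       ?c (br x (fst r)) (pairs (wprods br (fst a) (snd r)) (wprods br (snd a) (snd q))))"
    by (rule splits_coassoc_sum[symmetric, where F = "\<lambda>r1 r2 q2. \<Sum>a\<in>#splits u.
       ?c (br x r1) (pairs (wprods br (fst a) r2) (wprods br (snd a) q2))"])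
  have ih: "(\<Sum>p\<in>#splits (z # v). ?c (br x (fst p)) (\<Sum>w \<in># wprods br u (snd p). splits w)) =
    (\<Sum>p\<in>#splits (z # v). ?c (br x (fst p)) (\<Sum>a \<in># splits u. \<Sum>b \<in># splits (snd p). ?P a b))"
    by (intro arg_cong[of _ _ sum_mset] image_mset_cong) (simp only: 3(2))
  have "(\<Sum>w \<in># wprods br (x # u) (z # v). splits w) =
     image_mset (Pair []) (wprods br (x # u) (z # v)) + ?c z (\<Sum>w \<in># wprods br (x # u) v. splits w) +
     (\<Sum>p\<in>#splits (z # v). ?c (br x (fst p)) (\<Sum>w \<in># wprods br u (snd p). splits w))"
    unfolding wprods.simps(3) image_mset_union sum_mset.union sum_mset_sum_mset cons sum_mset.distrib
      image_mset_sum_mset[of "Pair []"] by (simp only: ac_simps)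
  also have "\<dots> = image_mset (Pair []) (wprods br (x # u) (z # v)) +
     ?c z (\<Sum>a \<in># splits (x # u). \<Sum>b \<in># splits v. ?P a b) +
     (\<Sum>p\<in>#splits (z # v). \<Sum>q\<in>#splits (snd p). \<Sum>a\<in>#splits u. ?c (br x (fst p)) (?P a q))"
    unfolding 3(1) ih csum by (subst sum_mset.swap[of _ "splits u"]) (rule refl)
  also have "\<dots> = (\<Sum>p \<in># splits (x # u). \<Sum>q \<in># splits (z # v). ?P p q)"
    unfolding cs csum
    apply (simp add: sum_mset.distrib multiset.map_comp comp_def pc pairs_sum)
    apply (simp add: csum sum_mset.swap[of _ "splits u"])
    done
  finally show ?case .
qed


lemma wprods_closed:
  assumes "\<And>x ys. x \<in> C \<Longrightarrow> ys \<in> lists C \<Longrightarrow> br x ys \<in> C"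
  shows "u \<in> lists C \<Longrightarrow> v \<in> lists C \<Longrightarrow> w \<in># wprods br u v \<Longrightarrow> w \<in> lists C"
  using assms
proof (induction br u v arbitrary: w rule: wprods.induct)
  case (2 br x u)
  then show ?case by auto (metis in_lists_conv_set)
next
  case (3 br x u z v)
  have *: "fst p \<in> lists C \<and> snd p \<in> lists C" if "p \<in># splits (z # v)" for p
    using splits_pair[OF that] 3(4) by (metis append_in_lists_conv)
  from 3(5) consider w' where "w = z # w'" "w' \<in># wprods br (x # u) v"
    | p w' where "p \<in># splits (z # v)" "w = br x (fst p) # w'" "w' \<in># wprods br u (snd p)"
    unfolding wprods.simps by (fastforce simp del: splits.simps)
  then show ?case
  proof cases
    case 1
    then show ?thesis using 3 by auto
  next
    case 2
    then show ?thesis using 3(2)[of p w'] 3(3,4,6) *[of p] by auto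
  qed
qed auto

text \<open>A letter leaves \<open>u\<close> only as the first entry of a brace, which itself
  becomes a letter of the product word. This is the combinatorial source of right-sidedness; there
  is no such bound by the length of \<open>v\<close>, whose letters are absorbed by braces.\<close>

lemma wprods_length: "w \<in># wprods br u v \<Longrightarrow> length u \<le> length w"
proof (induction br u v arbitrary: w rule: wprods.induct)
  case (3 br x u z v)
  from 3(3) consider w' where "w = z # w'" "w' \<in># wprods br (x # u) v"
    | p w' where "p \<in># splits (z # v)" "w = br x (fst p) # w'" "w' \<in># wprods br u (snd p)"
    unfolding wprods.simps by (fastforce simp del: splits.simps)
  then show ?case
  proof cases
    case 1
    then show ?thesis using 3(1)[of w'] by simp
  next
    case 2
    then show ?thesis using 3(2)[of p w'] by simp
  qed
qed auto

text \<open>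
  The two bracketings of a triple product satisfy the same recursion up to the brace identity.
\<close>

definition wprods_left where "wprods_left br u v w = (\<Sum>a \<in># wprods br u v. wprods br a w)"
definition wprods_right where "wprods_right br u v w = (\<Sum>b \<in># wprods br v w. wprods br u b)"

lemma sum_image_Cons_wprods:
  "(\<Sum>a \<in># image_mset ((#) y) M. wprods br a (c # w)) =
     image_mset ((#) c) (\<Sum>a \<in># image_mset ((#) y) M. wprods br a w) +
     (\<Sum>k \<in># splits (c # w). image_mset ((#) (br y (fst k))) (\<Sum>a \<in># M. wprods br a (snd k)))"
  unfolding multiset.map_comp comp_def wprods.simps sum_mset.distrib image_mset_sum_mset
  by (rule arg_cong2[of _ _ _ _ "(+)", OF refl sum_mset.swap])

text \<open>The three sums are sorted by the origin of the first letter: a letter of the third word;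
  a letter of the second word that absorbs a prefix of the third; or \<open>x\<close>, which absorbs
  a prefix of the second word in the first product and a prefix of the third word in the
  next.\<close>

lemma wprods_left_rec:
  "wprods_left br (x # u) (z # v) (c # w) = image_mset ((#) c) (wprods_left br (x # u) (z # v) w) +
     (\<Sum>k \<in># splits (c # w). image_mset ((#) (br z (fst k))) (wprods_left br (x # u) v (snd k))) +
     (\<Sum>j \<in># splits (z # v). \<Sum>k \<in># splits (c # w).
        image_mset ((#) (br (br x (fst j)) (fst k))) (wprods_left br u (snd j) (snd k)))"
  unfolding wprods_left_def wprods.simps(3)[of br x u z v] image_mset_union sum_mset.union sum_mset_sum_mset
    sum_image_Cons_wprods sum_mset.distrib image_mset_sum_mset[of "(#) c"]
  by (simp only: ac_simps)

text \<open>The shape is that of \<open>wprods_left_rec\<close> except in the last sum, where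
  \<open>x\<close> absorbs a prefix of a product. By \<open>splits_wprods\<close> such a prefix is a
  product of prefixes, so the brace identity is exactly what the two last sums need in order to
  match.\<close>

lemma wprods_right_rec:
  "wprods_right br (x # u) (z # v) (c # w) = image_mset ((#) c) (wprods_right br (x # u) (z # v) w) +
     (\<Sum>k \<in># splits (c # w). image_mset ((#) (br z (fst k))) (wprods_right br (x # u) v (snd k))) +
     (\<Sum>j \<in># splits (z # v). \<Sum>k \<in># splits (c # w). \<Sum>b \<in># wprods br (fst j) (fst k).
        image_mset ((#) (br x b)) (wprods_right br u (snd j) (snd k)))"
proof -
  let ?F = "\<lambda>p. image_mset ((#) (br x (fst p))) (wprods br u (snd p))"
  have 1: "(\<Sum>b \<in># image_mset ((#) y) M. wprods br (x # u) b) =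
    image_mset ((#) y) (\<Sum>b \<in># M. wprods br (x # u) b) +
    (\<Sum>b \<in># image_mset ((#) y) M. \<Sum>p \<in># splits b. ?F p)" for y and M :: "'a list multiset"
    unfolding multiset.map_comp comp_def wprods.simps sum_mset.distrib image_mset_sum_mset ..
  have 2: "(\<Sum>p \<in># pairs M N. ?F p) =
     (\<Sum>b \<in># M. image_mset ((#) (br x b)) (\<Sum>b \<in># N. wprods br u b))" for M N
    by (induction M) (simp_all add: multiset.map_comp comp_def image_mset_sum_mset)
  have "wprods_right br (x # u) (z # v) (c # w) = image_mset ((#) c) (wprods_right br (x # u) (z # v) w) +
     (\<Sum>k \<in># splits (c # w). image_mset ((#) (br z (fst k))) (wprods_right br (x # u) v (snd k))) +
     (\<Sum>b \<in># wprods br (z # v) (c # w). \<Sum>p \<in># splits b. ?F p)"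
    unfolding wprods_right_def wprods.simps(3)[of br z v c w] image_mset_union sum_mset.union sum_mset_sum_mset
      1 sum_mset.distrib image_mset_sum_mset[of "(#) c"]
    by (simp only: ac_simps)
  also have "(\<Sum>b \<in># wprods br (z # v) (c # w). \<Sum>p \<in># splits b. ?F p) =
    (\<Sum>p \<in># (\<Sum>b \<in># wprods br (z # v) (c # w). splits b). ?F p)"
    by (simp only: sum_mset_sum_mset)
  also have "\<dots> = (\<Sum>j \<in># splits (z # v). \<Sum>k \<in># splits (c # w). \<Sum>b \<in># wprods br (fst j) (fst k).
        image_mset ((#) (br x b)) (wprods_right br u (snd j) (snd k)))"
    unfolding splits_wprods sum_mset_sum_mset 2 wprods_right_def ..
  finally show ?thesis .
qed

section \<open>The index sum of the brace identity as a product of words\<close>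

definition brace_indices_from :: "nat \<Rightarrow> nat \<Rightarrow> nat \<Rightarrow> (nat list \<times> nat list) set"
  where "brace_indices_from j0 n m = {(is, js). length is = n \<and> length js = n \<and>
    (\<forall>k < n. (j0 # js) ! k \<le> is ! k \<and> is ! k \<le> js ! k \<and> js ! k \<le> m)}"

definition brace_word ::
    "('a \<Rightarrow> 'a list \<Rightarrow> 'a) \<Rightarrow> nat \<Rightarrow> 'a list \<Rightarrow> 'a list \<Rightarrow> nat list \<Rightarrow> nat list \<Rightarrow> 'a list"
  where "brace_word br j0 ys zs is js =
    concat (map (\<lambda>k. slice ((j0 # js) ! k) (is ! k) zs @ [br (ys ! k) (slice (is ! k) (js ! k) zs)])
       [0..<length ys])
     @ drop ((j0 # js) ! length ys) zs"

text \<open>After removal of the first inner brace the remaining index lists start at its right end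
  \<open>j\<close>. The induction on the inner braces therefore needs an arbitrary starting position
  \<open>j0\<close> in place of the 0 of \<open>brace_indices\<close>.\<close>

lemma brace_indices_from_Suc:
  "brace_indices_from j0 (Suc n) m =
    (\<lambda>(i, j, p). (i # fst p, j # snd p)) ` (SIGMA i:{j0..m}. SIGMA j:{i..m}. brace_indices_from j n m)"
  (is "?L = ?f ` ?R")
proof
  show "?L \<subseteq> ?f ` ?R"
  proof
    fix q assume q: "q \<in> ?L"
    then obtain i "is" j js where [simp]: "q = (i # is, j # js)"
      by (auto simp: brace_indices_from_def length_Suc_conv)
    have "j0 \<le> i" "i \<le> j" "j \<le> m" "(is, js) \<in> brace_indices_from j n m"
      using q by (auto simp: brace_indices_from_def All_less_Suc2)
    then show "q \<in> ?f ` ?R"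
      by (auto intro!: image_eqI[of _ _ "(i, j, (is, js))"])
  qed
  show "?f ` ?R \<subseteq> ?L"
    by (auto simp: brace_indices_from_def All_less_Suc2)
qed

lemma finite_brace_indices_from: "finite (brace_indices_from j0 n m)"
proof (induction n arbitrary: j0)
  case 0
  have "brace_indices_from j0 0 m = {([], [])}"
    by (auto simp: brace_indices_from_def)
  then show ?case by simp
qed (auto simp: brace_indices_from_Suc)

lemma brace_word_Cons:
  "brace_word br j0 (y # ys) zs (i # is) (j # js) =
     slice j0 i zs @ br y (slice i j zs) # brace_word br j ys zs is js"
proof -
  have *: "[0..<length (y # ys)] = 0 # map Suc [0..<length ys]"
    by (metis length_Cons map_Suc_upt upt_conv_Cons zero_less_Suc)
  show ?thesis
    unfolding brace_word_def * list.map map_map comp_def by simp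
qed

text \<open>The cuts of a suffix are indexed by absolute positions \<open>j\<close> in
  \<open>zs\<close>, to agree with the index lists of the brace identity.\<close>

lemma splits_drop:
  "j0 \<le> length zs \<Longrightarrow> splits (drop j0 zs) = (\<Sum>j \<in> {j0..length zs}. {#(slice j0 j zs, drop j zs)#})"
proof -
  assume j0: "j0 \<le> length zs"
  have "splits (drop j0 zs) = (\<Sum>i \<in> {..length zs - j0}. {#(take i (drop j0 zs), drop i (drop j0 zs))#})"
    by (subst splits_take_drop) (simp add: sum_unfold_sum_mset)
  also have "\<dots> = (\<Sum>j \<in> {j0..length zs}. {#(slice j0 j zs, drop j zs)#})"
    by (rule sum.reindex_bij_witness[of _ "\<lambda>j. j - j0" "\<lambda>i. i + j0"])
      (use j0 in \<open>auto simp: slice_def\<close>)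
  finally show ?thesis .
qed

lemma sum_mset_sum:
  fixes f :: "'i \<Rightarrow> 'b::comm_monoid_add"
  shows "finite A \<Longrightarrow> (\<Sum>i \<in># (\<Sum>x \<in> A. N x). f i) = (\<Sum>x \<in> A. \<Sum>i \<in># N x. f i)"
  by (induction A rule: finite_induct) auto

lemma image_mset_sum: "image_mset f (\<Sum>x \<in> A. N x) = (\<Sum>x \<in> A. image_mset f (N x))"
  by (rule sum_comp_morphism[of "image_mset f" N A, unfolded comp_def, symmetric]) auto

text \<open>Unfolds the first alternative of the recursion until \<open>y\<close> is used:
  \<open>i\<close> is the position in \<open>zs\<close> reached by then, and \<open>y\<close>
  absorbs the letters from \<open>i\<close> up to \<open>j\<close>. The induction runs downwards
  from the end of \<open>zs\<close>.\<close>

lemma wprods_Cons_drop: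
  "j0 \<le> length zs \<Longrightarrow> wprods br (y # ys) (drop j0 zs) = (\<Sum>i \<in> {j0..length zs}. \<Sum>j \<in> {i..length zs}.
     image_mset (\<lambda>w. slice j0 i zs @ br y (slice i j zs) # w) (wprods br ys (drop j zs)))"
proof (induction j0 rule: inc_induct)
  case base
  then show ?case by (simp add: slice_def)
next
  case (step j0)
  then have d: "drop j0 zs = zs ! j0 # drop (Suc j0) zs"
    by (metis Cons_nth_drop_Suc)
  have s: "slice j0 i zs = zs ! j0 # slice (Suc j0) i zs" if "Suc j0 \<le> i" for i
    unfolding slice_def d using that by (simp add: take_Cons' Suc_diff_le)
  have "wprods br (y # ys) (drop j0 zs) = image_mset ((#) (zs ! j0)) (wprods br (y # ys) (drop (Suc j0) zs)) +
     (\<Sum>p \<in># splits (drop j0 zs). image_mset ((#) (br y (fst p))) (wprods br ys (snd p)))"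
    by (simp add: d)
  \<comment> \<open>These are the terms with \<open>i = j0\<close>, where \<open>y\<close> is used
    at once; the induction hypothesis supplies those with \<open>i\<close> at least
    \<open>Suc j0\<close>.\<close>
  also have "(\<Sum>p \<in># splits (drop j0 zs). image_mset ((#) (br y (fst p))) (wprods br ys (snd p))) =
    (\<Sum>j \<in> {j0..length zs}. image_mset (\<lambda>w. slice j0 j0 zs @ br y (slice j0 j zs) # w) (wprods br ys (drop j zs)))"
    by (subst splits_drop) (use step in \<open>auto simp: sum_mset_sum slice_def[of j0 j0] less_imp_le\<close>)
  also have "image_mset ((#) (zs ! j0)) (wprods br (y # ys) (drop (Suc j0) zs)) =
    (\<Sum>i \<in> {Suc j0..length zs}. \<Sum>j \<in> {i..length zs}.
     image_mset (\<lambda>w. slice j0 i zs @ br y (slice i j zs) # w) (wprods br ys (drop j zs)))"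
    unfolding step.IH image_mset_sum multiset.map_comp comp_def
    by (intro sum.cong refl image_mset_cong) (simp add: s)
  also have "\<dots> + (\<Sum>j \<in> {j0..length zs}. image_mset (\<lambda>w. slice j0 j0 zs @ br y (slice j0 j zs) # w) (wprods br ys (drop j zs)))
    = (\<Sum>i \<in> {j0..length zs}. \<Sum>j \<in> {i..length zs}.
     image_mset (\<lambda>w. slice j0 i zs @ br y (slice i j zs) # w) (wprods br ys (drop j zs)))"
    using step by (subst add.commute) (intro sum.atLeast_Suc_atMost[symmetric], simp)
  finally show ?case .
qed

text \<open>Iterates \<open>wprods_Cons_drop\<close> along \<open>ys\<close>: each pair of index
  lists records one way of running through the recursion of \<open>wprods\<close>. The equality is
  one of multisets, so that equal words arising from different indices are counted
  correctly.\<close>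

lemma sum_brace_word:
  "j0 \<le> length zs \<Longrightarrow> (\<Sum>p \<in> brace_indices_from j0 (length ys) (length zs).
     {#brace_word br j0 ys zs (fst p) (snd p)#}) = wprods br ys (drop j0 zs)"
proof (induction ys arbitrary: j0)
  case Nil
  have "brace_indices_from j0 0 (length zs) = {([], [])}"
    by (auto simp: brace_indices_from_def)
  then show ?case by (simp add: brace_word_def)
next
  case (Cons y ys)
  let ?m = "length zs"
  have inj: "inj_on (\<lambda>(i, j, p). (i # fst p, j # snd p)) A" for A :: "(nat \<times> nat \<times> nat list \<times> nat list) set"
    by (auto simp: inj_on_def)
  have "(\<Sum>p \<in> brace_indices_from j0 (length (y # ys)) ?m. {#brace_word br j0 (y # ys) zs (fst p) (snd p)#})
    = (\<Sum>i \<in> {j0..?m}. \<Sum>j \<in> {i..?m}. \<Sum>p \<in> brace_indices_from j (length ys) ?m.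
       {#slice j0 i zs @ br y (slice i j zs) # brace_word br j ys zs (fst p) (snd p)#})"
    using inj by (simp add: brace_indices_from_Suc sum.reindex comp_def sum.Sigma
      finite_brace_indices_from split_def brace_word_Cons)
  also have "\<dots> = (\<Sum>i \<in> {j0..?m}. \<Sum>j \<in> {i..?m}.
     image_mset (\<lambda>w. slice j0 i zs @ br y (slice i j zs) # w) (wprods br ys (drop j zs)))"
  proof (intro sum.cong refl)
    fix i j assume "i \<in> {j0..?m}" "j \<in> {i..?m}"
    then have "wprods br ys (drop j zs) = (\<Sum>p \<in> brace_indices_from j (length ys) (length zs).
     {#brace_word br j ys zs (fst p) (snd p)#})"
      using Cons by simp
    then show "(\<Sum>p \<in> brace_indices_from j (length ys) ?m.
       {#slice j0 i zs @ br y (slice i j zs) # brace_word br j ys zs (fst p) (snd p)#}) =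
      image_mset (\<lambda>w. slice j0 i zs @ br y (slice i j zs) # w) (wprods br ys (drop j zs))"
      by (simp only: image_mset_sum image_mset_single)
  qed
  also have "\<dots> = wprods br (y # ys) (drop j0 zs)"
    using Cons.prems by (simp add: wprods_Cons_drop)
  finally show ?case .
qed

lemma brace_indices_eq: "brace_indices n m = brace_indices_from 0 n m"
  unfolding brace_indices_from_def brace_indices_def ..

text \<open>With this the brace identity reads: {{x; ys}; zs} is the sum of {x; w} over the words w
  of the product of ys and zs.\<close>

lemma brace_words:
  "image_mset (\<lambda>p. brace_word br 0 ys zs (fst p) (snd p))
     (mset_set (brace_indices (length ys) (length zs))) = wprods br ys zs"
  using sum_brace_word[of 0 zs br ys]
  unfolding sum_unfold_sum_mset sum_mset_singleton_mset drop_0 brace_indices_eq by blast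

lemma brace_term_eq: "brace_term br x ys zs is js = br x (brace_word br 0 ys zs is js)"
  unfolding brace_term_def brace_word_def ..

lemma finite_brace_indices: "finite (brace_indices n m)"
  unfolding brace_indices_eq by (rule finite_brace_indices_from)

section \<open>Linear maps and presented spaces\<close>

lemma (in abelian_group) minus_eq_zero_iff:
  assumes "a \<in> carrier G" "b \<in> carrier G"
  shows "a \<ominus> b = \<zero> \<longleftrightarrow> a = b"
  using assms by (metis a_minus_def add.inv_closed minus_equality minus_minus r_neg)

lemma lin_mapsI:
  assumes "\<And>x. x \<in> carrier V \<Longrightarrow> f x \<in> carrier W"
    and "\<And>x y. x \<in> carrier V \<Longrightarrow> y \<in> carrier V \<Longrightarrow> f (x \<oplus>\<^bsub>V\<^esub> y) = f x \<oplus>\<^bsub>W\<^esub> f y"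
    and "\<And>a x. a \<in> carrier K \<Longrightarrow> x \<in> carrier V \<Longrightarrow> f (a \<odot>\<^bsub>V\<^esub> x) = a \<odot>\<^bsub>W\<^esub> f x"
  shows "f \<in> lin_maps K V W"
  using assms by (auto simp: lin_maps_def)

lemma lin_closed: "f \<in> lin_maps K V W \<Longrightarrow> x \<in> carrier V \<Longrightarrow> f x \<in> carrier W"
  and lin_add: "f \<in> lin_maps K V W \<Longrightarrow> x \<in> carrier V \<Longrightarrow> y \<in> carrier V \<Longrightarrow>
    f (x \<oplus>\<^bsub>V\<^esub> y) = f x \<oplus>\<^bsub>W\<^esub> f y"
  and lin_smult: "f \<in> lin_maps K V W \<Longrightarrow> a \<in> carrier K \<Longrightarrow> x \<in> carrier V \<Longrightarrow>
    f (a \<odot>\<^bsub>V\<^esub> x) = a \<odot>\<^bsub>W\<^esub> f x"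
  by (auto simp: lin_maps_def)

lemma lin_zero:
  assumes "module K V" "module K W" "f \<in> lin_maps K V W"
  shows "f \<zero>\<^bsub>V\<^esub> = \<zero>\<^bsub>W\<^esub>"
proof -
  interpret V: module K V by fact
  interpret W: module K W by fact
  have "f \<zero>\<^bsub>V\<^esub> = f (\<zero>\<^bsub>K\<^esub> \<odot>\<^bsub>V\<^esub> \<zero>\<^bsub>V\<^esub>)" by (simp add: V.smult_r_null)
  also have "\<dots> = \<zero>\<^bsub>W\<^esub>"
    using lin_smult[OF assms(3), of "\<zero>\<^bsub>K\<^esub>" "\<zero>\<^bsub>V\<^esub>"] lin_closed[OF assms(3)] by (simp add: W.smult_l_null)
  finally show ?thesis .
qed

lemma lin_uminus:
  assumes "module K V" "module K W" "f \<in> lin_maps K V W" "x \<in> carrier V"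
  shows "f (\<ominus>\<^bsub>V\<^esub> x) = \<ominus>\<^bsub>W\<^esub> f x"
proof -
  interpret V: module K V by fact
  interpret W: module K W by fact
  have "f (\<ominus>\<^bsub>V\<^esub> x) \<oplus>\<^bsub>W\<^esub> f x = \<zero>\<^bsub>W\<^esub>"
    using assms lin_add[OF assms(3), of "\<ominus>\<^bsub>V\<^esub> x" x] by (simp add: V.l_neg lin_zero)
  then show ?thesis
    using assms(3,4) by (simp add: W.minus_equality lin_closed[OF assms(3)])
qed

lemma lin_minus:
  assumes "module K V" "module K W" "f \<in> lin_maps K V W" "x \<in> carrier V" "y \<in> carrier V"
  shows "f (x \<ominus>\<^bsub>V\<^esub> y) = f x \<ominus>\<^bsub>W\<^esub> f y"
proof -
  interpret V: module K V by fact
  interpret W: module K W by fact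
  show ?thesis
    using assms lin_add[OF assms(3), of x "\<ominus>\<^bsub>V\<^esub> y"] by (simp add: a_minus_def lin_uminus)
qed

lemma lin_comp:
  assumes "f \<in> lin_maps K V W" "g \<in> lin_maps K W U"
  shows "(\<lambda>x. g (f x)) \<in> lin_maps K V U"
  using assms by (auto simp: lin_maps_def Pi_def)

lemma lin_cong:
  assumes "module K V" "f \<in> lin_maps K V W" "\<And>x. x \<in> carrier V \<Longrightarrow> f x = g x"
  shows "g \<in> lin_maps K V W"
proof -
  interpret V: module K V by fact
  show ?thesis
  proof (rule lin_mapsI)
    fix x assume "x \<in> carrier V"
    then show "g x \<in> carrier W" using assms(3) lin_closed[OF assms(2)] by metis
  next
    fix x y assume "x \<in> carrier V" "y \<in> carrier V"
    then show "g (x \<oplus>\<^bsub>V\<^esub> y) = g x \<oplus>\<^bsub>W\<^esub> g y"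
      using assms(3) lin_add[OF assms(2)] V.add.m_closed by metis
  next
    fix a x assume "a \<in> carrier K" "x \<in> carrier V"
    then show "g (a \<odot>\<^bsub>V\<^esub> x) = a \<odot>\<^bsub>W\<^esub> g x"
      using assms(3) lin_smult[OF assms(2)] V.smult_closed by metis
  qed
qed

lemma lin_id: "(\<lambda>x. x) \<in> lin_maps K V V"
  by (simp add: lin_maps_def)

lemma lin_zero_map:
  assumes "module K W"
  shows "(\<lambda>x. \<zero>\<^bsub>W\<^esub>) \<in> lin_maps K V W"
proof -
  interpret W: module K W by fact
  show ?thesis by (rule lin_mapsI) (auto simp: W.smult_r_null)
qed

lemma lin_add_map:
  assumes "module K W" "f \<in> lin_maps K V W" "g \<in> lin_maps K V W"
  shows "(\<lambda>x. f x \<oplus>\<^bsub>W\<^esub> g x) \<in> lin_maps K V W"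
proof -
  interpret W: module K W by fact
  show ?thesis
    using lin_closed[OF assms(2)] lin_closed[OF assms(3)] lin_add[OF assms(2)] lin_add[OF assms(3)]
      lin_smult[OF assms(2)] lin_smult[OF assms(3)]
    by (intro lin_mapsI) (auto simp: W.smult_r_distr W.a_ac)
qed

lemma lin_smult_map:
  assumes "module K W" "f \<in> lin_maps K V W" "a \<in> carrier K"
  shows "(\<lambda>x. a \<odot>\<^bsub>W\<^esub> f x) \<in> lin_maps K V W"
proof -
  interpret W: module K W by fact
  show ?thesis
    using lin_closed[OF assms(2)] lin_add[OF assms(2)] lin_smult[OF assms(2)] assms(3)
    by (intro lin_mapsI) (auto simp: W.smult_r_distr W.m_comm simp flip: W.smult_assoc1)
qed

lemma lin_uminus_map:
  assumes "module K W" "f \<in> lin_maps K V W"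
  shows "(\<lambda>x. \<ominus>\<^bsub>W\<^esub> f x) \<in> lin_maps K V W"
proof -
  interpret W: module K W by fact
  show ?thesis
    using lin_closed[OF assms(2)] lin_add[OF assms(2)] lin_smult[OF assms(2)]
    by (intro lin_mapsI) (auto simp: W.minus_add W.smult_r_minus)
qed

text \<open>
  Terms outside the carrier count as \<open>\<zero>\<close>, which makes most identities for \<open>msum\<close> unconditional.
\<close>

definition msum :: "('w, 'n) ring_scheme \<Rightarrow> ('i \<Rightarrow> 'w) \<Rightarrow> 'i multiset \<Rightarrow> 'w"
  where "msum W g M = fold_mset
    (\<lambda>i s. if s \<in> carrier W then (if g i \<in> carrier W then g i else \<zero>\<^bsub>W\<^esub>) \<oplus>\<^bsub>W\<^esub> s else s) \<zero>\<^bsub>W\<^esub> M"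

context abelian_monoid
begin

lemma msum_empty [simp]: "msum G g {#} = \<zero>"
  by (simp add: msum_def)

lemma msum_add_mset_aux:
  "msum G g M \<in> carrier G \<and>
   msum G g (add_mset i M) = (if g i \<in> carrier G then g i else \<zero>) \<oplus> msum G g M"
proof -
  let ?f = "\<lambda>i s. if s \<in> carrier G then (if g i \<in> carrier G then g i else \<zero>) \<oplus> s else s"
  \<comment> \<open>Commutation is demanded for every \<open>s\<close>, also outside the carrier;
    the test on \<open>s\<close> in the definition makes the function the identity there.\<close>
  interpret comp_fun_commute ?f
    by unfold_locales (auto simp: fun_eq_iff a_ac)
  have "msum G g M \<in> carrier G" for M
    by (induction M) (auto simp: msum_def)
  then show ?thesis
    by (auto simp: msum_def)
qed

lemma msum_closed [simp, intro]: "msum G g M \<in> carrier G"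
  by (rule conjunct1[OF msum_add_mset_aux])

lemma msum_add_mset [simp]: "g i \<in> carrier G \<Longrightarrow> msum G g (add_mset i M) = g i \<oplus> msum G g M"
  using conjunct2[OF msum_add_mset_aux, of g i M] by simp

lemma msum_union: "msum G g (M + N) = msum G g M \<oplus> msum G g N"
  by (induction M) (auto simp: msum_add_mset_aux a_ac)

lemma msum_image_mset: "msum G g (image_mset h M) = msum G (\<lambda>i. g (h i)) M"
  by (induction M) (auto simp: msum_add_mset_aux)

lemma msum_sum_mset: "msum G g (\<Sum>x \<in># M. N x) = msum G (\<lambda>x. msum G g (N x)) M"
  by (induction M) (auto simp: msum_union)

lemma msum_cong: "M = N \<Longrightarrow> (\<And>x. x \<in># N \<Longrightarrow> g x = h x) \<Longrightarrow> msum G g M = msum G h N"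
  by (induction N arbitrary: M) (auto simp: msum_add_mset_aux)

lemma msum_add:
  "(\<And>x. x \<in># M \<Longrightarrow> f x \<in> carrier G) \<Longrightarrow> (\<And>x. x \<in># M \<Longrightarrow> g x \<in> carrier G) \<Longrightarrow>
   msum G (\<lambda>x. f x \<oplus> g x) M = msum G f M \<oplus> msum G g M"
  by (induction M) (auto simp: a_ac)

lemma msum_zero: "(\<And>x. x \<in># M \<Longrightarrow> g x = \<zero>) \<Longrightarrow> msum G g M = \<zero>"
  by (induction M) auto

lemma finsum_msum: "finite A \<Longrightarrow> g \<in> A \<rightarrow> carrier G \<Longrightarrow> finsum G g A = msum G g (mset_set A)"
  by (induction A rule: finite_induct) auto

end

lemma lin_msum:
  assumes "module K V" "module K W" "f \<in> lin_maps K V W" "\<And>i. i \<in># M \<Longrightarrow> g i \<in> carrier V"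
  shows "f (msum V g M) = msum W (\<lambda>i. f (g i)) M"
proof -
  interpret V: module K V by fact
  interpret W: module K W by fact
  show ?thesis
    using assms(4)
    by (induction M) (auto simp: lin_zero[OF assms(1-3)] lin_add[OF assms(3)] lin_closed[OF assms(3)])
qed

lemma lin_msum_map:
  assumes "module K W" "\<And>i. i \<in># M \<Longrightarrow> (\<lambda>x. f x i) \<in> lin_maps K V W"
  shows "(\<lambda>x. msum W (f x) M) \<in> lin_maps K V W"
proof -
  interpret W: module K W by fact
  have c: "(\<And>i. i \<in># M \<Longrightarrow> f x i \<in> carrier W)" if "x \<in> carrier V" for x
    using lin_closed[OF assms(2)] that by blast
  show ?thesis
  proof (rule lin_mapsI)
    fix x y assume xy: "x \<in> carrier V" "y \<in> carrier V"
    have "msum W (f (x \<oplus>\<^bsub>V\<^esub> y)) M = msum W (\<lambda>i. f x i \<oplus>\<^bsub>W\<^esub> f y i) M"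
      using xy lin_add[OF assms(2)] by (intro W.msum_cong) auto
    then show "msum W (f (x \<oplus>\<^bsub>V\<^esub> y)) M = msum W (f x) M \<oplus>\<^bsub>W\<^esub> msum W (f y) M"
      using c xy by (simp add: W.msum_add)
  next
    fix a x assume ax: "a \<in> carrier K" "x \<in> carrier V"
    have "msum W (f (a \<odot>\<^bsub>V\<^esub> x)) M = msum W (\<lambda>i. a \<odot>\<^bsub>W\<^esub> f x i) M"
      using ax lin_smult[OF assms(2)] by (intro W.msum_cong) auto
    also have "\<dots> = a \<odot>\<^bsub>W\<^esub> msum W (f x) M"
      using lin_msum[OF assms(1) assms(1) lin_smult_map[OF assms(1) lin_id ax(1)], of M "f x"] c ax
      by simp
    finally show "msum W (f (a \<odot>\<^bsub>V\<^esub> x)) M = a \<odot>\<^bsub>W\<^esub> msum W (f x) M" .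
  qed simp
qed

section \<open>Free spaces, quotients, and presentations by generators and relations\<close>

lemma module_free_space:
  fixes X :: "'x set"
  assumes "cring K"
  shows "module K (free_space K X)"
proof -
  interpret K: cring K by fact
  let ?F = "free_space K X"
  have s: "finite {x. f x \<oplus>\<^bsub>K\<^esub> g x \<noteq> \<zero>\<^bsub>K\<^esub>}" if "finite {x. f x \<noteq> \<zero>\<^bsub>K\<^esub>}" "finite {x. g x \<noteq> \<zero>\<^bsub>K\<^esub>}" for f g :: "'x \<Rightarrow> _"
    by (rule finite_subset[OF _ finite_UnI[OF that]]) auto
  have m: "finite {x. a \<otimes>\<^bsub>K\<^esub> f x \<noteq> \<zero>\<^bsub>K\<^esub>}" if "finite {x. f x \<noteq> \<zero>\<^bsub>K\<^esub>}" "a \<in> carrier K" for a and f :: "'x \<Rightarrow> _"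
    by (rule finite_subset[OF _ that(1)]) (use that in auto)
  have c: "f x \<in> carrier K" if "f \<in> carrier ?F" for f x
    using that by (cases "x \<in> X") (auto simp: free_space_def)
  have add: "(f \<oplus>\<^bsub>?F\<^esub> g) x = f x \<oplus>\<^bsub>K\<^esub> g x" and zero: "\<zero>\<^bsub>?F\<^esub> x = \<zero>\<^bsub>K\<^esub>"
    and smult: "(a \<odot>\<^bsub>?F\<^esub> f) x = a \<otimes>\<^bsub>K\<^esub> f x" for f g a x
    by (simp_all add: free_space_def)
  have ab: "abelian_group ?F"
  proof (rule abelian_groupI)
    fix f g assume "f \<in> carrier ?F" "g \<in> carrier ?F"
    then show "f \<oplus>\<^bsub>?F\<^esub> g \<in> carrier ?F"
      by (auto simp: free_space_def s)
  next
    show "\<zero>\<^bsub>?F\<^esub> \<in> carrier ?F" by (simp add: free_space_def)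
  next
    fix f g h assume "f \<in> carrier ?F" "g \<in> carrier ?F" "h \<in> carrier ?F"
    note this[THEN c]
    then show "f \<oplus>\<^bsub>?F\<^esub> g \<oplus>\<^bsub>?F\<^esub> h = f \<oplus>\<^bsub>?F\<^esub> (g \<oplus>\<^bsub>?F\<^esub> h)"
      by (intro ext) (simp add: add K.a_assoc)
  next
    fix f g assume "f \<in> carrier ?F" "g \<in> carrier ?F"
    note this[THEN c]
    then show "f \<oplus>\<^bsub>?F\<^esub> g = g \<oplus>\<^bsub>?F\<^esub> f"
      by (intro ext) (simp add: add K.a_comm)
  next
    fix f assume f: "f \<in> carrier ?F"
    note c[OF f]
    then show "\<zero>\<^bsub>?F\<^esub> \<oplus>\<^bsub>?F\<^esub> f = f"
      by (intro ext) (simp add: add zero)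
    have "(\<ominus>\<^bsub>K\<^esub> \<one>\<^bsub>K\<^esub>) \<odot>\<^bsub>?F\<^esub> f \<in> carrier ?F"
      using m[of f "\<ominus>\<^bsub>K\<^esub> \<one>\<^bsub>K\<^esub>"] f by (auto simp: free_space_def)
    moreover have "(\<ominus>\<^bsub>K\<^esub> \<one>\<^bsub>K\<^esub>) \<odot>\<^bsub>?F\<^esub> f \<oplus>\<^bsub>?F\<^esub> f = \<zero>\<^bsub>?F\<^esub>"
      using c[OF f] by (intro ext) (simp add: add smult zero K.l_minus K.l_neg)
    ultimately show "\<exists>y \<in> carrier ?F. y \<oplus>\<^bsub>?F\<^esub> f = \<zero>\<^bsub>?F\<^esub>" by blast
  qed
  show ?thesis
  proof (rule moduleI[OF assms ab])
    fix a f assume "a \<in> carrier K" "f \<in> carrier ?F"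
    then show "a \<odot>\<^bsub>?F\<^esub> f \<in> carrier ?F"
      by (auto simp: free_space_def m)
  next
    fix a b f assume ab: "a \<in> carrier K" "b \<in> carrier K" and f: "f \<in> carrier ?F"
    show "(a \<oplus>\<^bsub>K\<^esub> b) \<odot>\<^bsub>?F\<^esub> f = a \<odot>\<^bsub>?F\<^esub> f \<oplus>\<^bsub>?F\<^esub> b \<odot>\<^bsub>?F\<^esub> f"
      using ab c[OF f] by (intro ext) (simp add: add smult K.l_distr)
    show "a \<otimes>\<^bsub>K\<^esub> b \<odot>\<^bsub>?F\<^esub> f = a \<odot>\<^bsub>?F\<^esub> (b \<odot>\<^bsub>?F\<^esub> f)"
      using ab c[OF f] by (intro ext) (simp add: smult K.m_assoc)
  next
    fix a f g assume a: "a \<in> carrier K" and f: "f \<in> carrier ?F" and g: "g \<in> carrier ?F"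
    show "a \<odot>\<^bsub>?F\<^esub> (f \<oplus>\<^bsub>?F\<^esub> g) = a \<odot>\<^bsub>?F\<^esub> f \<oplus>\<^bsub>?F\<^esub> a \<odot>\<^bsub>?F\<^esub> g"
      using a c[OF f] c[OF g] by (intro ext) (simp add: add smult K.r_distr)
  next
    fix f assume f: "f \<in> carrier ?F"
    show "\<one>\<^bsub>K\<^esub> \<odot>\<^bsub>?F\<^esub> f = f"
      using c[OF f] by (intro ext) (simp add: smult)
  qed
qed

lemma free_space_carrier:
  assumes "cring K" "f \<in> carrier (free_space K X)"
  shows "f x \<in> carrier K" "finite {x. f x \<noteq> \<zero>\<^bsub>K\<^esub>}" "{x. f x \<noteq> \<zero>\<^bsub>K\<^esub>} \<subseteq> X"
proof -
  interpret K: cring K by fact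
  show "f x \<in> carrier K" "finite {x. f x \<noteq> \<zero>\<^bsub>K\<^esub>}" "{x. f x \<noteq> \<zero>\<^bsub>K\<^esub>} \<subseteq> X"
    using assms(2) by (cases "x \<in> X"; auto simp: free_space_def)+
qed

lemma single_closed:
  assumes "cring K" "x \<in> X"
  shows "single K x \<in> carrier (free_space K X)"
proof -
  interpret K: cring K by fact
  have "finite {y. single K x y \<noteq> \<zero>\<^bsub>K\<^esub>}"
    by (rule finite_subset[of _ "{x}"]) (auto simp: single_def)
  then show ?thesis
    using assms(2) by (auto simp: free_space_def) (auto simp: single_def)
qed

text \<open>The sum may run over any finite set of generators that contains the support, so that two
  functions can be summed over a common index set.\<close>

lemma free_ext_eq:
  assumes "module K W" "g \<in> X \<rightarrow> carrier W" "f \<in> carrier (free_space K X)"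
    and "finite A" "{x. f x \<noteq> \<zero>\<^bsub>K\<^esub>} \<subseteq> A" "A \<subseteq> X"
  shows "free_ext K W g f = (\<Oplus>\<^bsub>W\<^esub>x \<in> A. f x \<odot>\<^bsub>W\<^esub> g x)"
proof -
  interpret W: module K W by fact
  note c = free_space_carrier[OF W.is_cring assms(3)]
  have "f x \<odot>\<^bsub>W\<^esub> g x = \<zero>\<^bsub>W\<^esub>" if "x \<in> A - {x. f x \<noteq> \<zero>\<^bsub>K\<^esub>}" for x
    using that assms by (auto simp: W.smult_l_null Pi_def subset_eq)
  then show ?thesis
    unfolding free_ext_def using assms c
    by (intro W.add.finprod_mono_neutral_cong_left) (auto simp: Pi_def subset_eq)
qed

lemma free_ext_lin:
  fixes X :: "'x set"
  assumes "module K W" "g \<in> X \<rightarrow> carrier W"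
  shows "free_ext K W g \<in> lin_maps K (free_space K X) W"
proof -
  interpret W: module K W by fact
  let ?F = "free_space K X" let ?s = "\<lambda>f :: 'x \<Rightarrow> _. {x. f x \<noteq> \<zero>\<^bsub>K\<^esub>}"
  interpret F: module K ?F by (rule module_free_space[OF W.is_cring])
  note c = free_space_carrier[OF W.is_cring]
  have g: "g x \<in> carrier W" if "x \<in> X" for x using that assms by auto
  show ?thesis
  proof (rule lin_mapsI)
    fix f assume f: "f \<in> carrier ?F"
    then show "free_ext K W g f \<in> carrier W"
      using c[OF f] g by (auto simp: free_ext_eq[OF assms f c(2)[OF f] subset_refl c(3)[OF f]] subset_eq)
  next
    fix f h assume f: "f \<in> carrier ?F" and h: "h \<in> carrier ?F"
    let ?A = "?s f \<union> ?s h"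
    have fh: "f \<oplus>\<^bsub>?F\<^esub> h \<in> carrier ?F" using f h by simp
    have A: "finite ?A" "?A \<subseteq> X" using c(2,3)[OF f] c(2,3)[OF h] by auto
    have "?s (f \<oplus>\<^bsub>?F\<^esub> h) \<subseteq> ?A"
      by (auto simp: free_space_def)
    then have "free_ext K W g (f \<oplus>\<^bsub>?F\<^esub> h) = (\<Oplus>\<^bsub>W\<^esub>x \<in> ?A. (f \<oplus>\<^bsub>?F\<^esub> h) x \<odot>\<^bsub>W\<^esub> g x)"
      by (rule free_ext_eq[OF assms fh A(1) _ A(2)])
    also have "\<dots> = (\<Oplus>\<^bsub>W\<^esub>x \<in> ?A. f x \<odot>\<^bsub>W\<^esub> g x \<oplus>\<^bsub>W\<^esub> h x \<odot>\<^bsub>W\<^esub> g x)"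
      using c(1)[OF f] c(1)[OF h] g A(2)
      by (intro W.add.finprod_cong') (auto simp: free_space_def W.smult_l_distr subset_eq)
    also have "\<dots> = (\<Oplus>\<^bsub>W\<^esub>x \<in> ?A. f x \<odot>\<^bsub>W\<^esub> g x) \<oplus>\<^bsub>W\<^esub> (\<Oplus>\<^bsub>W\<^esub>x \<in> ?A. h x \<odot>\<^bsub>W\<^esub> g x)"
      using c(1)[OF f] c(1)[OF h] g A(2) by (intro W.finsum_addf) (auto simp: subset_eq)
    also have "\<dots> = free_ext K W g f \<oplus>\<^bsub>W\<^esub> free_ext K W g h"
      by (subst (1 2) free_ext_eq[OF assms _ A(1) _ A(2)]) (use f h in auto)
    finally show "free_ext K W g (f \<oplus>\<^bsub>?F\<^esub> h) = free_ext K W g f \<oplus>\<^bsub>W\<^esub> free_ext K W g h" .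
  next
    fix a f assume a: "a \<in> carrier K" and f: "f \<in> carrier ?F"
    have af: "a \<odot>\<^bsub>?F\<^esub> f \<in> carrier ?F" using a f by simp
    have "?s (a \<odot>\<^bsub>?F\<^esub> f) \<subseteq> ?s f" using a by (auto simp: free_space_def)
    then have "free_ext K W g (a \<odot>\<^bsub>?F\<^esub> f) = (\<Oplus>\<^bsub>W\<^esub>x \<in> ?s f. (a \<odot>\<^bsub>?F\<^esub> f) x \<odot>\<^bsub>W\<^esub> g x)"
      by (rule free_ext_eq[OF assms af c(2)[OF f] _ c(3)[OF f]])
    also have "\<dots> = (\<Oplus>\<^bsub>W\<^esub>x \<in> ?s f. a \<odot>\<^bsub>W\<^esub> (f x \<odot>\<^bsub>W\<^esub> g x))"
      using c(1,3)[OF f] a g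
      by (intro W.add.finprod_cong') (auto simp: free_space_def W.smult_assoc1 subset_eq)
    also have "\<dots> = a \<odot>\<^bsub>W\<^esub> free_ext K W g f"
      unfolding free_ext_def using c[OF f] a g
      by (intro W.finsum_smult_ldistr[symmetric]) (auto simp: subset_eq)
    finally show "free_ext K W g (a \<odot>\<^bsub>?F\<^esub> f) = a \<odot>\<^bsub>W\<^esub> free_ext K W g f" .
  qed
qed

lemma free_ext_single:
  assumes "module K W" "g \<in> X \<rightarrow> carrier W" "x \<in> X"
  shows "free_ext K W g (single K x) = g x"
proof -
  interpret W: module K W by fact
  have "g x \<in> carrier W" using assms by auto
  moreover have "free_ext K W g (single K x) = (\<Oplus>\<^bsub>W\<^esub>y \<in> {x}. single K x y \<odot>\<^bsub>W\<^esub> g y)"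
    by (rule free_ext_eq[OF assms(1,2) single_closed[OF W.is_cring assms(3)]])
      (use assms in \<open>auto simp: single_def\<close>)
  ultimately show ?thesis by (simp add: single_def)
qed

lemma submodule_lin_span:
  assumes "module K V" "S \<subseteq> carrier V"
  shows "submodule (lin_span K V S) K V"
proof -
  interpret V: module K V by fact
  let ?M = "{N. submodule N K V \<and> S \<subseteq> N}"
  \<comment> \<open>The intersection of an empty family would be the whole type; the carrier is a
    member and bounds it.\<close>
  have c: "carrier V \<in> ?M"
    using assms(2) V.carrier_is_submodule by auto
  show ?thesis
    unfolding lin_span_def hull_def
  proof (rule V.submoduleI)
    show "\<Inter> ?M \<subseteq> carrier V" using c by blast
    show "\<zero>\<^bsub>V\<^esub> \<in> \<Inter> ?M"
      using subgroup.one_closed[OF submodule.axioms(1)] by fastforce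
    show "\<ominus>\<^bsub>V\<^esub> x \<in> \<Inter> ?M" if "x \<in> \<Inter> ?M" for x
      using that V.submoduleE(3) by blast
    show "x \<oplus>\<^bsub>V\<^esub> y \<in> \<Inter> ?M" if "x \<in> \<Inter> ?M" "y \<in> \<Inter> ?M" for x y
      using that V.submoduleE(5) by blast
    show "a \<odot>\<^bsub>V\<^esub> x \<in> \<Inter> ?M" if "a \<in> carrier K" "x \<in> \<Inter> ?M" for a x
      using that V.submoduleE(4) by blast
  qed
qed

lemma lin_span_superset: "S \<subseteq> lin_span K V S"
  by (simp add: lin_span_def hull_subset)

lemma lin_span_minimal: "S \<subseteq> N \<Longrightarrow> submodule N K V \<Longrightarrow> lin_span K V S \<subseteq> N"
  by (simp add: lin_span_def hull_minimal)


lemma submodule_abelian_subgroup: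
  assumes "module K V" "submodule N K V"
  shows "abelian_subgroup N V"
proof -
  interpret V: module K V by fact
  show ?thesis
    using assms(2) V.abelian_group_axioms
    by (intro abelian_subgroupI3) (auto simp: additive_subgroup_def submodule_def)
qed

lemma quot_space_lin:
  assumes "module K V" "submodule N K V"
  shows "module K (quot_space V N)"
    and "(\<lambda>v. N +>\<^bsub>V\<^esub> v) \<in> lin_maps K V (quot_space V N)"
    and "carrier (quot_space V N) = (\<lambda>v. N +>\<^bsub>V\<^esub> v) ` carrier V"
proof -
  interpret V: module K V by fact
  interpret N: abelian_subgroup N V
    by (rule submodule_abelian_subgroup[OF assms])
  let ?Q = "quot_space V N"
  show carr: "carrier ?Q = (\<lambda>v. N +>\<^bsub>V\<^esub> v) ` carrier V"
    by (auto simp: quot_space_def A_RCOSETS_def')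
  have add: "(N +>\<^bsub>V\<^esub> v) \<oplus>\<^bsub>?Q\<^esub> (N +>\<^bsub>V\<^esub> w) = N +>\<^bsub>V\<^esub> (v \<oplus>\<^bsub>V\<^esub> w)"
    if "v \<in> carrier V" "w \<in> carrier V" for v w
    using that by (simp add: quot_space_def N.a_rcos_sum)
  have smult: "a \<odot>\<^bsub>?Q\<^esub> (N +>\<^bsub>V\<^esub> v) = N +>\<^bsub>V\<^esub> (a \<odot>\<^bsub>V\<^esub> v)"
    if a: "a \<in> carrier K" and v: "v \<in> carrier V" for a v
  proof -
    have "N <+>\<^bsub>V\<^esub> (\<lambda>x. a \<odot>\<^bsub>V\<^esub> x) ` (N +>\<^bsub>V\<^esub> v) = N +>\<^bsub>V\<^esub> (a \<odot>\<^bsub>V\<^esub> v)"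
    proof (intro equalityI subsetI)
      fix y assume "y \<in> N <+>\<^bsub>V\<^esub> (\<lambda>x. a \<odot>\<^bsub>V\<^esub> x) ` (N +>\<^bsub>V\<^esub> v)"
      then obtain n m where nm: "n \<in> N" "m \<in> N" and y: "y = n \<oplus>\<^bsub>V\<^esub> a \<odot>\<^bsub>V\<^esub> (m \<oplus>\<^bsub>V\<^esub> v)"
        by (auto simp: set_add_def' a_r_coset_def')
      have "y = (n \<oplus>\<^bsub>V\<^esub> a \<odot>\<^bsub>V\<^esub> m) \<oplus>\<^bsub>V\<^esub> a \<odot>\<^bsub>V\<^esub> v"
        using nm a v N.a_subset by (auto simp: y V.smult_r_distr V.a_assoc subset_eq)
      moreover have "n \<oplus>\<^bsub>V\<^esub> a \<odot>\<^bsub>V\<^esub> m \<in> N"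
        using nm a V.submoduleE(4,5)[OF assms(2)] by blast
      ultimately show "y \<in> N +>\<^bsub>V\<^esub> (a \<odot>\<^bsub>V\<^esub> v)"
        by (auto simp: a_r_coset_def')
    next
      fix y assume "y \<in> N +>\<^bsub>V\<^esub> (a \<odot>\<^bsub>V\<^esub> v)"
      then obtain n where n: "n \<in> N" and y: "y = n \<oplus>\<^bsub>V\<^esub> a \<odot>\<^bsub>V\<^esub> v"
        by (auto simp: a_r_coset_def')
      have "v \<in> N +>\<^bsub>V\<^esub> v" using v by (rule N.a_rcos_self)
      then show "y \<in> N <+>\<^bsub>V\<^esub> (\<lambda>x. a \<odot>\<^bsub>V\<^esub> x) ` (N +>\<^bsub>V\<^esub> v)"
        unfolding y set_add_def' using n by blast
    qed
    then show ?thesis by (simp add: quot_space_def)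
  qed
  have zero: "\<zero>\<^bsub>?Q\<^esub> = N +>\<^bsub>V\<^esub> \<zero>\<^bsub>V\<^esub>"
    using N.a_subset by (simp add: quot_space_def V.a_coset_add_zero)
  show "(\<lambda>v. N +>\<^bsub>V\<^esub> v) \<in> lin_maps K V ?Q"
    by (rule lin_mapsI) (auto simp: add smult carr)
  have ab: "abelian_group ?Q"
  proof (rule abelian_groupI)
    fix x assume "x \<in> carrier ?Q"
    then obtain v where "v \<in> carrier V" "x = N +>\<^bsub>V\<^esub> v" by (auto simp: carr)
    then show "\<exists>y \<in> carrier ?Q. y \<oplus>\<^bsub>?Q\<^esub> x = \<zero>\<^bsub>?Q\<^esub>"
      by (intro bexI[of _ "N +>\<^bsub>V\<^esub> (\<ominus>\<^bsub>V\<^esub> v)"]) (auto simp: add zero carr V.l_neg)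
  qed (auto simp: carr add zero V.a_ac)
  show "module K ?Q"
    by (rule moduleI[OF V.is_cring ab])
      (auto simp: carr add smult V.smult_l_distr V.smult_r_distr V.smult_assoc1)
qed

lemma quot_space_zero:
  assumes "module K V" "submodule N K V" "v \<in> N"
  shows "N +>\<^bsub>V\<^esub> v = \<zero>\<^bsub>quot_space V N\<^esub>"
proof -
  interpret V: module K V by fact
  interpret N: abelian_subgroup N V
    by (rule submodule_abelian_subgroup[OF assms(1,2)])
  have "v \<in> carrier V" using assms(3) N.a_subset by blast
  then show ?thesis
    using assms(3) V.a_coset_join2 N.a_subgroup by (simp add: quot_space_def)
qed

text \<open>Covers both the tensor product, generated by pairs, and T^c(R), generated by words.
  Induction over generators, the universal property and uniqueness of linear maps are proved once
  for both.\<close>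

locale presentation =
  fixes K :: "('k, 'm) ring_scheme" and X :: "'x set" and S :: "('x \<Rightarrow> 'k) set"
  assumes K: "cring K" and S: "S \<subseteq> carrier (free_space K X)"
begin

abbreviation "F \<equiv> free_space K X"
abbreviation "N \<equiv> lin_span K F S"
abbreviation "Q \<equiv> quot_space F N"
definition "cl x = N +>\<^bsub>F\<^esub> single K x"

lemma module_F: "module K F"
  by (rule module_free_space[OF K])

lemma submodule_N: "submodule N K F"
  by (rule submodule_lin_span[OF module_F S])

lemmas module_Q = quot_space_lin(1)[OF module_F submodule_N]
lemmas proj_lin = quot_space_lin(2)[OF module_F submodule_N]
lemmas carrier_Q = quot_space_lin(3)[OF module_F submodule_N]

sublocale F: module K F by (rule module_F)
sublocale Q: module K Q by (rule module_Q)

lemma cl_closed: "x \<in> X \<Longrightarrow> cl x \<in> carrier Q"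
  using lin_closed[OF proj_lin single_closed[OF K]] by (simp add: cl_def)

lemma proj_rel:
  assumes "s \<ominus>\<^bsub>F\<^esub> t \<in> S" "s \<in> carrier F" "t \<in> carrier F"
  shows "N +>\<^bsub>F\<^esub> s = N +>\<^bsub>F\<^esub> t"
proof -
  have "N +>\<^bsub>F\<^esub> (s \<ominus>\<^bsub>F\<^esub> t) = \<zero>\<^bsub>Q\<^esub>"
    by (rule quot_space_zero[OF module_F submodule_N subsetD[OF lin_span_superset assms(1)]])
  then show ?thesis
    unfolding lin_minus[OF module_F module_Q proj_lin assms(2,3)]
    by (simp only: Q.minus_eq_zero_iff[OF lin_closed[OF proj_lin assms(2)] lin_closed[OF proj_lin assms(3)]])
qed

lemma Q_induct [consumes 1, case_names gen zero add smult]: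
  assumes q: "q \<in> carrier Q"
    and gen: "\<And>x. x \<in> X \<Longrightarrow> P (cl x)"
    and zero: "P \<zero>\<^bsub>Q\<^esub>"
    and add: "\<And>s t. s \<in> carrier Q \<Longrightarrow> t \<in> carrier Q \<Longrightarrow> P s \<Longrightarrow> P t \<Longrightarrow> P (s \<oplus>\<^bsub>Q\<^esub> t)"
    and smult: "\<And>a s. a \<in> carrier K \<Longrightarrow> s \<in> carrier Q \<Longrightarrow> P s \<Longrightarrow> P (a \<odot>\<^bsub>Q\<^esub> s)"
  shows "P q"
proof -
  interpret K: cring K by (rule K)
  \<comment> \<open>Induction on a finite set containing the support: \<open>f\<close> is the sum of
    \<open>h\<close>, in which the coefficient at \<open>a\<close> is erased, and a multiple of the
    generator \<open>a\<close>.\<close>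
  have *: "P (N +>\<^bsub>F\<^esub> f)" if "finite A" "f \<in> carrier F" "{x. f x \<noteq> \<zero>\<^bsub>K\<^esub>} \<subseteq> A" "A \<subseteq> X" for f A
    using that
  proof (induction A arbitrary: f rule: finite_induct)
    case empty
    then have "f = \<zero>\<^bsub>F\<^esub>" by (auto simp: free_space_def)
    then show ?case using zero lin_zero[OF module_F module_Q proj_lin] by simp
  next
    case (insert a A)
    note c = free_space_carrier[OF K insert.prems(1)]
    define h where "h = f(a := \<zero>\<^bsub>K\<^esub>)"
    have "finite {x. h x \<noteq> \<zero>\<^bsub>K\<^esub>}"
      by (rule finite_subset[OF _ c(2)]) (auto simp: h_def)
    then have h: "h \<in> carrier F"
      using insert.prems(1) unfolding free_space_def by (simp add: h_def)
    have a: "a \<in> X" "f a \<in> carrier K" using insert.prems c by auto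
    have f: "f = h \<oplus>\<^bsub>F\<^esub> f a \<odot>\<^bsub>F\<^esub> single K a"
      using c(1) a(2) by (intro ext) (simp add: h_def free_space_def single_def)
    have "P (N +>\<^bsub>F\<^esub> h)"
      by (rule insert.IH[OF h]) (use insert.prems in \<open>auto simp: h_def\<close>)
    moreover have "P (f a \<odot>\<^bsub>Q\<^esub> cl a)"
      by (rule smult[OF a(2) cl_closed[OF a(1)] gen[OF a(1)]])
    ultimately have "P ((N +>\<^bsub>F\<^esub> h) \<oplus>\<^bsub>Q\<^esub> f a \<odot>\<^bsub>Q\<^esub> cl a)"
      by (intro add lin_closed[OF proj_lin h] Q.smult_closed a cl_closed)
    also have "(N +>\<^bsub>F\<^esub> h) \<oplus>\<^bsub>Q\<^esub> f a \<odot>\<^bsub>Q\<^esub> cl a =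
        N +>\<^bsub>F\<^esub> (h \<oplus>\<^bsub>F\<^esub> f a \<odot>\<^bsub>F\<^esub> single K a)"
      using h a single_closed[OF K a(1)] lin_add[OF proj_lin h, of "f a \<odot>\<^bsub>F\<^esub> single K a"]
        lin_smult[OF proj_lin a(2) single_closed[OF K a(1)]] by (simp add: cl_def)
    also have "\<dots> = N +>\<^bsub>F\<^esub> f" by (rule arg_cong[OF f, symmetric])
    finally show ?case .
  qed
  obtain f where f: "f \<in> carrier F" "q = N +>\<^bsub>F\<^esub> f" using q by (auto simp: carrier_Q)
  note c = free_space_carrier[OF K f(1)]
  show ?thesis unfolding f(2) by (rule *[OF c(2) f(1) subset_refl c(3)])
qed

text \<open>The kernel of the linear extension is a submodule that contains the relations, hence all
  of \<open>N\<close>. The extension is therefore constant on each coset, which gives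
  \<open>the_elem\<close> in the definition of \<open>lift\<close> its meaning.\<close>

lemma lift_proj:
  assumes W: "module K W" and g: "g \<in> X \<rightarrow> carrier W"
    and rel: "\<And>s. s \<in> S \<Longrightarrow> free_ext K W g s = \<zero>\<^bsub>W\<^esub>" and f: "f \<in> carrier F"
  shows "lift K W g (N +>\<^bsub>F\<^esub> f) = free_ext K W g f"
proof -
  interpret W: module K W by (rule W)
  note lin = free_ext_lin[OF W g]
  have "submodule {f \<in> carrier F. free_ext K W g f = \<zero>\<^bsub>W\<^esub>} K F"
    by (rule F.submoduleI)
      (auto simp: lin_zero[OF module_F W lin] lin_uminus[OF module_F W lin] lin_add[OF lin]
        lin_smult[OF lin] W.smult_r_null)
  then have "N \<subseteq> {f \<in> carrier F. free_ext K W g f = \<zero>\<^bsub>W\<^esub>}"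
    using S rel by (intro lin_span_minimal) auto
  then have "free_ext K W g ` (N +>\<^bsub>F\<^esub> f) \<subseteq> {free_ext K W g f}"
    using f lin_closed[OF lin f] by (auto simp: a_r_coset_def' lin_add[OF lin] subset_eq)
  moreover have "f \<in> N +>\<^bsub>F\<^esub> f"
    by (rule abelian_subgroup.a_rcos_self[OF submodule_abelian_subgroup[OF module_F submodule_N] f])
  ultimately have "free_ext K W g ` (N +>\<^bsub>F\<^esub> f) = {free_ext K W g f}" by blast
  then show ?thesis by (simp add: lift_def)
qed

lemma lift_lin:
  assumes W: "module K W" and g: "g \<in> X \<rightarrow> carrier W"
    and rel: "\<And>s. s \<in> S \<Longrightarrow> free_ext K W g s = \<zero>\<^bsub>W\<^esub>"
  shows "lift K W g \<in> lin_maps K Q W"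
proof -
  note lin = free_ext_lin[OF W g] and l = lift_proj[OF assms]
  show ?thesis
  proof (rule lin_mapsI)
    fix x assume "x \<in> carrier Q"
    then obtain f where "f \<in> carrier F" "x = N +>\<^bsub>F\<^esub> f" by (auto simp: carrier_Q)
    then show "lift K W g x \<in> carrier W" using l lin_closed[OF lin] by simp
  next
    fix x y assume "x \<in> carrier Q" "y \<in> carrier Q"
    then obtain f h where "f \<in> carrier F" "x = N +>\<^bsub>F\<^esub> f" "h \<in> carrier F" "y = N +>\<^bsub>F\<^esub> h"
      by (auto simp: carrier_Q)
    then show "lift K W g (x \<oplus>\<^bsub>Q\<^esub> y) = lift K W g x \<oplus>\<^bsub>W\<^esub> lift K W g y"
      using l[of f] l[of h] l[of "f \<oplus>\<^bsub>F\<^esub> h"] lin_add[OF lin, of f h] lin_add[OF proj_lin, of f h]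
      by simp
  next
    fix a x assume a: "a \<in> carrier K" and "x \<in> carrier Q"
    then obtain f where "f \<in> carrier F" "x = N +>\<^bsub>F\<^esub> f" by (auto simp: carrier_Q)
    then show "lift K W g (a \<odot>\<^bsub>Q\<^esub> x) = a \<odot>\<^bsub>W\<^esub> lift K W g x"
      using a l[of f] l[of "a \<odot>\<^bsub>F\<^esub> f"] lin_smult[OF lin, of a f] lin_smult[OF proj_lin, of a f]
      by simp
  qed
qed

lemma lift_cl:
  assumes W: "module K W" and g: "g \<in> X \<rightarrow> carrier W"
    and rel: "\<And>s. s \<in> S \<Longrightarrow> free_ext K W g s = \<zero>\<^bsub>W\<^esub>" and x: "x \<in> X"
  shows "lift K W g (cl x) = g x"
  using lift_proj[OF W g rel single_closed[OF K x]] free_ext_single[OF W g x] by (simp add: cl_def)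

lemma lin_eqI:
  assumes "module K W" "f \<in> lin_maps K Q W" "g \<in> lin_maps K Q W"
    and "\<And>x. x \<in> X \<Longrightarrow> f (cl x) = g (cl x)" and "q \<in> carrier Q"
  shows "f q = g q"
  using assms(5)
proof (induction rule: Q_induct)
  case zero
  show ?case using lin_zero[OF module_Q assms(1,2)] lin_zero[OF module_Q assms(1,3)] by simp
qed (auto simp: assms(4) lin_add[OF assms(2)] lin_add[OF assms(3)]
    lin_smult[OF assms(2)] lin_smult[OF assms(3)])

text \<open>For fixed \<open>z\<close> the map is linear on the quotient, so linearity in
  \<open>z\<close> passes from generators to sums and multiples of them. This is the device for the
  bilinearity of maps that are built from nested lifts.\<close>

lemma lin_param:
  assumes U: "module K U" and Z: "module K Z"
    and f: "\<And>z. z \<in> carrier Z \<Longrightarrow> f z \<in> lin_maps K Q U"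
    and gen: "\<And>x. x \<in> X \<Longrightarrow> (\<lambda>z. f z (cl x)) \<in> lin_maps K Z U"
    and q: "q \<in> carrier Q"
  shows "(\<lambda>z. f z q) \<in> lin_maps K Z U"
  using q
proof (induction rule: Q_induct)
  case (gen x)
  then show ?case by (rule assms(4))
next
  case zero
  show ?case
    by (rule lin_cong[OF Z lin_zero_map[OF U]]) (simp add: lin_zero[OF module_Q U f])
next
  case (add s t)
  show ?case
    by (rule lin_cong[OF Z lin_add_map[OF U add(3,4)]]) (simp add: lin_add[OF f] add)
next
  case (smult a s)
  show ?case
    by (rule lin_cong[OF Z lin_smult_map[OF U smult(3,1)]]) (simp add: lin_smult[OF f] smult)
qed

end

lemma free_ext_rel:
  assumes "module K W" "g \<in> X \<rightarrow> carrier W" "s \<in> carrier (free_space K X)" "t \<in> carrier (free_space K X)"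
    and "free_ext K W g s = free_ext K W g t"
  shows "free_ext K W g (s \<ominus>\<^bsub>free_space K X\<^esub> t) = \<zero>\<^bsub>W\<^esub>"
proof -
  interpret W: module K W by fact
  note lin = free_ext_lin[OF assms(1,2)]
  show ?thesis
    using assms lin_closed[OF lin] 
    by (simp add: lin_minus[OF module_free_space[OF W.is_cring] assms(1) lin] W.minus_eq W.r_neg)
qed

section \<open>Universal properties of the tensor product and of the tensor coalgebra\<close>

definition bilin_maps ::
    "('k, 'm) ring_scheme \<Rightarrow> ('k, 'v, 'n) module_scheme \<Rightarrow> ('k, 'w, 'o) module_scheme \<Rightarrow>
      ('k, 'u, 'p) module_scheme \<Rightarrow> ('v \<Rightarrow> 'w \<Rightarrow> 'u) set"
  where "bilin_maps K V W U = {g. (\<forall>w \<in> carrier W. (\<lambda>v. g v w) \<in> lin_maps K V U) \<and>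
    (\<forall>v \<in> carrier V. g v \<in> lin_maps K W U)}"

lemma bilin_mapsI:
  assumes "\<And>w. w \<in> carrier W \<Longrightarrow> (\<lambda>v. g v w) \<in> lin_maps K V U"
    and "\<And>v. v \<in> carrier V \<Longrightarrow> (\<lambda>w. g v w) \<in> lin_maps K W U"
  shows "g \<in> bilin_maps K V W U"
  using assms by (simp add: bilin_maps_def)

lemma bilin1: "g \<in> bilin_maps K V W U \<Longrightarrow> w \<in> carrier W \<Longrightarrow> (\<lambda>v. g v w) \<in> lin_maps K V U"
  and bilin2: "g \<in> bilin_maps K V W U \<Longrightarrow> v \<in> carrier V \<Longrightarrow> (\<lambda>w. g v w) \<in> lin_maps K W U"
  and bilin_closed: "g \<in> bilin_maps K V W U \<Longrightarrow> v \<in> carrier V \<Longrightarrow> w \<in> carrier W \<Longrightarrow> g v w \<in> carrier U"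
  by (auto simp: bilin_maps_def lin_maps_def)

lemma bilin_msum1:
  assumes "module K V" "module K U" "g \<in> bilin_maps K V W U" "w \<in> carrier W"
    and "\<And>i. i \<in># M \<Longrightarrow> f i \<in> carrier V"
  shows "g (msum V f M) w = msum U (\<lambda>i. g (f i) w) M"
  by (rule lin_msum[OF assms(1,2) bilin1[OF assms(3,4)] assms(5)])

lemma bilin_msum2:
  assumes "module K W" "module K U" "g \<in> bilin_maps K V W U" "v \<in> carrier V"
    and "\<And>i. i \<in># M \<Longrightarrow> f i \<in> carrier W"
  shows "g v (msum W f M) = msum U (\<lambda>i. g v (f i)) M"
  by (rule lin_msum[OF assms(1,2) bilin2[OF assms(3,4)] assms(5)])

locale module_pair =
  fixes K :: "('k, 'm) ring_scheme" and V :: "('k, 'v, 'n) module_scheme"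
    and W :: "('k, 'w, 'o) module_scheme"
  assumes V: "module K V" and W: "module K W"
begin

abbreviation (input) "X \<equiv> carrier V \<times> carrier W"
abbreviation (input) "FF \<equiv> free_space K X"
abbreviation (input) "S \<equiv> bilinear_rels K V W"

lemma cringK: "cring K"
  using V by (rule module.axioms)

sublocale V: module K V by (rule V)
sublocale W: module K W by (rule W)
sublocale FF: module K FF by (rule module_free_space[OF cringK])

lemma rels_subset: "S \<subseteq> carrier FF"
proof -
  have [simp]: "v \<in> carrier V \<Longrightarrow> w \<in> carrier W \<Longrightarrow> single K (v, w) \<in> carrier FF" for v w
    by (rule single_closed[OF cringK]) simp
  show ?thesis
    by (auto simp: bilinear_rels_def Let_def)
qed

sublocale presentation K X S
  by unfold_locales (rule cringK rels_subset)+

lemma tensor_eq: "tensor K V W = Q"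
  by (simp add: tensor_def Let_def)

lemma pure_eq: "pure_tensor K V W v w = cl (v, w)"
  by (simp add: pure_tensor_def cl_def Let_def)

lemma tensor_module: "module K (tensor K V W)"
  unfolding tensor_eq by (rule module_Q)

lemma pure_closed: "v \<in> carrier V \<Longrightarrow> w \<in> carrier W \<Longrightarrow> pure_tensor K V W v w \<in> carrier (tensor K V W)"
  unfolding tensor_eq pure_eq by (rule cl_closed) simp

lemma pure_bilin: "pure_tensor K V W \<in> bilin_maps K V W (tensor K V W)"
proof -
  have [simp]: "single K (v, w) \<in> carrier FF" if "v \<in> carrier V" "w \<in> carrier W" for v w
    by (rule single_closed[OF cringK]) (simp add: that)
  note p [simp] = pure_eq cl_def tensor_eq
  note add = lin_add[OF proj_lin] and smult = lin_smult[OF proj_lin] and cl = lin_closed[OF proj_lin]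
  show ?thesis
  proof (rule bilin_mapsI; rule lin_mapsI)
    fix v w x assume vw: "v \<in> carrier V" "x \<in> carrier V" "w \<in> carrier W"
    have "N +>\<^bsub>F\<^esub> single K (v \<oplus>\<^bsub>V\<^esub> x, w) = N +>\<^bsub>F\<^esub> (single K (v, w) \<oplus>\<^bsub>F\<^esub> single K (x, w))"
      by (rule proj_rel; (unfold bilinear_rels_def Let_def)?) (use vw in \<open>blast, auto\<close>)
    then show "pure_tensor K V W (v \<oplus>\<^bsub>V\<^esub> x) w =
      pure_tensor K V W v w \<oplus>\<^bsub>tensor K V W\<^esub> pure_tensor K V W x w"
      using vw by (simp add: add)
  next
    fix v w x assume vw: "v \<in> carrier V" "x \<in> carrier W" "w \<in> carrier W"
    have "N +>\<^bsub>F\<^esub> single K (v, w \<oplus>\<^bsub>W\<^esub> x) = N +>\<^bsub>F\<^esub> (single K (v, w) \<oplus>\<^bsub>F\<^esub> single K (v, x))"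
      by (rule proj_rel; (unfold bilinear_rels_def Let_def)?) (use vw in \<open>blast, auto\<close>)
    then show "pure_tensor K V W v (w \<oplus>\<^bsub>W\<^esub> x) =
      pure_tensor K V W v w \<oplus>\<^bsub>tensor K V W\<^esub> pure_tensor K V W v x"
      using vw by (simp add: add)
  next
    fix a v w assume vw: "a \<in> carrier K" "v \<in> carrier V" "w \<in> carrier W"
    have "N +>\<^bsub>F\<^esub> single K (a \<odot>\<^bsub>V\<^esub> v, w) = N +>\<^bsub>F\<^esub> (a \<odot>\<^bsub>F\<^esub> single K (v, w))"
      by (rule proj_rel; (unfold bilinear_rels_def Let_def)?) (use vw in \<open>blast, auto\<close>)
    then show "pure_tensor K V W (a \<odot>\<^bsub>V\<^esub> v) w = a \<odot>\<^bsub>tensor K V W\<^esub> pure_tensor K V W v w"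
      using vw by (simp add: smult)
  next
    fix a v w assume vw: "a \<in> carrier K" "v \<in> carrier V" "w \<in> carrier W"
    have "N +>\<^bsub>F\<^esub> single K (v, a \<odot>\<^bsub>W\<^esub> w) = N +>\<^bsub>F\<^esub> (a \<odot>\<^bsub>F\<^esub> single K (v, w))"
      by (rule proj_rel; (unfold bilinear_rels_def Let_def)?) (use vw in \<open>blast, auto\<close>)
    then show "pure_tensor K V W v (a \<odot>\<^bsub>W\<^esub> w) = a \<odot>\<^bsub>tensor K V W\<^esub> pure_tensor K V W v w"
      using vw by (simp add: smult)
  qed (use pure_closed in auto)
qed

text \<open>The four families of relations express additivity and homogeneity in either factor, so
  the linear extension of a bilinear map kills each of them.\<close>

lemma tensor_lift:
  assumes U: "module K U" and g: "g \<in> bilin_maps K V W U"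
  shows tensor_lift_lin: "lift K U (\<lambda>(v, w). g v w) \<in> lin_maps K (tensor K V W) U" (is ?A)
    and "v \<in> carrier V \<Longrightarrow> w \<in> carrier W \<Longrightarrow>
      lift K U (\<lambda>(v, w). g v w) (pure_tensor K V W v w) = g v w" (is "_ \<Longrightarrow> _ \<Longrightarrow> ?B")
proof -
  let ?g = "\<lambda>(v, w). g v w"
  interpret U: module K U by (rule U)
  have gc: "?g \<in> X \<rightarrow> carrier U" using bilin_closed[OF g] by auto
  have sc [simp]: "single K (v, w) \<in> carrier FF" if "v \<in> carrier V" "w \<in> carrier W" for v w
    by (rule single_closed[OF cringK]) (simp add: that)
  note lin = free_ext_lin[OF U gc]
  have s [simp]: "free_ext K U ?g (single K (v, w)) = g v w" if "v \<in> carrier V" "w \<in> carrier W" for v w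
    by (subst free_ext_single[OF U gc]) (use that in auto)
  have rel: "free_ext K U ?g s = \<zero>\<^bsub>U\<^esub>" if "s \<in> S" for s
  proof -
    note r = free_ext_rel[OF U gc]
    from that consider
      (1) x y w where "s = single K (x \<oplus>\<^bsub>V\<^esub> y, w) \<ominus>\<^bsub>FF\<^esub> (single K (x, w) \<oplus>\<^bsub>FF\<^esub> single K (y, w))"
        "x \<in> carrier V" "y \<in> carrier V" "w \<in> carrier W"
    | (2) v x y where "s = single K (v, x \<oplus>\<^bsub>W\<^esub> y) \<ominus>\<^bsub>FF\<^esub> (single K (v, x) \<oplus>\<^bsub>FF\<^esub> single K (v, y))"
        "v \<in> carrier V" "x \<in> carrier W" "y \<in> carrier W"
    | (3) a v w where "s = single K (a \<odot>\<^bsub>V\<^esub> v, w) \<ominus>\<^bsub>FF\<^esub> a \<odot>\<^bsub>FF\<^esub> single K (v, w)"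
        "a \<in> carrier K" "v \<in> carrier V" "w \<in> carrier W"
    | (4) a v w where "s = single K (v, a \<odot>\<^bsub>W\<^esub> w) \<ominus>\<^bsub>FF\<^esub> a \<odot>\<^bsub>FF\<^esub> single K (v, w)"
        "a \<in> carrier K" "v \<in> carrier V" "w \<in> carrier W"
      unfolding bilinear_rels_def Let_def by blast
    then show ?thesis
    proof cases
      case 1
      then show ?thesis
        unfolding 1(1) by (intro r) (simp_all add: lin_add[OF lin] lin_add[OF bilin1[OF g]])
    next
      case 2
      then show ?thesis
        unfolding 2(1) by (intro r) (simp_all add: lin_add[OF lin] lin_add[OF bilin2[OF g]])
    next
      case 3
      then show ?thesis
        unfolding 3(1) by (intro r) (simp_all add: lin_smult[OF lin] lin_smult[OF bilin1[OF g]])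
    next
      case 4
      then show ?thesis
        unfolding 4(1) by (intro r) (simp_all add: lin_smult[OF lin] lin_smult[OF bilin2[OF g]])
    qed
  qed
  show ?A unfolding tensor_eq by (rule lift_lin[OF U gc rel])
  show ?B if "v \<in> carrier V" "w \<in> carrier W"
    unfolding pure_eq by (subst lift_cl[OF U gc rel]) (use that in auto)
qed

lemma tensor_lin_param:
  assumes U: "module K U" and Z: "module K Z"
    and f: "\<And>z. z \<in> carrier Z \<Longrightarrow> f z \<in> lin_maps K (tensor K V W) U"
    and gen: "\<And>v w. v \<in> carrier V \<Longrightarrow> w \<in> carrier W \<Longrightarrow>
      (\<lambda>z. f z (pure_tensor K V W v w)) \<in> lin_maps K Z U"
    and t: "t \<in> carrier (tensor K V W)"
  shows "(\<lambda>z. f z t) \<in> lin_maps K Z U"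
  by (rule lin_param[OF U Z f[unfolded tensor_eq] _ t[unfolded tensor_eq]])
    (use gen in \<open>auto simp: pure_eq\<close>)

end

definition mlin_maps ::
    "('k, 'm) ring_scheme \<Rightarrow> ('k, 'a, 'n) module_scheme \<Rightarrow> ('k, 'w, 'o) module_scheme \<Rightarrow>
      ('a list \<Rightarrow> 'w) set"
  where "mlin_maps K R W = {g. g [] \<in> carrier W \<and>
    (\<forall>u \<in> lists (carrier R). \<forall>v \<in> lists (carrier R). (\<lambda>y. g (u @ y # v)) \<in> lin_maps K R W)}"

lemma mlin_mapsI:
  assumes "g [] \<in> carrier W"
    and "\<And>u v. u \<in> lists (carrier R) \<Longrightarrow> v \<in> lists (carrier R) \<Longrightarrow>
      (\<lambda>y. g (u @ y # v)) \<in> lin_maps K R W"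
  shows "g \<in> mlin_maps K R W"
  using assms by (simp add: mlin_maps_def)

lemma ml_lin:
  "g \<in> mlin_maps K R W \<Longrightarrow> u \<in> lists (carrier R) \<Longrightarrow> v \<in> lists (carrier R) \<Longrightarrow>
    (\<lambda>y. g (u @ y # v)) \<in> lin_maps K R W"
  by (simp add: mlin_maps_def)

lemma ml_lin_hd:
  "g \<in> mlin_maps K R W \<Longrightarrow> v \<in> lists (carrier R) \<Longrightarrow> (\<lambda>y. g (y # v)) \<in> lin_maps K R W"
  using ml_lin[of g K R W "[]"] by simp

text \<open>The value at a nonempty word is the value of a linear map in its first letter; this is
  why \<open>mlin_maps\<close> asks for closedness at the empty word only.\<close>

lemma ml_closed: "g \<in> mlin_maps K R W \<Longrightarrow> w \<in> lists (carrier R) \<Longrightarrow> g w \<in> carrier W"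
proof (cases w)
  case (Cons x v)
  assume "g \<in> mlin_maps K R W" "w \<in> lists (carrier R)"
  then show ?thesis
    using Cons lin_closed[OF ml_lin_hd[of g K R W v], of x] by simp
qed (simp add: mlin_maps_def)

lemma ml_lin_comp:
  assumes "g \<in> mlin_maps K R W" "f \<in> lin_maps K W U"
  shows "(\<lambda>w. f (g w)) \<in> mlin_maps K R U"
  using assms by (auto simp: mlin_maps_def lin_closed intro!: lin_comp[of _ K R W f U])

lemma ml_Cons:
  assumes "g \<in> mlin_maps K R W" "x \<in> carrier R"
  shows "(\<lambda>w. g (x # w)) \<in> mlin_maps K R W"
proof (rule mlin_mapsI)
  show "g [x] \<in> carrier W" using assms by (simp add: ml_closed)
  fix u v assume "u \<in> lists (carrier R)" "v \<in> lists (carrier R)"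
  then show "(\<lambda>y. g (x # u @ y # v)) \<in> lin_maps K R W"
    using ml_lin[OF assms(1), of "x # u" v] assms(2) by simp
qed

locale tensor_coalgebra =
  fixes K :: "('k, 'm) ring_scheme" and R :: "('k, 'a, 'n) module_scheme"
  assumes R: "module K R"
begin

abbreviation (input) "L \<equiv> lists (carrier R)"
abbreviation (input) "FL \<equiv> free_space K L"
abbreviation (input) "SL \<equiv> multilinear_rels K R"

lemma cringK: "cring K"
  using R by (rule module.axioms)

sublocale R: module K R by (rule R)
sublocale FL: module K FL by (rule module_free_space[OF cringK])

lemma words_rels_subset: "SL \<subseteq> carrier FL"
proof -
  have *: "single K w \<in> carrier FL" if "\<forall>x \<in> set w. x \<in> carrier R" for w
    by (rule single_closed[OF cringK]) (simp add: in_lists_conv_set that)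
  show ?thesis
    by (auto simp: multilinear_rels_def Let_def
      intro!: FL.minus_closed FL.M.a_closed FL.smult_closed *)
qed

interpretation W: presentation K L SL
  by unfold_locales (rule cringK words_rels_subset)+

abbreviation "T \<equiv> tensor_words K R"
abbreviation "wd \<equiv> word K R"

lemma words_eq: "T = W.Q"
  by (simp add: tensor_words_def Let_def)

lemma word_eq: "wd w = W.cl w"
  by (simp add: word_def W.cl_def Let_def)

lemma words_module: "module K T"
  unfolding words_eq by (rule W.module_Q)

lemma word_closed: "w \<in> L \<Longrightarrow> wd w \<in> carrier T"
  unfolding words_eq word_eq by (rule W.cl_closed)

lemma word_ml: "wd \<in> mlin_maps K R T"
proof -
  have sc: "single K w \<in> carrier FL" if "w \<in> L" for w
    by (rule single_closed[OF cringK that])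
  have l: "u @ x # v \<in> L" if "u \<in> L" "v \<in> L" "x \<in> carrier R" for u x v
    using that by simp
  note p [simp] = word_eq W.cl_def words_eq
  note add = lin_add[OF W.proj_lin] and smult = lin_smult[OF W.proj_lin] and cl = lin_closed[OF W.proj_lin]
  show ?thesis
  proof (rule mlin_mapsI; (rule lin_mapsI)?)
    fix u v x y assume uv: "u \<in> L" "v \<in> L" "x \<in> carrier R" "y \<in> carrier R"
    note m = sc[OF l[OF uv(1,2)]]
    have "W.N +>\<^bsub>W.F\<^esub> single K (u @ (x \<oplus>\<^bsub>R\<^esub> y) # v) =
      W.N +>\<^bsub>W.F\<^esub> (single K (u @ x # v) \<oplus>\<^bsub>W.F\<^esub> single K (u @ y # v))"
    proof (rule W.proj_rel)
      show "single K (u @ (x \<oplus>\<^bsub>R\<^esub> y) # v) \<ominus>\<^bsub>FL\<^esub> (single K (u @ x # v) \<oplus>\<^bsub>FL\<^esub> single K (u @ y # v)) \<in> SL"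
        unfolding multilinear_rels_def Let_def using uv by blast
    qed (use m uv in auto)
    then show "wd (u @ (x \<oplus>\<^bsub>R\<^esub> y) # v) = wd (u @ x # v) \<oplus>\<^bsub>T\<^esub> wd (u @ y # v)"
      using m uv by (simp add: add)
  next
    fix u v x a assume uv: "u \<in> L" "v \<in> L" "a \<in> carrier K" "x \<in> carrier R"
    note m = sc[OF l[OF uv(1,2)]]
    have "W.N +>\<^bsub>W.F\<^esub> single K (u @ (a \<odot>\<^bsub>R\<^esub> x) # v) =
      W.N +>\<^bsub>W.F\<^esub> (a \<odot>\<^bsub>W.F\<^esub> single K (u @ x # v))"
    proof (rule W.proj_rel)
      show "single K (u @ (a \<odot>\<^bsub>R\<^esub> x) # v) \<ominus>\<^bsub>FL\<^esub> (a \<odot>\<^bsub>FL\<^esub> single K (u @ x # v)) \<in> SL"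
        unfolding multilinear_rels_def Let_def using uv by blast
    qed (use m uv in auto)
    then show "wd (u @ (a \<odot>\<^bsub>R\<^esub> x) # v) = a \<odot>\<^bsub>T\<^esub> wd (u @ x # v)"
      using m uv by (simp add: smult)
  qed (rule word_closed, simp)+
qed

lemma words_lift:
  assumes U: "module K U" and g: "g \<in> mlin_maps K R U"
  shows words_lift_lin: "lift K U g \<in> lin_maps K T U" (is ?A)
    and words_lift_word: "w \<in> L \<Longrightarrow> lift K U g (wd w) = g w" (is "_ \<Longrightarrow> ?B")
proof -
  interpret U: module K U by (rule U)
  have gc: "g \<in> L \<rightarrow> carrier U" using ml_closed[OF g] by blast
  have sc: "single K w \<in> carrier FL" if "w \<in> L" for w
    by (rule single_closed[OF cringK that])
  have l: "u @ x # v \<in> L" if "u \<in> L" "v \<in> L" "x \<in> carrier R" for u x v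
    using that by simp
  note lin = free_ext_lin[OF U gc]
  note s = free_ext_single[OF U gc]
  have rel: "free_ext K U g s = \<zero>\<^bsub>U\<^esub>" if "s \<in> SL" for s
  proof -
    note r = free_ext_rel[OF U gc]
    from that consider
      (1) u v x y where "s = single K (u @ (x \<oplus>\<^bsub>R\<^esub> y) # v) \<ominus>\<^bsub>FL\<^esub>
          (single K (u @ x # v) \<oplus>\<^bsub>FL\<^esub> single K (u @ y # v))"
        "u \<in> L" "v \<in> L" "x \<in> carrier R" "y \<in> carrier R"
    | (2) u v a x where "s = single K (u @ (a \<odot>\<^bsub>R\<^esub> x) # v) \<ominus>\<^bsub>FL\<^esub> a \<odot>\<^bsub>FL\<^esub> single K (u @ x # v)"
        "u \<in> L" "v \<in> L" "a \<in> carrier K" "x \<in> carrier R"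
      unfolding multilinear_rels_def Let_def by blast
    then show ?thesis
    proof cases
      case 1
      note m = l[OF 1(2,3)]
      show ?thesis
        unfolding 1(1)
        using 1 m sc s lin_add[OF ml_lin[OF g 1(2,3)]]
        by (intro r) (simp_all add: lin_add[OF lin])
    next
      case 2
      note m = l[OF 2(2,3)]
      show ?thesis
        unfolding 2(1)
        using 2 m sc s lin_smult[OF ml_lin[OF g 2(2,3)]]
        by (intro r) (simp_all add: lin_smult[OF lin])
    qed
  qed
  show ?A unfolding words_eq by (rule W.lift_lin[OF U gc rel])
  show ?B if "w \<in> L"
    unfolding word_eq by (rule W.lift_cl[OF U gc rel that])
qed

lemma words_eqI:
  assumes "module K U" "f \<in> lin_maps K T U" "g \<in> lin_maps K T U"
    and "\<And>w. w \<in> L \<Longrightarrow> f (wd w) = g (wd w)" and "t \<in> carrier T"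
  shows "f t = g t"
  by (rule W.lin_eqI[OF assms(1) assms(2,3)[unfolded words_eq] _ assms(5)[unfolded words_eq]])
    (use assms(4) in \<open>auto simp: word_eq\<close>)

lemma words_lin_param:
  assumes "module K U" "module K Z" "\<And>z. z \<in> carrier Z \<Longrightarrow> f z \<in> lin_maps K T U"
    and "\<And>w. w \<in> L \<Longrightarrow> (\<lambda>z. f z (wd w)) \<in> lin_maps K Z U" and "t \<in> carrier T"
  shows "(\<lambda>z. f z t) \<in> lin_maps K Z U"
  by (rule W.lin_param[OF assms(1,2) assms(3)[unfolded words_eq] _ assms(5)[unfolded words_eq]])
    (use assms(4) in \<open>auto simp: word_eq\<close>)

lemmas words_induct [consumes 1, case_names word zero add smult] =
  W.Q_induct[folded words_eq word_eq]

end

section \<open>Maps, associativity and products on tensor products\<close>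

lemma tensor_map_lin:
  assumes "module K V" "module K W" "module K V'" "module K W'"
    and f: "f \<in> lin_maps K V V'" and g: "g \<in> lin_maps K W W'"
  shows tensor_map_in_lin: "tensor_map K V' W' f g \<in> lin_maps K (tensor K V W) (tensor K V' W')"
    and tensor_map_pure: "v \<in> carrier V \<Longrightarrow> w \<in> carrier W \<Longrightarrow>
      tensor_map K V' W' f g (pure_tensor K V W v w) = pure_tensor K V' W' (f v) (g w)"
proof -
  interpret P: module_pair K V W by (intro module_pair.intro assms)
  interpret P': module_pair K V' W' by (intro module_pair.intro assms)
  have b: "(\<lambda>v w. pure_tensor K V' W' (f v) (g w)) \<in> bilin_maps K V W (tensor K V' W')"
    by (intro bilin_mapsI lin_comp[OF f] lin_comp[OF g] bilin1[OF P'.pure_bilin] bilin2[OF P'.pure_bilin]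
        lin_closed[OF f] lin_closed[OF g])
  show "tensor_map K V' W' f g \<in> lin_maps K (tensor K V W) (tensor K V' W')"
    unfolding tensor_map_def by (rule P.tensor_lift_lin[OF P'.tensor_module b])
  show "v \<in> carrier V \<Longrightarrow> w \<in> carrier W \<Longrightarrow>
      tensor_map K V' W' f g (pure_tensor K V W v w) = pure_tensor K V' W' (f v) (g w)"
    unfolding tensor_map_def by (rule P.tensor_lift(2)[OF P'.tensor_module b])
qed

lemma tensor_assoc_lin:
  assumes U: "module K U" and V: "module K V" and W: "module K W"
  shows tensor_assoc_in_lin: "tensor_assoc K U V W \<in>
      lin_maps K (tensor K (tensor K U V) W) (tensor K U (tensor K V W))"
    and tensor_assoc_pure: "u \<in> carrier U \<Longrightarrow> v \<in> carrier V \<Longrightarrow> w \<in> carrier W \<Longrightarrow>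
      tensor_assoc K U V W (pure_tensor K (tensor K U V) W (pure_tensor K U V u v) w) =
        pure_tensor K U (tensor K V W) u (pure_tensor K V W v w)"
proof -
  interpret UV: module_pair K U V by (intro module_pair.intro assms)
  interpret VW: module_pair K V W by (intro module_pair.intro assms)
  interpret L: module_pair K "tensor K U V" W
    by (intro module_pair.intro UV.tensor_module W)
  interpret R: module_pair K U "tensor K V W"
    by (intro module_pair.intro VW.tensor_module U)
  let ?UVW = "tensor K U (tensor K V W)"
  let ?g = "\<lambda>w u v. pure_tensor K U (tensor K V W) u (pure_tensor K V W v w)"
  have b: "?g w \<in> bilin_maps K U V ?UVW" if "w \<in> carrier W" for w
    using that by (intro bilin_mapsI lin_comp[OF bilin1[OF VW.pure_bilin]]
        bilin1[OF R.pure_bilin] bilin2[OF R.pure_bilin] VW.pure_closed)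
  have lin: "lift K ?UVW (\<lambda>(u, v). ?g w u v) \<in> lin_maps K (tensor K U V) ?UVW" if "w \<in> carrier W" for w
    by (rule UV.tensor_lift_lin[OF R.tensor_module b[OF that]])
  have val: "lift K ?UVW (\<lambda>(u, v). ?g w u v) (pure_tensor K U V u v) = ?g w u v"
    if "w \<in> carrier W" "u \<in> carrier U" "v \<in> carrier V" for u v w
    by (rule UV.tensor_lift(2)[OF R.tensor_module b[OF that(1)] that(2,3)])
  \<comment> \<open>A lift is linear in the tensor by construction. Linearity in the extra parameter
    \<open>w\<close> is checked on pure tensors, where the inner lift has an explicit value.\<close>
  have lin2: "(\<lambda>w. lift K ?UVW (\<lambda>(u, v). ?g w u v) t) \<in> lin_maps K W ?UVW"
    if "t \<in> carrier (tensor K U V)" for t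
  proof (rule UV.tensor_lin_param[OF R.tensor_module W lin _ that])
    fix u v assume uv: "u \<in> carrier U" "v \<in> carrier V"
    have "(\<lambda>w. ?g w u v) \<in> lin_maps K W ?UVW"
      by (intro lin_comp[OF bilin2[OF VW.pure_bilin uv(2)]] bilin2[OF R.pure_bilin uv(1)])
    then show "(\<lambda>w. lift K ?UVW (\<lambda>(u, v). ?g w u v) (pure_tensor K U V u v)) \<in> lin_maps K W ?UVW"
      by (rule lin_cong[OF W]) (simp add: val uv)
  qed
  have b2: "(\<lambda>t w. lift K ?UVW (\<lambda>(u, v). ?g w u v) t) \<in> bilin_maps K (tensor K U V) W ?UVW"
    by (intro bilin_mapsI lin2 lin)
  have a: "tensor_assoc K U V W = lift K ?UVW (\<lambda>(t, w). lift K ?UVW (\<lambda>(u, v). ?g w u v) t)"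
    by (simp add: tensor_assoc_def Let_def)
  show "tensor_assoc K U V W \<in> lin_maps K (tensor K (tensor K U V) W) ?UVW"
    unfolding a by (rule L.tensor_lift_lin[OF R.tensor_module b2])
  show "tensor_assoc K U V W (pure_tensor K (tensor K U V) W (pure_tensor K U V u v) w) = ?g w u v"
    if "u \<in> carrier U" "v \<in> carrier V" "w \<in> carrier W"
    unfolding a using L.tensor_lift(2)[OF R.tensor_module b2 UV.pure_closed[OF that(1,2)] that(3)]
    by (simp only: val that)
qed

lemma tensor_alg_simps:
  "carrier (tensor_alg K A B) = carrier (tensor K A B)"
  "add (tensor_alg K A B) = add (tensor K A B)"
  "one (tensor_alg K A B) = pure_tensor K A B \<one>\<^bsub>A\<^esub> \<one>\<^bsub>B\<^esub>"
  by (simp_all add: tensor_alg_def Let_def)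

lemma tensor_alg_mult:
  assumes A: "module K A" and B: "module K B"
    and a: "monoid.mult A \<in> bilin_maps K A A A" and b: "monoid.mult B \<in> bilin_maps K B B B"
  shows tensor_alg_mult_bilin: "monoid.mult (tensor_alg K A B) \<in>
      bilin_maps K (tensor K A B) (tensor K A B) (tensor K A B)"
    and tensor_alg_mult_pure: "x \<in> carrier A \<Longrightarrow> y \<in> carrier B \<Longrightarrow> x' \<in> carrier A \<Longrightarrow> y' \<in> carrier B \<Longrightarrow>
      pure_tensor K A B x y \<otimes>\<^bsub>tensor_alg K A B\<^esub> pure_tensor K A B x' y' =
      pure_tensor K A B (x \<otimes>\<^bsub>A\<^esub> x') (y \<otimes>\<^bsub>B\<^esub> y')"
proof -
  interpret P: module_pair K A B by (intro module_pair.intro assms)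
  let ?T = "tensor K A B" let ?p = "pure_tensor K A B"
  let ?g = "\<lambda>x y x' y'. ?p (x \<otimes>\<^bsub>A\<^esub> x') (y \<otimes>\<^bsub>B\<^esub> y')"
  have b1: "?g x y \<in> bilin_maps K A B ?T" if "x \<in> carrier A" "y \<in> carrier B" for x y
    using that by (intro bilin_mapsI lin_comp[OF bilin2[OF a]] lin_comp[OF bilin2[OF b]]
        bilin1[OF P.pure_bilin] bilin2[OF P.pure_bilin] bilin_closed[OF a] bilin_closed[OF b])
  let ?l = "\<lambda>t x y. lift K ?T (\<lambda>(x', y'). ?g x y x' y') t"
  have lin: "(\<lambda>t. ?l t x y) \<in> lin_maps K ?T ?T" if "x \<in> carrier A" "y \<in> carrier B" for x y
    by (rule P.tensor_lift_lin[OF P.tensor_module b1[OF that]])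
  have val: "?l (?p x' y') x y = ?g x y x' y'"
    if "x \<in> carrier A" "y \<in> carrier B" "x' \<in> carrier A" "y' \<in> carrier B" for x y x' y'
    by (rule P.tensor_lift(2)[OF P.tensor_module b1[OF that(1,2)] that(3,4)])
  \<comment> \<open>Before the outer lift can be formed, the inner one has to be bilinear in
    \<open>x\<close> and \<open>y\<close> for every fixed tensor \<open>t\<close>; again it suffices
    to let \<open>t\<close> be pure.\<close>
  have b2: "?l t \<in> bilin_maps K A B ?T" if t: "t \<in> carrier ?T" for t
  proof (rule bilin_mapsI)
    fix y assume y: "y \<in> carrier B"
    show "(\<lambda>x. ?l t x y) \<in> lin_maps K A ?T"
    proof (rule P.tensor_lin_param[OF P.tensor_module A lin _ t])
      fix x' y' assume xy: "x' \<in> carrier A" "y' \<in> carrier B"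
      have "(\<lambda>x. ?g x y x' y') \<in> lin_maps K A ?T"
        using xy y by (intro lin_comp[OF bilin1[OF a]] bilin1[OF P.pure_bilin] bilin_closed[OF b])
      then show "(\<lambda>x. ?l (?p x' y') x y) \<in> lin_maps K A ?T"
        by (rule lin_cong[OF A]) (simp add: val xy y)
    qed (use y in auto)
  next
    fix x assume x: "x \<in> carrier A"
    show "(\<lambda>y. ?l t x y) \<in> lin_maps K B ?T"
    proof (rule P.tensor_lin_param[OF P.tensor_module B lin _ t])
      fix x' y' assume xy: "x' \<in> carrier A" "y' \<in> carrier B"
      have "(\<lambda>y. ?g x y x' y') \<in> lin_maps K B ?T"
        using xy x by (intro lin_comp[OF bilin1[OF b]] bilin2[OF P.pure_bilin] bilin_closed[OF a])
      then show "(\<lambda>y. ?l (?p x' y') x y) \<in> lin_maps K B ?T"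
        by (rule lin_cong[OF B]) (simp add: val xy x)
    qed (use x in auto)
  qed
  have m: "monoid.mult (tensor_alg K A B) = (\<lambda>s t. lift K ?T (\<lambda>(x, y). ?l t x y) s)"
    by (simp add: tensor_alg_def Let_def)
  have lin1: "(\<lambda>s. s \<otimes>\<^bsub>tensor_alg K A B\<^esub> t) \<in> lin_maps K ?T ?T" if "t \<in> carrier ?T" for t
    unfolding m by (rule P.tensor_lift_lin[OF P.tensor_module b2[OF that]])
  have val1: "?p x y \<otimes>\<^bsub>tensor_alg K A B\<^esub> t = ?l t x y"
    if "x \<in> carrier A" "y \<in> carrier B" "t \<in> carrier ?T" for x y t
    unfolding m by (rule P.tensor_lift(2)[OF P.tensor_module b2[OF that(3)] that(1,2)])
  show "monoid.mult (tensor_alg K A B) \<in> bilin_maps K ?T ?T ?T"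
  proof (rule bilin_mapsI)
    fix s assume s: "s \<in> carrier ?T"
    show "(\<lambda>t. s \<otimes>\<^bsub>tensor_alg K A B\<^esub> t) \<in> lin_maps K ?T ?T"
    proof (rule P.tensor_lin_param[OF P.tensor_module P.tensor_module lin1 _ s])
      fix x y assume "x \<in> carrier A" "y \<in> carrier B"
      then show "(\<lambda>t. ?p x y \<otimes>\<^bsub>tensor_alg K A B\<^esub> t) \<in> lin_maps K ?T ?T"
        by (intro lin_cong[OF P.tensor_module lin[of x y]]) (simp_all add: val1)
    qed
  qed (rule lin1)
  show "?p x y \<otimes>\<^bsub>tensor_alg K A B\<^esub> ?p x' y' = ?g x y x' y'"
    if "x \<in> carrier A" "y \<in> carrier B" "x' \<in> carrier A" "y' \<in> carrier B"
    by (simp only: val1[OF that(1,2) P.pure_closed[OF that(3,4)]] val[OF that])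
qed

lemma module_scalars:
  assumes "cring K"
  shows "module K (scalars K)"
proof -
  interpret K: cring K by fact
  show ?thesis
    by (intro moduleI abelian_groupI assms)
      (auto simp: scalars_def K.a_ac K.l_distr K.r_distr K.m_assoc
        intro: bexI[of _ "\<ominus>\<^bsub>K\<^esub> _"] K.l_neg)
qed

lemma ml_cong:
  assumes "module K R" "g \<in> mlin_maps K R W" "\<And>w. w \<in> lists (carrier R) \<Longrightarrow> g w = h w"
  shows "h \<in> mlin_maps K R W"
proof (rule mlin_mapsI)
  show "h [] \<in> carrier W" using assms(2) assms(3)[of "[]"] by (simp add: mlin_maps_def)
  fix u v assume uv: "u \<in> lists (carrier R)" "v \<in> lists (carrier R)"
  show "(\<lambda>y. h (u @ y # v)) \<in> lin_maps K R W"
    by (rule lin_cong[OF assms(1) ml_lin[OF assms(2) uv]], rule assms(3)) (use uv in simp)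
qed

lemma splits_lists: "p \<in># splits w \<Longrightarrow> w \<in> lists A \<Longrightarrow> fst p \<in> lists A \<and> snd p \<in> lists A"
  using splits_pair by (metis append_in_lists_conv)

text \<open>The middle letter lands in one of the two factors.\<close>

lemma ml_splits:
  assumes "module K W"
    and "\<And>b. b \<in> lists (carrier R) \<Longrightarrow> (\<lambda>a. h a b) \<in> mlin_maps K R W"
    and "\<And>a. a \<in> lists (carrier R) \<Longrightarrow> h a \<in> mlin_maps K R W"
  shows "(\<lambda>w. msum W (\<lambda>p. h (fst p) (snd p)) (splits w)) \<in> mlin_maps K R W"
proof -
  interpret W: module K W by fact
  show ?thesis
  proof (rule mlin_mapsI)
    fix u v assume uv: "u \<in> lists (carrier R)" "v \<in> lists (carrier R)"
    show "(\<lambda>y. msum W (\<lambda>p. h (fst p) (snd p)) (splits (u @ y # v))) \<in> lin_maps K R W"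
      unfolding splits_append W.msum_union W.msum_image_mset fst_conv snd_conv
      using uv splits_lists
      by (intro lin_add_map lin_msum_map assms(1) ml_lin[OF assms(3)] ml_lin[OF assms(2)]) blast+
  qed simp
qed

section \<open>The tensor coalgebra\<close>

lemma T_hopf_simps [simp]:
  "carrier (T_hopf K R mul) = carrier (tensor_words K R)"
  "add (T_hopf K R mul) = add (tensor_words K R)"
  "zero (T_hopf K R mul) = zero (tensor_words K R)"
  "smult (T_hopf K R mul) = smult (tensor_words K R)"
  "monoid.mult (T_hopf K R mul) = mul"
  "one (T_hopf K R mul) = word K R []"
  "comult (T_hopf K R mul) = deconcatenation K R"
  "counit (T_hopf K R mul) = T_counit K R"
  by (simp_all add: T_hopf_def Let_def)

text \<open>The Hopf algebra and \<open>tensor_words\<close> are different records with the same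
  carrier, addition and scalars. Tensor constructions see only this common part, so all of them are
  rewritten to \<open>tensor_words\<close>.\<close>

lemma T_hopf_tensor [simp]:
  "tensor K (T_hopf K R mul) W = tensor K (tensor_words K R) W"
  "tensor K V (T_hopf K R mul) = tensor K V (tensor_words K R)"
  "pure_tensor K (T_hopf K R mul) W = pure_tensor K (tensor_words K R) W"
  "pure_tensor K V (T_hopf K R mul) = pure_tensor K V (tensor_words K R)"
  by (simp_all add: tensor_def pure_tensor_def bilinear_rels_def fun_eq_iff)

lemma T_hopf_lift [simp]: "lift K (T_hopf K R mul) = lift K (tensor_words K R)"
  by (simp add: lift_def free_ext_def finsum_def finprod_def fun_eq_iff)

lemma T_hopf_lin_maps [simp]:
  "lin_maps K (T_hopf K R mul) W = lin_maps K (tensor_words K R) W"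
  "lin_maps K V (T_hopf K R mul) = lin_maps K V (tensor_words K R)"
  by (simp_all add: lin_maps_def)

lemma T_hopf_tensor_map [simp]:
  "tensor_map K (T_hopf K R mul) W f g = tensor_map K (tensor_words K R) W f g"
  "tensor_map K V (T_hopf K R mul) h i = tensor_map K V (tensor_words K R) h i"
  by (simp_all add: tensor_map_def)

lemma T_hopf_tensor_assoc [simp]:
  "tensor_assoc K (T_hopf K R mul) (T_hopf K R mul) (T_hopf K R mul) =
     tensor_assoc K (tensor_words K R) (tensor_words K R) (tensor_words K R)"
  by (simp add: tensor_assoc_def)

context abelian_monoid
begin

text \<open>The form in which the counit and the projection to R collapse a sum over all cuts of a
  word to a single cut.\<close>

lemma msum_splits_fst:
  assumes "h [] w \<in> carrier G" "\<And>a b. a \<noteq> [] \<Longrightarrow> a @ b = w \<Longrightarrow> h a b = \<zero>"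
  shows "msum G (\<lambda>p. h (fst p) (snd p)) (splits w) = h [] w"
proof (cases w)
  case (Cons x v)
  have "msum G (\<lambda>p. h (x # fst p) (snd p)) (splits v) = \<zero>"
    by (rule msum_zero, rule assms(2)) (use splits_pair[of _ v] Cons in auto)
  then show ?thesis using assms(1) Cons by (simp add: msum_image_mset)
qed (use assms in simp)

lemma msum_splits_snd:
  assumes "h w [] \<in> carrier G" "\<And>a b. b \<noteq> [] \<Longrightarrow> a @ b = w \<Longrightarrow> h a b = \<zero>"
  shows "msum G (\<lambda>p. h (fst p) (snd p)) (splits w) = h w []"
  using assms
proof (induction w arbitrary: h)
  case (Cons x w)
  have "msum G (\<lambda>p. h (x # fst p) (snd p)) (splits w) = h (x # w) []"
    by (rule Cons.IH) (use Cons.prems in auto)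
  moreover have "h [] (x # w) = \<zero>" by (rule Cons.prems(2)) auto
  ultimately show ?case using Cons.prems(1) by (simp add: msum_image_mset)
qed simp

end

context tensor_coalgebra
begin

sublocale T: module K T by (rule words_module)
sublocale TP: module_pair K T T by (intro module_pair.intro words_module)

abbreviation "TT \<equiv> tensor K T T"
abbreviation "pt \<equiv> pure_tensor K T T"
abbreviation "\<Delta> \<equiv> deconcatenation K R"
abbreviation "\<epsilon> \<equiv> T_counit K R"
abbreviation "\<pi> \<equiv> T_proj K R"

sublocale TT: module K TT by (rule TP.tensor_module)

lemma splits_L: "p \<in># splits w \<Longrightarrow> w \<in> L \<Longrightarrow> fst p \<in> L"
  "p \<in># splits w \<Longrightarrow> w \<in> L \<Longrightarrow> snd p \<in> L"
  using splits_lists by blast+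

lemma word_pt_ml:
  "b \<in> L \<Longrightarrow> (\<lambda>a. pt (wd a) (wd b)) \<in> mlin_maps K R TT"
  "a \<in> L \<Longrightarrow> (\<lambda>b. pt (wd a) (wd b)) \<in> mlin_maps K R TT"
  by (intro ml_lin_comp[OF word_ml] bilin1[OF TP.pure_bilin] bilin2[OF TP.pure_bilin] word_closed; assumption)+

lemma pt_word_closed: "a \<in> L \<Longrightarrow> b \<in> L \<Longrightarrow> pt (wd a) (wd b) \<in> carrier TT"
  by (intro TP.pure_closed word_closed)

lemma Delta_lin: "\<Delta> \<in> lin_maps K T TT"
  and Delta_word: "w \<in> L \<Longrightarrow> \<Delta> (wd w) = msum TT (\<lambda>p. pt (wd (fst p)) (wd (snd p))) (splits w)"
proof -
  let ?g = "\<lambda>w. \<Oplus>\<^bsub>TT\<^esub>i \<in> {..length w}. pt (wd (take i w)) (wd (drop i w))"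
  let ?h = "\<lambda>w. msum TT (\<lambda>p. pt (wd (fst p)) (wd (snd p))) (splits w)"
  have h: "?h \<in> mlin_maps K R TT"
    by (rule ml_splits[OF TT.module_axioms word_pt_ml])
  \<comment> \<open>The definition sums over cut positions, but multilinearity is available from
    \<open>ml_splits\<close> for the sum over \<open>splits\<close>; this equation transfers
    it.\<close>
  have eq: "?h w = ?g w" if "w \<in> L" for w
  proof -
    have "?g w = msum TT (\<lambda>i. pt (wd (take i w)) (wd (drop i w))) (mset_set {..length w})"
      using that by (intro TT.finsum_msum Pi_I pt_word_closed) (auto dest: in_set_takeD in_set_dropD)
    then show ?thesis by (simp add: splits_take_drop TT.msum_image_mset)
  qed
  have g: "?g \<in> mlin_maps K R TT"
    by (rule ml_cong[OF R h eq])
  have d: "\<Delta> = lift K TT ?g"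
    by (simp add: deconcatenation_def Let_def)
  show "\<Delta> \<in> lin_maps K T TT"
    unfolding d by (rule words_lift_lin[OF TT.module_axioms g])
  show "w \<in> L \<Longrightarrow> \<Delta> (wd w) = ?h w"
    unfolding d by (simp only: words_lift_word[OF TT.module_axioms g] eq)
qed

text \<open>Evaluates Sweedler sums: a bilinear expression in the two factors of a coproduct becomes
  a finite sum over the cuts of a word.\<close>

lemma lift_Delta_word:
  assumes U: "module K U" and g: "g \<in> bilin_maps K T T U" and w: "w \<in> L"
  shows "lift K U (\<lambda>(a, b). g a b) (\<Delta> (wd w)) = msum U (\<lambda>p. g (wd (fst p)) (wd (snd p))) (splits w)"
proof -
  interpret U: module K U by (rule U)
  show ?thesis
    unfolding Delta_word[OF w]
    by (subst lin_msum[OF TT.module_axioms U TP.tensor_lift_lin[OF U g]],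
        simp only: pt_word_closed splits_L[OF _ w], rule U.msum_cong[OF refl],
        simp only: TP.tensor_lift(2)[OF U g] word_closed splits_L[OF _ w])
qed

lemma eps_lin: "\<epsilon> \<in> lin_maps K T (scalars K)"
  and eps_word: "w \<in> L \<Longrightarrow> \<epsilon> (wd w) = (if w = [] then \<one>\<^bsub>K\<^esub> else \<zero>\<^bsub>K\<^esub>)"
proof -
  let ?g = "\<lambda>w. if w = [] then \<one>\<^bsub>K\<^esub> else \<zero>\<^bsub>K\<^esub>"
  have z: "\<zero>\<^bsub>scalars K\<^esub> = \<zero>\<^bsub>K\<^esub>" by (simp add: scalars_def)
  have g: "?g \<in> mlin_maps K R (scalars K)"
    using lin_zero_map[OF module_scalars[OF cringK], of R]
    by (intro mlin_mapsI) (simp_all add: z, simp add: scalars_def)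
  show "\<epsilon> \<in> lin_maps K T (scalars K)"
    unfolding T_counit_def by (rule words_lift_lin[OF module_scalars[OF cringK] g])
  show "w \<in> L \<Longrightarrow> \<epsilon> (wd w) = ?g w"
    unfolding T_counit_def by (rule words_lift_word[OF module_scalars[OF cringK] g])
qed

lemma eps_closed: "t \<in> carrier T \<Longrightarrow> \<epsilon> t \<in> carrier K"
  using lin_closed[OF eps_lin] by (simp add: scalars_def)

lemma pi_lin: "\<pi> \<in> lin_maps K T R"
  and pi_word: "w \<in> L \<Longrightarrow> \<pi> (wd w) = (if length w = 1 then hd w else \<zero>\<^bsub>R\<^esub>)"
proof -
  let ?g = "\<lambda>w. if length w = 1 then hd w else \<zero>\<^bsub>R\<^esub>"
  have g: "?g \<in> mlin_maps K R R"
  proof (rule mlin_mapsI)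
    fix u v assume "u \<in> L" "v \<in> L"
    show "(\<lambda>y. if length (u @ y # v) = 1 then hd (u @ y # v) else \<zero>\<^bsub>R\<^esub>) \<in> lin_maps K R R"
      using lin_id[of K R] lin_zero_map[OF R, of R] by (cases "u = [] \<and> v = []") auto
  qed simp
  show "\<pi> \<in> lin_maps K T R"
    unfolding T_proj_def by (rule words_lift_lin[OF R g])
  show "w \<in> L \<Longrightarrow> \<pi> (wd w) = ?g w"
    unfolding T_proj_def by (rule words_lift_word[OF R g])
qed

text \<open>Concatenation with a single letter on the left. Nothing more general is needed, since
  the left factor passes through \<pi> before it is attached.\<close>

definition conc where "conc x = lift K T (\<lambda>w. wd (x # w))"

lemma conc_bilin: "conc \<in> bilin_maps K R T T"
  and conc_word: "x \<in> carrier R \<Longrightarrow> w \<in> L \<Longrightarrow> conc x (wd w) = wd (x # w)"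
proof -
  have lin: "conc x \<in> lin_maps K T T" if "x \<in> carrier R" for x
    unfolding conc_def by (rule words_lift_lin[OF words_module ml_Cons[OF word_ml that]])
  have val: "conc x (wd w) = wd (x # w)" if "x \<in> carrier R" "w \<in> L" for x w
    unfolding conc_def by (rule words_lift_word[OF words_module ml_Cons[OF word_ml that(1)] that(2)])
  show "conc \<in> bilin_maps K R T T"
  proof (rule bilin_mapsI)
    fix t assume t: "t \<in> carrier T"
    show "(\<lambda>x. conc x t) \<in> lin_maps K R T"
    proof (rule words_lin_param[OF words_module R lin _ t])
      fix w assume w: "w \<in> L"
      show "(\<lambda>x. conc x (wd w)) \<in> lin_maps K R T"
        by (rule lin_cong[OF R ml_lin_hd[OF word_ml w]]) (simp add: val w)
    qed
  qed (rule lin)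
  show "x \<in> carrier R \<Longrightarrow> w \<in> L \<Longrightarrow> conc x (wd w) = wd (x # w)"
    by (rule val)
qed

lemma conc_zero: "t \<in> carrier T \<Longrightarrow> conc \<zero>\<^bsub>R\<^esub> t = \<zero>\<^bsub>T\<^esub>"
  by (rule lin_zero[OF R words_module bilin1[OF conc_bilin]])

text \<open>\<open>\<kappa>\<close> is a left inverse of \<open>\<Delta>\<close> on the augmentation ideal, so that an element of it is
  determined by its coproduct.\<close>

definition kappa where "kappa = lift K T (\<lambda>(a, b). conc (\<pi> a) b)"

lemma pi_conc_bilin: "(\<lambda>a b. conc (\<pi> a) b) \<in> bilin_maps K T T T"
  by (intro bilin_mapsI lin_comp[OF pi_lin] bilin1[OF conc_bilin] bilin2[OF conc_bilin] lin_closed[OF pi_lin])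

lemma kappa_lin: "kappa \<in> lin_maps K TT T"
  and kappa_pure: "a \<in> carrier T \<Longrightarrow> b \<in> carrier T \<Longrightarrow> kappa (pt a b) = conc (\<pi> a) b"
  unfolding kappa_def
  by (rule TP.tensor_lift_lin[OF words_module pi_conc_bilin], rule TP.tensor_lift(2)[OF words_module pi_conc_bilin])

text \<open>The projection \<pi> keeps only the cut after the first letter, and concatenation
  reassembles the word there. The empty word has no such cut.\<close>

lemma kappa_Delta_word: "w \<in> L \<Longrightarrow> kappa (\<Delta> (wd w)) = (if w = [] then \<zero>\<^bsub>T\<^esub> else wd w)"
proof -
  assume w: "w \<in> L"
  have "kappa (\<Delta> (wd w)) = msum T (\<lambda>p. conc (\<pi> (wd (fst p))) (wd (snd p))) (splits w)"
    unfolding kappa_def by (rule lift_Delta_word[OF words_module pi_conc_bilin w])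
  also have "\<dots> = (if w = [] then \<zero>\<^bsub>T\<^esub> else wd w)"
  proof (cases w)
    case Nil
    then show ?thesis by (simp add: pi_word conc_zero word_closed)
  next
    case (Cons x v)
    then have xv: "x \<in> carrier R" "v \<in> L" using w by auto
    have "msum T (\<lambda>p. conc (\<pi> (wd (x # fst p))) (wd (snd p))) (splits v) = conc (\<pi> (wd [x])) (wd v)"
    proof (rule T.msum_splits_fst)
      show "conc (\<pi> (wd [x])) (wd v) \<in> carrier T"
        using xv by (simp add: pi_word conc_word word_closed)
      fix a b assume ab: "a \<noteq> []" "a @ b = v"
      then have "a \<in> L" "b \<in> L" using xv by auto
      then show "conc (\<pi> (wd (x # a))) (wd b) = \<zero>\<^bsub>T\<^esub>"
        using xv ab by (simp add: pi_word conc_zero word_closed)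
    qed
    also have "\<dots> = wd w" using Cons xv by (simp add: pi_word conc_word)
    finally show ?thesis
      using Cons xv by (simp add: T.msum_image_mset pi_word conc_zero word_closed)
  qed
  finally show ?thesis .
qed

lemma eps_smult_lin: "t \<in> carrier T \<Longrightarrow> (\<lambda>a. \<epsilon> a \<odot>\<^bsub>T\<^esub> t) \<in> lin_maps K T T"
  by (rule lin_mapsI)
    (simp_all add: eps_closed lin_add[OF eps_lin] lin_smult[OF eps_lin] scalars_def T.smult_l_distr T.smult_assoc1)

lemma eps_kappa: 
  assumes "t \<in> carrier T"
  shows "\<epsilon> t \<odot>\<^bsub>T\<^esub> wd [] \<oplus>\<^bsub>T\<^esub> kappa (\<Delta> t) = t"
proof (rule words_eqI[OF words_module _ lin_id _ assms])
  show "(\<lambda>t. \<epsilon> t \<odot>\<^bsub>T\<^esub> wd [] \<oplus>\<^bsub>T\<^esub> kappa (\<Delta> t)) \<in> lin_maps K T T"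
    by (intro lin_add_map words_module eps_smult_lin lin_comp[OF Delta_lin kappa_lin] word_closed) simp
  show "\<epsilon> (wd w) \<odot>\<^bsub>T\<^esub> wd [] \<oplus>\<^bsub>T\<^esub> kappa (\<Delta> (wd w)) = wd w" if "w \<in> L" for w
    using that word_closed[of "[]"] word_closed[OF that]
    by (cases "w = []") (simp_all add: eps_word kappa_Delta_word T.smult_l_null)
qed

lemma counit_bilin:
  "(\<lambda>a b. \<epsilon> a \<odot>\<^bsub>T\<^esub> b) \<in> bilin_maps K T T T" "(\<lambda>a b. \<epsilon> b \<odot>\<^bsub>T\<^esub> a) \<in> bilin_maps K T T T"
  by (intro bilin_mapsI eps_smult_lin lin_smult_map[OF words_module lin_id] eps_closed; assumption)+

lemma counit:
  assumes "t \<in> carrier T"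
  shows "lift K T (\<lambda>(a, b). \<epsilon> a \<odot>\<^bsub>T\<^esub> b) (\<Delta> t) = t"
    and "lift K T (\<lambda>(a, b). \<epsilon> b \<odot>\<^bsub>T\<^esub> a) (\<Delta> t) = t"
proof -
  note lin = lin_comp[OF Delta_lin TP.tensor_lift_lin[OF words_module]]
  have z: "\<epsilon> (wd a) \<odot>\<^bsub>T\<^esub> wd b = \<zero>\<^bsub>T\<^esub>" if "a \<noteq> []" "a @ b \<in> L \<or> b @ a \<in> L" for a b
  proof -
    have "a \<in> L" "b \<in> L" using that by auto
    then show ?thesis using that by (simp add: eps_word word_closed T.smult_l_null)
  qed
  have o: "\<epsilon> (wd []) \<odot>\<^bsub>T\<^esub> wd w = wd w" if "w \<in> L" for w
    using word_closed[OF that] by (simp add: eps_word)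
  show "lift K T (\<lambda>(a, b). \<epsilon> a \<odot>\<^bsub>T\<^esub> b) (\<Delta> t) = t"
  proof (rule words_eqI[OF words_module lin[OF counit_bilin(1)] lin_id _ assms])
    fix w assume w: "w \<in> L"
    have "msum T (\<lambda>p. \<epsilon> (wd (fst p)) \<odot>\<^bsub>T\<^esub> wd (snd p)) (splits w) = \<epsilon> (wd []) \<odot>\<^bsub>T\<^esub> wd w"
    proof (rule T.msum_splits_fst[where h = "\<lambda>a b. \<epsilon> (wd a) \<odot>\<^bsub>T\<^esub> wd b"])
      show "\<epsilon> (wd a) \<odot>\<^bsub>T\<^esub> wd b = \<zero>\<^bsub>T\<^esub>" if "a \<noteq> []" "a @ b = w" for a b
        by (rule z[OF that(1)]) (simp add: that w)
    qed (simp only: o w word_closed)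
    then show "lift K T (\<lambda>(a, b). \<epsilon> a \<odot>\<^bsub>T\<^esub> b) (\<Delta> (wd w)) = wd w"
      by (simp only: lift_Delta_word[OF words_module counit_bilin(1) w] o w)
  qed
  show "lift K T (\<lambda>(a, b). \<epsilon> b \<odot>\<^bsub>T\<^esub> a) (\<Delta> t) = t"
  proof (rule words_eqI[OF words_module lin[OF counit_bilin(2)] lin_id _ assms])
    fix w assume w: "w \<in> L"
    have "msum T (\<lambda>p. \<epsilon> (wd (snd p)) \<odot>\<^bsub>T\<^esub> wd (fst p)) (splits w) = \<epsilon> (wd []) \<odot>\<^bsub>T\<^esub> wd w"
    proof (rule T.msum_splits_snd[where h = "\<lambda>a b. \<epsilon> (wd b) \<odot>\<^bsub>T\<^esub> wd a"])
      show "\<epsilon> (wd b) \<odot>\<^bsub>T\<^esub> wd a = \<zero>\<^bsub>T\<^esub>" if "b \<noteq> []" "a @ b = w" for a b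
        by (rule z[OF that(1)]) (simp add: that w)
    qed (simp only: o w word_closed)
    then show "lift K T (\<lambda>(a, b). \<epsilon> b \<odot>\<^bsub>T\<^esub> a) (\<Delta> (wd w)) = wd w"
      by (simp only: lift_Delta_word[OF words_module counit_bilin(2) w] o w)
  qed
qed

lemma coassoc:
  assumes "t \<in> carrier T"
  shows "tensor_assoc K T T T (tensor_map K TT T \<Delta> (\<lambda>y. y) (\<Delta> t)) =
    tensor_map K T TT (\<lambda>y. y) \<Delta> (\<Delta> t)"
proof -
  note mT = words_module and mTT = TT.module_axioms
  interpret P1: module_pair K TT T by (intro module_pair.intro mT mTT)
  interpret P2: module_pair K T TT by (intro module_pair.intro mT mTT)
  note l1 = tensor_map_in_lin[OF mT mT mTT mT Delta_lin lin_id]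
  note v1 = tensor_map_pure[OF mT mT mTT mT Delta_lin lin_id]
  note l2 = tensor_map_in_lin[OF mT mT mT mTT lin_id Delta_lin]
  note v2 = tensor_map_pure[OF mT mT mT mTT lin_id Delta_lin]
  note la = tensor_assoc_in_lin[OF mT mT mT] and va = tensor_assoc_pure[OF mT mT mT]
  let ?U = "tensor K T TT"
  let ?p = "\<lambda>a b c. pure_tensor K T TT (wd a) (pt (wd b) (wd c))"
  have mU: "module K ?U" by (rule P2.tensor_module)
  interpret U: module K ?U by (rule mU)
  show ?thesis
  proof (rule words_eqI[OF mU lin_comp[OF lin_comp[OF Delta_lin l1] la] lin_comp[OF Delta_lin l2] _ assms])
    fix w assume w: "w \<in> L"
    note dL = splits_L[OF _ w]
    have D: "\<Delta> (wd u) = msum TT (\<lambda>p. pt (wd (fst p)) (wd (snd p))) (splits u)" if "u \<in> L" for u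
      by (rule Delta_word[OF that])
    have "tensor_assoc K T T T (tensor_map K TT T \<Delta> (\<lambda>y. y) (\<Delta> (wd w))) =
      msum ?U (\<lambda>p. tensor_assoc K T T T (tensor_map K TT T \<Delta> (\<lambda>y. y) (pt (wd (fst p)) (wd (snd p))))) (splits w)"
      unfolding D[OF w]
      by (rule lin_msum[OF mTT mU lin_comp[OF l1 la]]) (simp add: pt_word_closed dL)
    also have "\<dots> = msum ?U (\<lambda>p. msum ?U (\<lambda>q. ?p (fst q) (snd q) (snd p)) (splits (fst p))) (splits w)"
    proof (intro U.msum_cong refl)
      fix p assume p: "p \<in># splits w"
      note pL = dL[OF p]
      have "tensor_assoc K T T T (tensor_map K TT T \<Delta> (\<lambda>y. y) (pt (wd (fst p)) (wd (snd p)))) =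
         tensor_assoc K T T T (pure_tensor K TT T (\<Delta> (wd (fst p))) (wd (snd p)))"
        by (simp only: v1 word_closed pL)
      also have "\<dots> = msum ?U (\<lambda>q. tensor_assoc K T T T
         (pure_tensor K TT T (pt (wd (fst q)) (wd (snd q))) (wd (snd p)))) (splits (fst p))"
        unfolding D[OF pL(1)]
        by (rule lin_msum[OF mTT mU lin_comp[OF bilin1[OF P1.pure_bilin word_closed[OF pL(2)]] la]])
          (simp add: pt_word_closed splits_L[OF _ pL(1)])
      also have "\<dots> = msum ?U (\<lambda>q. ?p (fst q) (snd q) (snd p)) (splits (fst p))"
        by (intro U.msum_cong refl) (simp only: va word_closed splits_L[OF _ pL(1)] pL)
      finally show "tensor_assoc K T T T (tensor_map K TT T \<Delta> (\<lambda>y. y) (pt (wd (fst p)) (wd (snd p)))) = \<dots>" .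
    qed
    also have "\<dots> = msum ?U (\<lambda>p. msum ?U (\<lambda>q. ?p (fst p) (fst q) (snd q)) (splits (snd p))) (splits w)"
      using arg_cong[OF splits_coassoc[of w], of "msum ?U (\<lambda>t. ?p (fst t) (fst (snd t)) (snd (snd t)))"]
      by (simp add: U.msum_sum_mset U.msum_image_mset)
    also have "\<dots> = msum ?U (\<lambda>p. tensor_map K T TT (\<lambda>y. y) \<Delta> (pt (wd (fst p)) (wd (snd p)))) (splits w)"
    proof (intro U.msum_cong refl)
      fix p assume p: "p \<in># splits w"
      note pL = dL[OF p]
      have "tensor_map K T TT (\<lambda>y. y) \<Delta> (pt (wd (fst p)) (wd (snd p))) =
         pure_tensor K T TT (wd (fst p)) (\<Delta> (wd (snd p)))"
        by (simp only: v2 word_closed pL)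
      also have "\<dots> = msum ?U (\<lambda>q. ?p (fst p) (fst q) (snd q)) (splits (snd p))"
        unfolding D[OF pL(2)]
        by (rule lin_msum[OF mTT mU bilin2[OF P2.pure_bilin word_closed[OF pL(1)]]])
          (simp add: pt_word_closed splits_L[OF _ pL(2)])
      finally show "msum ?U (\<lambda>q. ?p (fst p) (fst q) (snd q)) (splits (snd p)) =
        tensor_map K T TT (\<lambda>y. y) \<Delta> (pt (wd (fst p)) (wd (snd p)))" ..
    qed
    also have "\<dots> = tensor_map K T TT (\<lambda>y. y) \<Delta> (\<Delta> (wd w))"
      unfolding D[OF w]
      by (rule lin_msum[OF mTT mU l2, symmetric]) (simp add: pt_word_closed dL)
    finally show "tensor_assoc K T T T (tensor_map K TT T \<Delta> (\<lambda>y. y) (\<Delta> (wd w))) =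
      tensor_map K T TT (\<lambda>y. y) \<Delta> (\<Delta> (wd w))" .
  qed
qed

lemma module_T_hopf: "module K (T_hopf K R mul)"
  by (intro moduleI abelian_groupI cringK)
    (auto simp: T.a_ac T.smult_l_distr T.smult_r_distr T.smult_assoc1 intro: bexI[of _ "\<ominus>\<^bsub>T\<^esub> _"] T.l_neg)

lemma coalgebra_T_hopf: "coalgebra K (T_hopf K R mul)"
  unfolding coalgebra_def
  using module_T_hopf Delta_lin eps_lin coassoc counit by simp

lemma word_single_primitive:
  assumes "x \<in> carrier R"
  shows "wd [x] \<in> primitives K (T_hopf K R mul)"
  using assms by (simp add: primitives_def word_closed Delta_word pt_word_closed TT.a_comm)

text \<open>The counit axiom, applied to the coproduct of a primitive \<open>t\<close>, gives that
  \<epsilon>(t) times the unit is zero, so \<open>eps_kappa\<close> leaves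
  \<open>t = kappa (\<Delta> t)\<close>. Of the two terms of the coproduct, \<kappa> kills the one
  whose left factor is the unit and sends the other to the word with the single letter
  \<open>\<pi> t\<close>.\<close>

lemma primitive_eq:
  assumes "t \<in> primitives K (T_hopf K R mul)"
  shows "t = wd [\<pi> t]"
proof -
  have t: "t \<in> carrier T" and D: "\<Delta> t = pt t (wd []) \<oplus>\<^bsub>TT\<^esub> pt (wd []) t"
    using assms by (auto simp: primitives_def)
  have o: "wd [] \<in> carrier T" by (rule word_closed) simp
  have p: "\<pi> t \<in> carrier R" by (rule lin_closed[OF pi_lin t])
  note b1 = counit_bilin(1)
  have "t = lift K T (\<lambda>(a, b). \<epsilon> a \<odot>\<^bsub>T\<^esub> b) (\<Delta> t)"
    by (rule counit(1)[OF t, symmetric])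
  also have "\<dots> = \<epsilon> t \<odot>\<^bsub>T\<^esub> wd [] \<oplus>\<^bsub>T\<^esub> \<epsilon> (wd []) \<odot>\<^bsub>T\<^esub> t"
    unfolding D lin_add[OF TP.tensor_lift_lin[OF words_module b1] TP.pure_closed[OF t o] TP.pure_closed[OF o t]]
      TP.tensor_lift(2)[OF words_module b1 t o] TP.tensor_lift(2)[OF words_module b1 o t] ..
  also have "\<epsilon> (wd []) \<odot>\<^bsub>T\<^esub> t = t" using t by (simp add: eps_word)
  finally have "t = \<epsilon> t \<odot>\<^bsub>T\<^esub> wd [] \<oplus>\<^bsub>T\<^esub> t" .
  then have e: "\<epsilon> t \<odot>\<^bsub>T\<^esub> wd [] = \<zero>\<^bsub>T\<^esub>"
    using t o eps_closed[OF t] T.add.r_cancel_one' by (metis T.smult_closed)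
  have "kappa (\<Delta> t) = conc (\<pi> t) (wd []) \<oplus>\<^bsub>T\<^esub> conc (\<pi> (wd [])) t"
    unfolding D lin_add[OF kappa_lin TP.pure_closed[OF t o] TP.pure_closed[OF o t]]
      kappa_pure[OF t o] kappa_pure[OF o t] ..
  also have "\<dots> = wd [\<pi> t]"
    using t p by (simp add: pi_word conc_zero conc_word word_closed)
  finally show ?thesis
    using eps_kappa[OF t] e word_closed[of "[\<pi> t]"] p by simp
qed

lemma primitives_bij: "bij_betw (\<lambda>x. wd [x]) (carrier R) (primitives K (T_hopf K R mul))"
proof (rule bij_betwI[where g = \<pi>])
  show "\<pi> \<in> primitives K (T_hopf K R mul) \<rightarrow> carrier R"
    using lin_closed[OF pi_lin] by (auto simp: primitives_def)
qed (auto simp: word_single_primitive primitive_eq[symmetric] pi_word)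

end

section \<open>From Hopf algebras to brace algebras\<close>

context tensor_coalgebra
begin

abbreviation "H mul \<equiv> T_hopf K R mul"
text \<open>The bridge from the combinatorics to the Hopf algebra: a multiset of words is read as
  their sum in T^c(R).\<close>

abbreviation "E M \<equiv> msum T wd M"

lemma empty_closed: "wd [] \<in> carrier T"
  by (rule word_closed) simp

lemma conc_closed: "x \<in> carrier R \<Longrightarrow> t \<in> carrier T \<Longrightarrow> conc x t \<in> carrier T"
  by (rule bilin_closed[OF conc_bilin])

lemma conc_E:
  assumes "x \<in> carrier R" "\<And>w. w \<in># M \<Longrightarrow> w \<in> L"
  shows "conc x (E M) = E (image_mset ((#) x) M)"
proof -
  have "conc x (E M) = msum T (\<lambda>w. conc x (wd w)) M"
    by (rule bilin_msum2[OF words_module words_module conc_bilin assms(1) word_closed[OF assms(2)]])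
  also have "\<dots> = msum T (\<lambda>w. wd (x # w)) M"
    by (intro T.msum_cong refl conc_word assms)
  finally show ?thesis by (simp add: T.msum_image_mset)
qed

lemma pi_E:
  "(\<And>w. w \<in># M \<Longrightarrow> w \<in> L) \<Longrightarrow> \<pi> (E M) = msum R (\<lambda>w. \<pi> (wd w)) M"
  by (rule lin_msum[OF words_module R pi_lin word_closed])

lemma bilin_T_hopf: "mul \<in> bilin_maps K T T T \<Longrightarrow>
    monoid.mult (H mul) \<in> bilin_maps K (H mul) (H mul) (H mul)"
  by (simp add: bilin_maps_def)

lemma tensor_alg_T_hopf:
  assumes "mul \<in> bilin_maps K T T T"
  shows "monoid.mult (tensor_alg K (H mul) (H mul)) \<in> bilin_maps K TT TT TT"
    and "a \<in> carrier T \<Longrightarrow> b \<in> carrier T \<Longrightarrow> c \<in> carrier T \<Longrightarrow> d \<in> carrier T \<Longrightarrow>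
      pt a b \<otimes>\<^bsub>tensor_alg K (H mul) (H mul)\<^esub> pt c d = pt (mul a c) (mul b d)"
  using tensor_alg_mult_bilin[OF module_T_hopf module_T_hopf bilin_T_hopf[OF assms] bilin_T_hopf[OF assms]]
    tensor_alg_mult_pure[OF module_T_hopf module_T_hopf bilin_T_hopf[OF assms] bilin_T_hopf[OF assms], of a b c d]
  by (simp_all add: bilin_maps_def)

lemma Delta_mult_Delta:
  assumes m: "mul \<in> bilin_maps K T T T" and u: "u \<in> L" and v: "v \<in> L"
  shows "\<Delta> (wd u) \<otimes>\<^bsub>tensor_alg K (H mul) (H mul)\<^esub> \<Delta> (wd v) =
    msum TT (\<lambda>p. msum TT (\<lambda>q. pt (mul (wd (fst p)) (wd (fst q))) (mul (wd (snd p)) (wd (snd q)))) (splits v)) (splits u)"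
proof -
  let ?M = "monoid.mult (tensor_alg K (H mul) (H mul))"
  let ?p = "\<lambda>p. pt (wd (fst p)) (wd (snd p))"
  note b = tensor_alg_T_hopf(1)[OF m] and mTT = TT.module_axioms
  have "?M (\<Delta> (wd u)) (\<Delta> (wd v)) = msum TT (\<lambda>p. ?M (?p p) (\<Delta> (wd v))) (splits u)"
    unfolding Delta_word[OF u]
    by (rule bilin_msum1[OF mTT mTT b lin_closed[OF Delta_lin word_closed[OF v]] pt_word_closed[OF splits_L[OF _ u]]])
  also have "\<dots> = msum TT (\<lambda>p. msum TT (\<lambda>q. ?M (?p p) (?p q)) (splits v)) (splits u)"
    unfolding Delta_word[OF v]
    by (intro TT.msum_cong refl bilin_msum2[OF mTT mTT b] pt_word_closed splits_L[OF _ u] splits_L[OF _ v])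
  also have "\<dots> = msum TT (\<lambda>p. msum TT (\<lambda>q. pt (mul (wd (fst p)) (wd (fst q))) (mul (wd (snd p)) (wd (snd q)))) (splits v)) (splits u)"
    by (intro TT.msum_cong refl tensor_alg_T_hopf(2)[OF m] word_closed splits_L[OF _ u] splits_L[OF _ v])
  finally show ?thesis .
qed

lemma lin_span_T:
  "submodule (lin_span K T {wd w | w. w \<in> L \<and> P w}) K T"
  by (rule submodule_lin_span[OF words_module]) (auto intro: word_closed simp: in_lists_conv_set)

lemma tensor_part_submodule: "submodule (tensor_part K R N) K T"
  unfolding tensor_part_def by (rule lin_span_T)

lemma tensor_part_word: "w \<in> L \<Longrightarrow> length w \<in> N \<Longrightarrow> wd w \<in> tensor_part K R N"
  unfolding tensor_part_def by (rule subsetD[OF lin_span_superset]) blast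

lemma tensor_part_minimal:
  "(\<And>w. w \<in> L \<Longrightarrow> length w \<in> N \<Longrightarrow> wd w \<in> A) \<Longrightarrow> submodule A K T \<Longrightarrow> tensor_part K R N \<subseteq> A"
  unfolding tensor_part_def by (rule lin_span_minimal) auto

lemma kernel_submodule:
  assumes "module K W" "f \<in> lin_maps K T W"
  shows "submodule {t \<in> carrier T. f t = \<zero>\<^bsub>W\<^esub>} K T"
proof -
  interpret W: module K W by fact
  show ?thesis
    by (rule T.submoduleI)
      (auto simp: lin_zero[OF words_module assms] lin_uminus[OF words_module assms]
        lin_add[OF assms(2)] lin_smult[OF assms(2)] W.smult_r_null)
qed

text \<open>A word of the product of \<open>[x]\<close> and \<open>v\<close> has length one only if
  \<open>x\<close> absorbs all of \<open>v\<close> at once, and this occurs exactly once. The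
  function \<open>h\<close> is \<pi> in one application, and in another \<pi> after right
  multiplication by a word, which kills longer words by right-sidedness.\<close>

lemma msum_wprods_single:
  assumes W: "abelian_monoid W" and c: "h [br x v] \<in> carrier W"
    and z: "\<And>w. w \<in># wprods br [x] v \<Longrightarrow> length w \<noteq> 1 \<Longrightarrow> h w = \<zero>\<^bsub>W\<^esub>"
  shows "msum W h (wprods br [x] v) = h [br x v]"
proof (cases v)
  case Nil
  interpret W: abelian_monoid W by fact
  show ?thesis using c Nil by simp
next
  case (Cons y v')
  interpret W: abelian_monoid W by fact
  have 1: "msum W h (image_mset ((#) y) (wprods br [x] v')) = \<zero>\<^bsub>W\<^esub>"
    unfolding W.msum_image_mset
  proof (rule W.msum_zero)
    fix w assume w: "w \<in># wprods br [x] v'"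
    then show "h (y # w) = \<zero>\<^bsub>W\<^esub>"
      using wprods_length[OF w] Cons by (intro z) auto
  qed
  have 2: "msum W (\<lambda>p. h (br x (fst p) # snd p)) (splits v) = h [br x v]"
  \<comment> \<open>If \<open>x\<close> absorbs a proper prefix, the remaining letters stay behind
    the brace and the word has length at least two.\<close>
  proof (rule W.msum_splits_snd[where h = "\<lambda>a b. h (br x a # b)"])
    fix a b assume ab: "b \<noteq> []" "a @ b = v"
    have "(a, b) \<in># splits v"
      using splits_mem ab(2) by blast
    then have "br x a # b \<in># (\<Sum>p \<in># splits v. image_mset ((#) (br x (fst p))) {#snd p#})"
      by force
    then show "h (br x a # b) = \<zero>\<^bsub>W\<^esub>"
      using ab Cons by (intro z) auto
  qed (rule c)
  have "wprods br [x] v = image_mset ((#) y) (wprods br [x] v') + (\<Sum>p \<in># splits v. {#br x (fst p) # snd p#})"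
    using Cons by simp
  then show ?thesis
    using 1 2 c by (simp add: W.msum_union W.msum_image_mset)
qed

end

locale right_sided = tensor_coalgebra K R for K :: "('k, 'm) ring_scheme" and R :: "('k, 'a, 'n) module_scheme" +
  fixes mul :: "('k, 'a) T_product"
  assumes cha: "right_sided_CHA K R mul"
begin

abbreviation "br \<equiv> CHA_brace K R mul"

lemma hopf: "hopf_algebra K (H mul)"
  using cha by (simp add: right_sided_CHA_def CHA_def)

lemma alg: "unital_assoc_algebra K (H mul)" and bialg: "bialgebra K (H mul)"
  using hopf by (simp_all add: hopf_algebra_def bialgebra_def)

sublocale HR: ring "H mul"
  using alg by (simp add: unital_assoc_algebra_def)

lemma mul_bilin: "mul \<in> bilin_maps K T T T"
  using alg HR.l_distr HR.r_distr HR.m_closed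
  by (intro bilin_mapsI lin_mapsI) (auto simp: unital_assoc_algebra_def)

lemma mul_closed: "s \<in> carrier T \<Longrightarrow> t \<in> carrier T \<Longrightarrow> mul s t \<in> carrier T"
  by (rule bilin_closed[OF mul_bilin])

lemma mul_assoc: "s \<in> carrier T \<Longrightarrow> t \<in> carrier T \<Longrightarrow> r \<in> carrier T \<Longrightarrow> mul (mul s t) r = mul s (mul t r)"
  using HR.m_assoc by simp

lemma mul_one: "t \<in> carrier T \<Longrightarrow> mul (wd []) t = t" "t \<in> carrier T \<Longrightarrow> mul t (wd []) = t"
  using HR.l_one HR.r_one by simp_all

lemma Delta_mul: "s \<in> carrier T \<Longrightarrow> t \<in> carrier T \<Longrightarrow>
    \<Delta> (mul s t) = \<Delta> s \<otimes>\<^bsub>tensor_alg K (H mul) (H mul)\<^esub> \<Delta> t"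
  using bialg ring_hom_mult[of \<Delta> "H mul" "tensor_alg K (H mul) (H mul)" s t] by (simp add: bialgebra_def)

lemma eps_mul: "s \<in> carrier T \<Longrightarrow> t \<in> carrier T \<Longrightarrow> \<epsilon> (mul s t) = \<epsilon> s \<otimes>\<^bsub>K\<^esub> \<epsilon> t"
  using bialg ring_hom_mult[of \<epsilon> "H mul" K s t] by (simp add: bialgebra_def)

lemma brace_eq: "x \<in> carrier R \<Longrightarrow> ys \<in> L \<Longrightarrow> br x ys = \<pi> (mul (wd [x]) (wd ys))"
  by (simp add: CHA_brace_def M_op_def tensor_part_word)

lemma brace_closed: "x \<in> carrier R \<Longrightarrow> ys \<in> L \<Longrightarrow> br x ys \<in> carrier R"
  by (simp add: brace_eq lin_closed[OF pi_lin] mul_closed word_closed)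

lemma brace_empty: "x \<in> carrier R \<Longrightarrow> br x [] = x"
  by (simp add: brace_eq mul_one word_closed pi_word)

text \<open>The right ideal condition for q = 2: the product stays in the span of the words of
  length at least two, and \<pi> vanishes on these.\<close>

lemma pi_mul_long:
  assumes u: "u \<in> L" "length u \<ge> 2" and t: "t \<in> carrier T"
  shows "\<pi> (mul (wd u) t) = \<zero>\<^bsub>R\<^esub>"
proof -
  let ?N = "{n. (2::int) \<le> int n}"
  have "right_ideal (H mul) (tensor_part K R ?N)"
    using cha unfolding right_sided_CHA_def by blast
  moreover have "wd u \<in> tensor_part K R ?N"
    using u by (intro tensor_part_word) auto
  ultimately have "mul (wd u) t \<in> tensor_part K R ?N"
    using t by (simp add: right_ideal_def)
  also have "\<dots> \<subseteq> {t \<in> carrier T. \<pi> t = \<zero>\<^bsub>R\<^esub>}"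
    by (rule tensor_part_minimal[OF _ kernel_submodule[OF R pi_lin]])
      (auto simp: pi_word word_closed in_lists_conv_set)
  finally show ?thesis by blast
qed

lemma mul_word_rec:
  assumes u: "u \<in> L" and v: "v \<in> L"
  shows "mul (wd u) (wd v) = (\<epsilon> (wd u) \<otimes>\<^bsub>K\<^esub> \<epsilon> (wd v)) \<odot>\<^bsub>T\<^esub> wd [] \<oplus>\<^bsub>T\<^esub>
    msum T (\<lambda>p. msum T (\<lambda>q. conc (\<pi> (mul (wd (fst p)) (wd (fst q)))) (mul (wd (snd p)) (wd (snd q)))) (splits v)) (splits u)"
proof -
  let ?f = "\<lambda>p q. mul (wd (fst p)) (wd (fst q))" and ?s = "\<lambda>p q. mul (wd (snd p)) (wd (snd q))"
  have c: "?f p q \<in> carrier T" "?s p q \<in> carrier T" if "p \<in># splits u" "q \<in># splits v" for p q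
    using splits_L[OF that(1) u] splits_L[OF that(2) v] by (simp_all add: mul_closed word_closed)
  note mT = words_module and mTT = TT.module_axioms
  have "kappa (\<Delta> (mul (wd u) (wd v))) =
     kappa (msum TT (\<lambda>p. msum TT (\<lambda>q. pt (?f p q) (?s p q)) (splits v)) (splits u))"
    using u v by (simp only: Delta_mul word_closed Delta_mult_Delta[OF mul_bilin u v])
  also have "\<dots> = msum T (\<lambda>p. kappa (msum TT (\<lambda>q. pt (?f p q) (?s p q)) (splits v))) (splits u)"
    by (rule lin_msum[OF mTT mT kappa_lin]) (rule TT.msum_closed)
  also have "\<dots> = msum T (\<lambda>p. msum T (\<lambda>q. kappa (pt (?f p q) (?s p q))) (splits v)) (splits u)"
    by (intro T.msum_cong refl lin_msum[OF mTT mT kappa_lin] TP.pure_closed c)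
  also have "\<dots> = msum T (\<lambda>p. msum T (\<lambda>q. conc (\<pi> (?f p q)) (?s p q)) (splits v)) (splits u)"
    by (intro T.msum_cong refl kappa_pure c)
  finally show ?thesis
    using eps_kappa[OF mul_closed[OF word_closed[OF u] word_closed[OF v]]]
    by (simp only: eps_mul word_closed u v)
qed

lemma mul_words: "u \<in> L \<Longrightarrow> v \<in> L \<Longrightarrow> mul (wd u) (wd v) = E (wprods br u v)"
proof (induction u arbitrary: v)
  case Nil
  then show ?case by (simp add: mul_one word_closed)
next
  case (Cons x u)
  have x: "x \<in> carrier R" and u: "u \<in> L" using Cons.prems(1) by auto
  \<comment> \<open>The recursion either keeps \<open>x # u\<close> and shortens the second word, or
    shortens the first word and meets any suffix of the second. Hence an induction on
    \<open>v\<close> inside an induction on \<open>u\<close> with the second word arbitrary.\<close>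
  from Cons.prems(2) show ?case
  proof (induction v rule: list.induct)
    case Nil
    have "wprods br (x # u) [] = {#x # u#}"
      using Cons.prems(1) by (intro wprods_Nil2 brace_empty) auto
    then show ?case using Cons.prems(1) by (simp add: mul_one word_closed)
  next
    case (Cons z v)
    note IHv = Cons.IH
    have z: "z \<in> carrier R" and v: "v \<in> L" and zv: "z # v \<in> L" and xu: "x # u \<in> L"
      using Cons.prems x u by auto
    let ?f = "\<lambda>p q. conc (\<pi> (mul (wd (fst p)) (wd (fst q)))) (mul (wd (snd p)) (wd (snd q)))"
    note m = mul_closed[OF word_closed word_closed]
    \<comment> \<open>The cut of \<open>x # u\<close> with empty left part: \<pi> is applied to a
      prefix of \<open>z # v\<close> multiplied by the unit, so only the prefix \<open>[z]\<close>
      survives.\<close>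
    have 1: "msum T (\<lambda>q. ?f ([], x # u) q) (splits (z # v)) = conc z (mul (wd (x # u)) (wd v))"
    proof -
      have "msum T (\<lambda>q. ?f ([], x # u) q) (splits (z # v)) =
        conc (\<pi> (mul (wd []) (wd []))) (mul (wd (x # u)) (wd (z # v))) \<oplus>\<^bsub>T\<^esub>
        msum T (\<lambda>q. conc (\<pi> (mul (wd []) (wd (z # fst q)))) (mul (wd (x # u)) (wd (snd q)))) (splits v)"
        using x u z v by (simp add: T.msum_image_mset conc_closed lin_closed[OF pi_lin] m)
      also have "conc (\<pi> (mul (wd []) (wd []))) (mul (wd (x # u)) (wd (z # v))) = \<zero>\<^bsub>T\<^esub>"
        using xu zv by (simp only: mul_one empty_closed) (simp add: pi_word conc_zero m)
      also have "msum T (\<lambda>q. conc (\<pi> (mul (wd []) (wd (z # fst q)))) (mul (wd (x # u)) (wd (snd q)))) (splits v) =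
        conc (\<pi> (mul (wd []) (wd [z]))) (mul (wd (x # u)) (wd v))"
      proof (rule T.msum_splits_fst)
        show "conc (\<pi> (mul (wd []) (wd [z]))) (mul (wd (x # u)) (wd v)) \<in> carrier T"
          using x u z v by (intro conc_closed lin_closed[OF pi_lin] m) auto
        fix a b assume ab: "a \<noteq> []" "a @ b = v"
        then have "a \<in> L" "b \<in> L" using v by auto
        then show "conc (\<pi> (mul (wd []) (wd (z # a)))) (mul (wd (x # u)) (wd b)) = \<zero>\<^bsub>T\<^esub>"
          using ab z xu by (simp add: mul_one word_closed pi_word conc_zero m)
      qed
      also have "\<dots> = conc z (mul (wd (x # u)) (wd v))"
        using z by (simp add: mul_one word_closed pi_word)
      finally show ?thesis using conc_closed[OF z m[OF xu v]] by simp
    qed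
    \<comment> \<open>The cuts of \<open>x # u\<close> with nonempty left part: by right-sidedness
      only the left part \<open>[x]\<close> contributes, and \<pi> of its product with a prefix is
      the brace.\<close>
    have 2: "msum T (\<lambda>p. msum T (\<lambda>q. ?f (x # fst p, snd p) q) (splits (z # v))) (splits u) =
       msum T (\<lambda>q. conc (br x (fst q)) (mul (wd u) (wd (snd q)))) (splits (z # v))"
    proof -
      let ?h = "\<lambda>a b. msum T (\<lambda>q. ?f (x # a, b) q) (splits (z # v))"
      have "msum T (\<lambda>p. ?h (fst p) (snd p)) (splits u) = ?h [] u"
      proof (rule T.msum_splits_fst)
        fix a b assume ab: "a \<noteq> []" "a @ b = u"
        then have abL: "a \<in> L" "b \<in> L" using u by auto
        have "Suc 0 \<le> length a" using ab by (cases a) auto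
        then show "?h a b = \<zero>\<^bsub>T\<^esub>"
          using abL x by (intro T.msum_zero) (simp add: pi_mul_long conc_zero m word_closed splits_L[OF _ zv])
      qed simp
      also have "\<dots> = msum T (\<lambda>q. conc (br x (fst q)) (mul (wd u) (wd (snd q)))) (splits (z # v))"
        by (intro T.msum_cong refl) (simp add: brace_eq x splits_L(1)[OF _ zv])
      finally show ?thesis by simp
    qed
    have br: "\<And>y ys. y \<in> carrier R \<Longrightarrow> ys \<in> L \<Longrightarrow> br y ys \<in> carrier R" by (rule brace_closed)
    have pL: "w \<in> L" if "w \<in># wprods br a b" "a \<in> L" "b \<in> L" for w a b
      by (rule wprods_closed[where br = br, OF _ that(2,3,1)]) (rule br)
    \<comment> \<open>The counit term of \<open>mul_word_rec\<close> is zero here, since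
      \<open>x # u\<close> is not empty.\<close>
    have "mul (wd (x # u)) (wd (z # v)) =
      msum T (\<lambda>p. msum T (?f p) (splits (z # v))) (splits (x # u))"
      using x u z v by (subst mul_word_rec[OF xu zv]) (simp add: eps_word T.smult_l_null empty_closed)
    also have "\<dots> = msum T (?f ([], x # u)) (splits (z # v)) \<oplus>\<^bsub>T\<^esub>
      msum T (\<lambda>p. msum T (\<lambda>q. ?f (x # fst p, snd p) q) (splits (z # v))) (splits u)"
      by (simp add: T.msum_image_mset del: splits.simps(2)[of z v])
    also have "\<dots> = conc z (mul (wd (x # u)) (wd v)) \<oplus>\<^bsub>T\<^esub>
      msum T (\<lambda>q. conc (br x (fst q)) (mul (wd u) (wd (snd q)))) (splits (z # v))"
      unfolding 1 2 ..
    also have "conc z (mul (wd (x # u)) (wd v)) = E (image_mset ((#) z) (wprods br (x # u) v))"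
      using IHv v by (simp only:) (rule conc_E[OF z pL[OF _ xu v]])
    also have "msum T (\<lambda>q. conc (br x (fst q)) (mul (wd u) (wd (snd q)))) (splits (z # v)) =
      msum T (\<lambda>q. E (image_mset ((#) (br x (fst q))) (wprods br u (snd q)))) (splits (z # v))"
    proof (intro T.msum_cong refl)
      fix q assume q: "q \<in># splits (z # v)"
      note qL = splits_L[OF q zv]
      show "conc (br x (fst q)) (mul (wd u) (wd (snd q))) = E (image_mset ((#) (br x (fst q))) (wprods br u (snd q)))"
        unfolding \<open>\<And>v. u \<in> L \<Longrightarrow> v \<in> L \<Longrightarrow> mul (wd u) (wd v) = E (wprods br u v)\<close>[OF u qL(2)]
        by (rule conc_E[OF br[OF x qL(1)] pL[OF _ u qL(2)]])
    qed
    also have "E (image_mset ((#) z) (wprods br (x # u) v)) \<oplus>\<^bsub>T\<^esub> \<dots> = E (wprods br (x # u) (z # v))"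
      unfolding wprods.simps(3) T.msum_union T.msum_sum_mset ..
    finally show ?case .
  qed
qed

lemma wprods_brace_L: "a \<in> L \<Longrightarrow> b \<in> L \<Longrightarrow> w \<in># wprods br a b \<Longrightarrow> w \<in> L"
  by (rule wprods_closed[where br = br]) (rule brace_closed)

lemma brace_brace:
  assumes x: "x \<in> carrier R" and ys: "ys \<in> L" and zs: "zs \<in> L"
  shows "br (br x ys) zs = msum R (br x) (wprods br ys zs)"
proof -
  have xL: "[x] \<in> L" using x by simp
  note w = word_closed[OF xL] word_closed[OF ys] word_closed[OF zs]
  have lin: "(\<lambda>t. \<pi> (mul t (wd zs))) \<in> lin_maps K T R"
    by (rule lin_comp[OF bilin1[OF mul_bilin w(3)] pi_lin])
  have lin2: "(\<lambda>t. \<pi> (mul (wd [x]) t)) \<in> lin_maps K T R"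
    by (rule lin_comp[OF bilin2[OF mul_bilin w(1)] pi_lin])
  have "\<pi> (mul (mul (wd [x]) (wd ys)) (wd zs)) = msum R (\<lambda>w. \<pi> (mul (wd w) (wd zs))) (wprods br [x] ys)"
    unfolding mul_words[OF xL ys]
    by (rule lin_msum[OF words_module R lin word_closed[OF wprods_brace_L[OF xL ys]]])
  \<comment> \<open>All words of the first product other than the brace itself have length at least
    two, and right-sidedness makes their products with \<open>zs\<close> vanish under \<pi>.\<close>
  also have "\<dots> = \<pi> (mul (wd [br x ys]) (wd zs))"
  proof (rule msum_wprods_single)
    show "abelian_monoid R" by (rule R.abelian_monoid_axioms)
    show "\<pi> (mul (wd [br x ys]) (wd zs)) \<in> carrier R"
      using brace_closed[OF x ys] w by (intro lin_closed[OF lin] word_closed) simp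
    fix a assume a: "a \<in># wprods br [x] ys" "length a \<noteq> 1"
    then show "\<pi> (mul (wd a) (wd zs)) = \<zero>\<^bsub>R\<^esub>"
      using wprods_length[OF a(1)] by (intro pi_mul_long wprods_brace_L[OF xL ys] w) auto
  qed
  also have "\<dots> = br (br x ys) zs"
    by (rule brace_eq[OF brace_closed[OF x ys] zs, symmetric])
  finally have 1: "\<pi> (mul (mul (wd [x]) (wd ys)) (wd zs)) = br (br x ys) zs" .
  have "\<pi> (mul (wd [x]) (mul (wd ys) (wd zs))) = msum R (\<lambda>w. \<pi> (mul (wd [x]) (wd w))) (wprods br ys zs)"
    unfolding mul_words[OF ys zs]
    by (rule lin_msum[OF words_module R lin2 word_closed[OF wprods_brace_L[OF ys zs]]])
  also have "\<dots> = msum R (br x) (wprods br ys zs)"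
    by (intro R.msum_cong refl brace_eq[OF x, symmetric] wprods_brace_L[OF ys zs])
  finally show ?thesis
    using 1 mul_assoc[OF w] by simp
qed

end

text \<open>Both directions of the equivalence use the brace identity in the form on the right; only
  here does the index sum of the axiom have to be handled.\<close>

lemma brace_identity_sum:
  assumes "abelian_monoid R" "ys \<in> lists (carrier R)" "zs \<in> lists (carrier R)" "x \<in> carrier R"
    and br: "\<And>y vs. y \<in> carrier R \<Longrightarrow> vs \<in> lists (carrier R) \<Longrightarrow> br y vs \<in> carrier R"
  shows "(\<Oplus>\<^bsub>R\<^esub>p \<in> brace_indices (length ys) (length zs). brace_term br x ys zs (fst p) (snd p)) =
    msum R (br x) (wprods br ys zs)"
proof -
  interpret R: abelian_monoid R by fact
  let ?w = "\<lambda>p. brace_word br 0 ys zs (fst p) (snd p)"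
  let ?I = "brace_indices (length ys) (length zs)"
  have w: "?w p \<in> lists (carrier R)" if "p \<in> ?I" for p
  proof (rule wprods_closed[OF br assms(2,3)])
    show "?w p \<in># wprods br ys zs"
      unfolding brace_words[symmetric] using that finite_brace_indices by simp
  qed
  have "(\<Oplus>\<^bsub>R\<^esub>p \<in> ?I. brace_term br x ys zs (fst p) (snd p)) = msum R (\<lambda>p. br x (?w p)) (mset_set ?I)"
    unfolding brace_term_eq
    by (intro R.finsum_msum finite_brace_indices Pi_I br assms(4) w)
  also have "\<dots> = msum R (br x) (image_mset ?w (mset_set ?I))"
    by (rule R.msum_image_mset[symmetric])
  also have "\<dots> = msum R (br x) (wprods br ys zs)"
    by (simp only: brace_words)
  finally show ?thesis .
qed

context right_sided
begin

theorem brace_algebra_CHA: "brace_algebra K R br"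
  unfolding brace_algebra_def
proof (intro conjI ballI impI)
  show "module K R" by (rule R)
  show "br x [] = x" if "x \<in> carrier R" for x by (rule brace_empty[OF that])
  show "(\<lambda>x. br x ys) \<in> lin_maps K R R" if ys: "ys \<in> L" for ys
    by (rule lin_cong[OF R lin_comp[OF lin_comp[OF ml_lin_hd[OF word_ml]
            bilin1[OF mul_bilin word_closed[OF ys]]] pi_lin], of "[]"])
      (simp_all add: brace_eq ys)
  show "(\<lambda>y. br x (us @ y # vs)) \<in> lin_maps K R R"
    if x: "x \<in> carrier R" and us: "us \<in> L" and vs: "vs \<in> L" for x us vs
    by (rule lin_cong[OF R lin_comp[OF lin_comp[OF ml_lin[OF word_ml us vs]
            bilin2[OF mul_bilin word_closed[of "[x]"]]] pi_lin]])
      (use x us vs in \<open>simp_all add: brace_eq\<close>)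
  show "br (br x ys) zs = (\<Oplus>\<^bsub>R\<^esub>p \<in> brace_indices (length ys) (length zs).
      brace_term br x ys zs (fst p) (snd p))"
    if "x \<in> carrier R" "ys \<in> L" "zs \<in> L" for x ys zs
    using brace_brace[OF that] brace_identity_sum[OF R.abelian_monoid_axioms that(2,3,1) brace_closed]
    by simp
qed

end

section \<open>From brace algebras to Hopf algebras\<close>

text \<open>Every clause for a nonempty \<open>u\<close> puts a letter in front of the word, and the
  remaining clause returns \<open>v\<close>. This is what makes \<epsilon> multiplicative.\<close>

lemma wprods_empty_notin: "u \<noteq> [] \<or> v \<noteq> [] \<Longrightarrow> [] \<notin># wprods br u v"
  by (induction br u v rule: wprods.induct) auto

locale brace = tensor_coalgebra K R for K :: "('k, 'm) ring_scheme" and R :: "('k, 'a, 'n) module_scheme" +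
  fixes br :: "'a \<Rightarrow> 'a list \<Rightarrow> 'a"
  assumes brace_algebra: "brace_algebra K R br"
begin

lemma br_Nil: "x \<in> carrier R \<Longrightarrow> br x [] = x"
  using brace_algebra by (simp add: brace_algebra_def)

lemma br_lin_fst: "ys \<in> L \<Longrightarrow> (\<lambda>x. br x ys) \<in> lin_maps K R R"
proof (cases "ys = []")
  case True
  show ?thesis unfolding True
    by (rule lin_cong[OF R lin_id]) (simp add: br_Nil)
next
  case False
  assume "ys \<in> L"
  then show ?thesis using False brace_algebra unfolding brace_algebra_def by blast
qed

lemma br_ml: 
  assumes "x \<in> carrier R"
  shows "br x \<in> mlin_maps K R R"
proof (rule mlin_mapsI)
  show "br x [] \<in> carrier R" using assms by (simp add: br_Nil)
  show "(\<lambda>y. br x (u @ y # v)) \<in> lin_maps K R R" if "u \<in> L" "v \<in> L" for u v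
    using brace_algebra assms that unfolding brace_algebra_def by blast
qed

lemma br_closed: "x \<in> carrier R \<Longrightarrow> ys \<in> L \<Longrightarrow> br x ys \<in> carrier R"
  by (rule lin_closed[OF br_lin_fst])

lemma wprods_L: "u \<in> L \<Longrightarrow> v \<in> L \<Longrightarrow> w \<in># wprods br u v \<Longrightarrow> w \<in> L"
  by (rule wprods_closed[where br = br]) (rule br_closed)

lemma wprods_Nil2_br: "u \<in> L \<Longrightarrow> wprods br u [] = {#u#}"
  by (rule wprods_Nil2) (auto simp: br_Nil)

text \<open>Extends the axiom to empty lists by the convention {x; } = x. They occur as the prefixes
  that a letter absorbs in the proof of associativity.\<close>

lemma br_br:
  assumes x: "x \<in> carrier R" and ys: "ys \<in> L" and zs: "zs \<in> L"
  shows "br (br x ys) zs = msum R (br x) (wprods br ys zs)"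
proof -
  note c = br_closed[OF br_closed[OF x ys] zs] br_closed[OF x ys] br_closed[OF x zs]
  consider "ys = []" | "zs = []" | "ys \<noteq> []" "zs \<noteq> []" by blast
  then show ?thesis
  proof cases
    case 1
    then show ?thesis using x c by (simp add: br_Nil)
  next
    case 2
    then show ?thesis using x ys c by (simp add: br_Nil wprods_Nil2_br)
  next
    case 3
    then have "br (br x ys) zs = (\<Oplus>\<^bsub>R\<^esub>p \<in> brace_indices (length ys) (length zs).
          brace_term br x ys zs (fst p) (snd p))"
      using brace_algebra assms unfolding brace_algebra_def by blast
    also have "\<dots> = msum R (br x) (wprods br ys zs)"
      by (rule brace_identity_sum[OF R.abelian_monoid_axioms ys zs x br_closed])
    finally show ?thesis .
  qed
qed

section \<open>Multilinearity of the product in the letters of both words\<close>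

lemma E_Nil:
  assumes "x \<in> carrier R" "u \<in> L"
  shows "E (wprods br (x # u) []) = conc x (E (wprods br u []))"
  using assms by (simp add: br_Nil wprods_Nil2_br conc_word word_closed)

lemma E_Cons:
  assumes x: "x \<in> carrier R" and u: "u \<in> L" and z: "z \<in> carrier R" and v: "v \<in> L"
  shows "E (wprods br (x # u) (z # v)) = conc z (E (wprods br (x # u) v)) \<oplus>\<^bsub>T\<^esub>
    msum T (\<lambda>p. conc (br x (fst p)) (E (wprods br u (snd p)))) (splits (z # v))"
proof -
  have xu: "x # u \<in> L" and zv: "z # v \<in> L" using assms by auto
  have 1: "conc z (E (wprods br (x # u) v)) = E (image_mset ((#) z) (wprods br (x # u) v))"
    by (rule conc_E[OF z wprods_L[OF xu v]])
  have 2: "msum T (\<lambda>p. conc (br x (fst p)) (E (wprods br u (snd p)))) (splits (z # v)) =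
    msum T (\<lambda>p. E (image_mset ((#) (br x (fst p))) (wprods br u (snd p)))) (splits (z # v))"
    by (intro T.msum_cong refl conc_E[OF br_closed[OF x] wprods_L[OF u]]) (simp_all only: splits_L[OF _ zv])
  show ?thesis
    unfolding 1 2 wprods.simps(3) T.msum_union T.msum_sum_mset ..
qed

lemma conc_lin_comp:
  assumes "module K V" "f \<in> lin_maps K V R" "t \<in> carrier T"
  shows "(\<lambda>y. conc (f y) t) \<in> lin_maps K V T"
  by (rule lin_comp[OF assms(2) bilin1[OF conc_bilin assms(3)]])

text \<open>Within the induction on \<open>u\<close>, a second one runs over the letters
  \<open>v1\<close> in front of the varied letter: the first summand of the recursion passes to a
  shorter \<open>v1\<close>, and the second, in which the braces occur, is covered by the hypothesis
  for \<open>u\<close>.\<close>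

lemma E_ml_snd: "u \<in> L \<Longrightarrow> (\<lambda>v. E (wprods br u v)) \<in> mlin_maps K R T"
proof (induction u)
  case Nil
  show ?case
    by (rule ml_cong[OF R word_ml]) (simp add: word_closed)
next
  case (Cons x u)
  then have x: "x \<in> carrier R" and u: "u \<in> L" by auto
  note IH = Cons.IH[OF u]
  \<comment> \<open>Stated for the sum over all cuts of an arbitrary \<open>v\<close>, because the
    inner induction meets it for every position of the varied letter.\<close>
  have D: "(\<lambda>v. msum T (\<lambda>p. conc (br x (fst p)) (E (wprods br u (snd p)))) (splits v)) \<in> mlin_maps K R T"
    by (rule ml_splits[OF words_module, where h = "\<lambda>a b. conc (br x a) (E (wprods br u b))"])
      (intro ml_lin_comp[OF br_ml[OF x] bilin1[OF conc_bilin]] T.msum_closed,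
       intro ml_lin_comp[OF IH bilin2[OF conc_bilin]] br_closed x)
  show ?case
  proof (rule mlin_mapsI)
    fix v1 v2 assume v1: "v1 \<in> L" and v2: "v2 \<in> L"
    from v1 show "(\<lambda>y. E (wprods br (x # u) (v1 @ y # v2))) \<in> lin_maps K R T"
    proof (induction v1 rule: list.induct)
      case Nil
      have "(\<lambda>y. conc y (E (wprods br (x # u) v2)) \<oplus>\<^bsub>T\<^esub>
        msum T (\<lambda>p. conc (br x (fst p)) (E (wprods br u (snd p)))) (splits (y # v2))) \<in> lin_maps K R T"
        by (intro lin_add_map words_module conc_lin_comp[OF R lin_id] T.msum_closed ml_lin_hd[OF D v2])
      then show ?case
        by (rule lin_cong[OF R]) (simp only: append_Nil E_Cons[OF x u _ v2])
    next
      case (Cons z v1)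
      then have z: "z \<in> carrier R" and v1: "v1 \<in> L" and zv1: "z # v1 \<in> L" by auto
      have m: "v1 @ y # v2 \<in> L" if "y \<in> carrier R" for y using that v1 v2 by simp
      have "(\<lambda>y. conc z (E (wprods br (x # u) (v1 @ y # v2))) \<oplus>\<^bsub>T\<^esub>
        msum T (\<lambda>p. conc (br x (fst p)) (E (wprods br u (snd p)))) (splits ((z # v1) @ y # v2))) \<in> lin_maps K R T"
        by (intro lin_add_map words_module lin_comp[OF Cons.IH[OF v1] bilin2[OF conc_bilin z]]
            ml_lin[OF D zv1 v2])
      then show ?case
        by (rule lin_cong[OF R]) (simp only: append_Cons E_Cons[OF x u z m])
    qed
  qed simp
qed

text \<open>The second word stays arbitrary in the induction on the letters before the varied one,
  since the tail of the first word meets suffixes of \<open>v\<close>. Once the varied letter is in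
  front, it enters through the first argument of \<open>br\<close>, in which the brace is
  linear.\<close>

lemma E_ml_fst:
  assumes "v \<in> L"
  shows "(\<lambda>u. E (wprods br u v)) \<in> mlin_maps K R T"
proof (rule mlin_mapsI)
  fix u1 u2 assume u1: "u1 \<in> L" and u2: "u2 \<in> L"
  show "(\<lambda>y. E (wprods br (u1 @ y # u2) v)) \<in> lin_maps K R T"
    using u1 assms
  proof (induction u1 arbitrary: v rule: list.induct)
    case Nil
    from Nil.prems(2) show ?case
    proof (induction v rule: list.induct)
      case Nil
      show ?case
        by (rule lin_cong[OF R conc_lin_comp[OF R lin_id T.msum_closed]])
          (simp only: append_Nil E_Nil[OF _ u2])
    next
      case (Cons z v)
      then have z: "z \<in> carrier R" and v: "v \<in> L" and zv: "z # v \<in> L" by auto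
      have "(\<lambda>y. conc z (E (wprods br (y # u2) v)) \<oplus>\<^bsub>T\<^esub>
        msum T (\<lambda>p. conc (br y (fst p)) (E (wprods br u2 (snd p)))) (splits (z # v))) \<in> lin_maps K R T"
        using Cons.IH[OF v]
        by (intro lin_add_map words_module lin_comp[OF _ bilin2[OF conc_bilin z]] lin_msum_map
            conc_lin_comp[OF R br_lin_fst] splits_L[OF _ zv] T.msum_closed) simp
      then show ?case
        by (rule lin_cong[OF R]) (simp only: append_Nil E_Cons[OF _ u2 z v])
    qed
  next
    case (Cons x u1)
    then have x: "x \<in> carrier R" and u1: "u1 \<in> L" by auto
    have m: "u1 @ y # u2 \<in> L" if "y \<in> carrier R" for y using that u1 u2 by simp
    note IH = Cons.IH[OF u1]
    from Cons.prems(2) show ?case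
    proof (induction v rule: list.induct)
      case Nil
      show ?case
        by (rule lin_cong[OF R lin_comp[OF IH[of "[]"] bilin2[OF conc_bilin x]]])
          (simp_all only: append_Cons E_Nil[OF x m] lists.Nil)
    next
      case (Cons z v)
      then have z: "z \<in> carrier R" and v: "v \<in> L" and zv: "z # v \<in> L" by auto
      have "(\<lambda>y. conc z (E (wprods br (x # u1 @ y # u2) v)) \<oplus>\<^bsub>T\<^esub>
        msum T (\<lambda>p. conc (br x (fst p)) (E (wprods br (u1 @ y # u2) (snd p)))) (splits (z # v))) \<in> lin_maps K R T"
        using Cons.IH[OF v]
        by (intro lin_add_map words_module lin_comp[OF _ bilin2[OF conc_bilin z]] lin_msum_map
            lin_comp[OF IH bilin2[OF conc_bilin]] splits_L[OF _ zv] br_closed x) simp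
      then show ?case
        by (rule lin_cong[OF R]) (simp only: append_Cons E_Cons[OF x m z v])
    qed
  qed
qed simp

text \<open>Two nested lifts, one for each factor; the multilinearity in the letters of both words
  makes them well defined on the quotient.\<close>

definition bprod :: "('k, 'a) T_product"
  where "bprod s t = lift K T (\<lambda>u. lift K T (\<lambda>v. E (wprods br u v)) t) s"

lemma bprod_bilin: "bprod \<in> bilin_maps K T T T"
  and bprod_words: "u \<in> L \<Longrightarrow> v \<in> L \<Longrightarrow> bprod (wd u) (wd v) = E (wprods br u v)"
proof -
  let ?g = "\<lambda>u t. lift K T (\<lambda>v. E (wprods br u v)) t"
  note mT = words_module
  have lin: "?g u \<in> lin_maps K T T" if "u \<in> L" for u
    by (rule words_lift_lin[OF mT E_ml_snd[OF that]])
  have val: "?g u (wd v) = E (wprods br u v)" if "u \<in> L" "v \<in> L" for u v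
    by (rule words_lift_word[OF mT E_ml_snd[OF that(1)] that(2)])
  have ml: "(\<lambda>u. ?g u t) \<in> mlin_maps K R T" if t: "t \<in> carrier T" for t
  proof (rule mlin_mapsI)
    show "?g [] t \<in> carrier T" by (rule lin_closed[OF lin t]) simp
    fix u v assume uv: "u \<in> L" "v \<in> L"
    have m: "u @ y # v \<in> L" if "y \<in> carrier R" for y using that uv by simp
    show "(\<lambda>y. ?g (u @ y # v) t) \<in> lin_maps K R T"
    proof (rule words_lin_param[OF mT R lin[OF m] _ t])
      fix w assume w: "w \<in> L"
      show "(\<lambda>y. ?g (u @ y # v) (wd w)) \<in> lin_maps K R T"
        by (rule lin_cong[OF R ml_lin[OF E_ml_fst[OF w] uv]]) (simp only: val m w)
    qed
  qed
  have lin1: "(\<lambda>s. bprod s t) \<in> lin_maps K T T" if "t \<in> carrier T" for t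
    unfolding bprod_def by (rule words_lift_lin[OF mT ml[OF that]])
  have val1: "bprod (wd u) t = ?g u t" if "u \<in> L" "t \<in> carrier T" for u t
    unfolding bprod_def by (rule words_lift_word[OF mT ml[OF that(2)] that(1)])
  show "bprod \<in> bilin_maps K T T T"
  proof (rule bilin_mapsI)
    fix s assume s: "s \<in> carrier T"
    show "(\<lambda>t. bprod s t) \<in> lin_maps K T T"
    proof (rule words_lin_param[OF mT mT lin1 _ s])
      fix u assume u: "u \<in> L"
      show "(\<lambda>t. bprod (wd u) t) \<in> lin_maps K T T"
        by (rule lin_cong[OF mT lin[OF u]]) (simp only: val1 u)
    qed
  qed (rule lin1)
  show "bprod (wd u) (wd v) = E (wprods br u v)" if "u \<in> L" "v \<in> L"
    by (simp only: val1 val that word_closed)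
qed

lemma bprod_closed: "s \<in> carrier T \<Longrightarrow> t \<in> carrier T \<Longrightarrow> bprod s t \<in> carrier T"
  by (rule bilin_closed[OF bprod_bilin])

lemma bprod_one: "t \<in> carrier T \<Longrightarrow> bprod (wd []) t = t" "t \<in> carrier T \<Longrightarrow> bprod t (wd []) = t"
proof -
  assume t: "t \<in> carrier T"
  have e: "[] \<in> L" by simp
  show "bprod (wd []) t = t"
    by (rule words_eqI[OF words_module bilin2[OF bprod_bilin word_closed[OF e]] lin_id _ t])
      (simp add: bprod_words word_closed)
  show "bprod t (wd []) = t"
    by (rule words_eqI[OF words_module bilin1[OF bprod_bilin word_closed[OF e]] lin_id _ t])
      (simp add: bprod_words word_closed wprods_Nil2_br)
qed

section \<open>Associativity\<close>

lemma wprods_left_L: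
  assumes "u \<in> L" "v \<in> L" "w \<in> L" "a \<in># wprods_left br u v w"
  shows "a \<in> L"
proof -
  obtain b where b: "b \<in># wprods br u v" "a \<in># wprods br b w" using assms(4) by (auto simp: wprods_left_def)
  show ?thesis by (rule wprods_L[OF wprods_L[OF assms(1,2) b(1)] assms(3) b(2)])
qed

lemma wprods_right_L:
  assumes "u \<in> L" "v \<in> L" "w \<in> L" "a \<in># wprods_right br u v w"
  shows "a \<in> L"
proof -
  obtain b where b: "b \<in># wprods br v w" "a \<in># wprods br u b" using assms(4) by (auto simp: wprods_right_def)
  show ?thesis by (rule wprods_L[OF assms(1) wprods_L[OF assms(2,3) b(1)] b(2)])
qed

text \<open>The two multisets need not be equal, only their sums in T^c(R). In both recursions the
  total length drops; the first two sums match by induction alone, the last one by induction and the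
  brace identity.\<close>

lemma E_wprods_left_wprods_right: "u \<in> L \<Longrightarrow> v \<in> L \<Longrightarrow> w \<in> L \<Longrightarrow> E (wprods_left br u v w) = E (wprods_right br u v w)"
proof (induction "length u + length v + length w" arbitrary: u v w rule: less_induct)
  case less
  note IH = less.hyps
  consider "u = []" | "v = []" | "w = []" | x u' z v' c w' where "u = x # u'" "v = z # v'" "w = c # w'"
    by (metis neq_Nil_conv)
  then show ?case
  proof cases
    case 1
    then show ?thesis by (simp add: wprods_left_def wprods_right_def)
  next
    case 2
    then show ?thesis using less.prems by (simp add: wprods_left_def wprods_right_def wprods_Nil2_br)
  next
    case 3
    have "wprods_left br u v [] = (\<Sum>a \<in># wprods br u v. {#a#})"
      unfolding wprods_left_def
      by (intro arg_cong[of _ _ sum_mset] image_mset_cong wprods_Nil2_br wprods_L[OF less.prems(1,2)])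
    then show ?thesis using less.prems 3 by (simp add: wprods_right_def wprods_Nil2_br)
  next
    case 4
    then have x: "x \<in> carrier R" and u: "u' \<in> L" and z: "z \<in> carrier R" and v: "v' \<in> L"
      and c: "c \<in> carrier R" and w: "w' \<in> L" and xu: "x # u' \<in> L" and zv: "z # v' \<in> L" and cw: "c # w' \<in> L"
      using less.prems by auto
    note jL = splits_L[OF _ zv] and kL = splits_L[OF _ cw]
    have len: "length (snd p) \<le> length a" if "p \<in># splits a" for p and a :: "'a list"
      by (rule splits_length_snd[OF that])
    have cl: "conc y (E (wprods_left br a b d)) = E (image_mset ((#) y) (wprods_left br a b d))"
      if "y \<in> carrier R" "a \<in> L" "b \<in> L" "d \<in> L" for y a b d
      by (rule conc_E[OF that(1) wprods_left_L[OF that(2-4)]])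
    have cr: "conc y (E (wprods_right br a b d)) = E (image_mset ((#) y) (wprods_right br a b d))"
      if "y \<in> carrier R" "a \<in> L" "b \<in> L" "d \<in> L" for y a b d
      by (rule conc_E[OF that(1) wprods_right_L[OF that(2-4)]])
    have 1: "E (image_mset ((#) c) (wprods_left br (x # u') (z # v') w')) = E (image_mset ((#) c) (wprods_right br (x # u') (z # v') w'))"
    proof -
      have "E (wprods_left br (x # u') (z # v') w') = E (wprods_right br (x # u') (z # v') w')"
        by (rule IH) (use 4 xu zv w in auto)
      then show ?thesis
        using cl[OF c xu zv w] cr[OF c xu zv w] by simp
    qed
    have 2: "msum T (\<lambda>k. E (image_mset ((#) (br z (fst k))) (wprods_left br (x # u') v' (snd k)))) (splits (c # w')) =
       msum T (\<lambda>k. E (image_mset ((#) (br z (fst k))) (wprods_right br (x # u') v' (snd k)))) (splits (c # w'))"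
    proof (rule T.msum_cong[OF refl])
      fix k assume k: "k \<in># splits (c # w')"
      note bz = br_closed[OF z kL(1)[OF k]]
      have "E (wprods_left br (x # u') v' (snd k)) = E (wprods_right br (x # u') v' (snd k))"
        by (rule IH) (use 4 xu v kL(2)[OF k] len[OF k] in auto)
      then show "E (image_mset ((#) (br z (fst k))) (wprods_left br (x # u') v' (snd k))) =
         E (image_mset ((#) (br z (fst k))) (wprods_right br (x # u') v' (snd k)))"
        using cl[OF bz xu v kL(2)[OF k]] cr[OF bz xu v kL(2)[OF k]] by simp
    qed
    \<comment> \<open>By \<open>br_br\<close> the letter {{x; j}; k} is the sum of the letters {x;
      b} over the words b of the product of the two prefixes; linearity of \<open>conc\<close> in
      its letter moves this sum outside.\<close>
    have 3: "msum T (\<lambda>j. msum T (\<lambda>k.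
         E (image_mset ((#) (br (br x (fst j)) (fst k))) (wprods_left br u' (snd j) (snd k)))) (splits (c # w'))) (splits (z # v')) =
      msum T (\<lambda>j. msum T (\<lambda>k. msum T (\<lambda>b.
         E (image_mset ((#) (br x b)) (wprods_right br u' (snd j) (snd k)))) (wprods br (fst j) (fst k))) (splits (c # w'))) (splits (z # v'))"
    proof (rule T.msum_cong[OF refl], rule T.msum_cong[OF refl])
      fix j k assume j: "j \<in># splits (z # v')" and k: "k \<in># splits (c # w')"
      note bb = br_closed[OF br_closed[OF x jL(1)[OF j]] kL(1)[OF k]]
      have eq: "E (wprods_left br u' (snd j) (snd k)) = E (wprods_right br u' (snd j) (snd k))"
        by (rule IH) (use 4 u jL(2)[OF j] kL(2)[OF k] len[OF k] len[OF j] in auto)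
      have "E (image_mset ((#) (br (br x (fst j)) (fst k))) (wprods_left br u' (snd j) (snd k))) =
        conc (br (br x (fst j)) (fst k)) (E (wprods_right br u' (snd j) (snd k)))"
        using cl[OF bb u jL(2)[OF j] kL(2)[OF k]] eq by simp
      also have "\<dots> = msum T (\<lambda>b. conc (br x b) (E (wprods_right br u' (snd j) (snd k)))) (wprods br (fst j) (fst k))"
        unfolding br_br[OF x jL(1)[OF j] kL(1)[OF k]]
        by (rule bilin_msum1[OF R words_module conc_bilin T.msum_closed br_closed[OF x wprods_L[OF jL(1)[OF j] kL(1)[OF k]]]])
      also have "\<dots> = msum T (\<lambda>b. E (image_mset ((#) (br x b)) (wprods_right br u' (snd j) (snd k)))) (wprods br (fst j) (fst k))"
        by (rule T.msum_cong[OF refl], rule cr[OF br_closed[OF x wprods_L[OF jL(1)[OF j] kL(1)[OF k]]] u jL(2)[OF j] kL(2)[OF k]])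
      finally show "E (image_mset ((#) (br (br x (fst j)) (fst k))) (wprods_left br u' (snd j) (snd k))) = \<dots>" .
    qed
    show ?thesis
      unfolding 4 wprods_left_rec wprods_right_rec T.msum_union T.msum_sum_mset 1 2 3 ..
  qed
qed

lemma bprod_assoc:
  assumes s: "s \<in> carrier T" and t: "t \<in> carrier T" and r: "r \<in> carrier T"
  shows "bprod (bprod s t) r = bprod s (bprod t r)"
proof -
  note mT = words_module and b1 = bilin1[OF bprod_bilin] and b2 = bilin2[OF bprod_bilin]
  have w: "bprod (bprod (wd u) (wd v)) (wd w) = bprod (wd u) (bprod (wd v) (wd w))"
    if u: "u \<in> L" and v: "v \<in> L" and w: "w \<in> L" for u v w
  proof -
    have "bprod (bprod (wd u) (wd v)) (wd w) = msum T (\<lambda>a. bprod (wd a) (wd w)) (wprods br u v)"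
      unfolding bprod_words[OF u v]
      by (rule bilin_msum1[OF mT mT bprod_bilin word_closed[OF w] word_closed[OF wprods_L[OF u v]]])
    also have "\<dots> = msum T (\<lambda>a. E (wprods br a w)) (wprods br u v)"
      by (intro T.msum_cong refl bprod_words wprods_L[OF u v] w)
    also have "\<dots> = E (wprods_left br u v w)"
      unfolding wprods_left_def T.msum_sum_mset ..
    also have "\<dots> = E (wprods_right br u v w)" by (rule E_wprods_left_wprods_right[OF u v w])
    also have "\<dots> = msum T (\<lambda>b. E (wprods br u b)) (wprods br v w)"
      unfolding wprods_right_def T.msum_sum_mset ..
    also have "\<dots> = msum T (\<lambda>b. bprod (wd u) (wd b)) (wprods br v w)"
      by (intro T.msum_cong refl bprod_words[symmetric] wprods_L[OF v w] u)
    also have "\<dots> = bprod (wd u) (bprod (wd v) (wd w))"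
      unfolding bprod_words[OF v w]
      by (rule bilin_msum2[OF mT mT bprod_bilin word_closed[OF u] word_closed[OF wprods_L[OF v w]], symmetric])
    finally show ?thesis .
  qed
  \<comment> \<open>The identity for words is extended to all elements in one argument at a time,
    both sides being linear in each.\<close>
  have 1: "bprod (bprod s (wd v)) (wd w) = bprod s (bprod (wd v) (wd w))" if v: "v \<in> L" and w': "w \<in> L" for v w
    by (rule words_eqI[OF mT lin_comp[OF b1[OF word_closed[OF v]] b1[OF word_closed[OF w']]]
          b1[OF bprod_closed[OF word_closed[OF v] word_closed[OF w']]] _ s])
      (rule w[OF _ v w'])
  have 2: "bprod (bprod s t) (wd w) = bprod s (bprod t (wd w))" if w': "w \<in> L" for w
    by (rule words_eqI[OF mT lin_comp[OF b2[OF s] b1[OF word_closed[OF w']]]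
          lin_comp[OF b1[OF word_closed[OF w']] b2[OF s]] _ t])
      (rule 1[OF _ w'])
  show ?thesis
    by (rule words_eqI[OF mT b2[OF bprod_closed[OF s t]] lin_comp[OF b2[OF t] b2[OF s]] _ r]) (rule 2)
qed

section \<open>Compatibility with the counit and the coproduct\<close>

lemma eps_bprod:
  assumes s: "s \<in> carrier T" and t: "t \<in> carrier T"
  shows "\<epsilon> (bprod s t) = \<epsilon> s \<otimes>\<^bsub>K\<^esub> \<epsilon> t"
proof -
  have mS: "module K (scalars K)" by (rule module_scalars[OF cringK])
  interpret S: module K "scalars K" by (rule mS)
  note mT = words_module
  have w: "\<epsilon> (bprod (wd u) (wd v)) = \<epsilon> (wd u) \<otimes>\<^bsub>K\<^esub> \<epsilon> (wd v)" if u: "u \<in> L" and v: "v \<in> L" for u v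
  proof -
    have "\<epsilon> (bprod (wd u) (wd v)) = msum (scalars K) (\<lambda>w. \<epsilon> (wd w)) (wprods br u v)"
      unfolding bprod_words[OF u v]
      by (rule lin_msum[OF mT mS eps_lin word_closed[OF wprods_L[OF u v]]])
    also have "\<dots> = \<epsilon> (wd u) \<otimes>\<^bsub>K\<^esub> \<epsilon> (wd v)"
    proof (cases "u = [] \<and> v = []")
      case True
      have "\<epsilon> (wd []) \<in> carrier (scalars K)" by (rule lin_closed[OF eps_lin empty_closed])
      then have "msum (scalars K) (\<lambda>w. \<epsilon> (wd w)) {#[]#} = \<epsilon> (wd [])" by simp
      then show ?thesis using True by (simp add: eps_word)
    next
      case False
      have "\<epsilon> (wd w) = \<zero>\<^bsub>scalars K\<^esub>" if "w \<in># wprods br u v" for w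
        using wprods_L[OF u v that] wprods_empty_notin[of u v br] False that
        by (auto simp: eps_word scalars_def)
      then have "msum (scalars K) (\<lambda>w. \<epsilon> (wd w)) (wprods br u v) = \<zero>\<^bsub>scalars K\<^esub>"
        by (rule S.msum_zero)
      then show ?thesis using False u v by (auto simp: eps_word scalars_def)
    qed
    finally show ?thesis .
  qed
  have l: "(\<lambda>s. \<epsilon> s \<otimes>\<^bsub>K\<^esub> a) \<in> lin_maps K T (scalars K)" "(\<lambda>s. a \<otimes>\<^bsub>K\<^esub> \<epsilon> s) \<in> lin_maps K T (scalars K)"
    if "a \<in> carrier K" for a
    using that by (auto intro!: lin_mapsI
      simp: scalars_def eps_closed lin_add[OF eps_lin] lin_smult[OF eps_lin] R.R.l_distr R.R.r_distr R.R.m_ac)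
  have 1: "\<epsilon> (bprod s (wd v)) = \<epsilon> s \<otimes>\<^bsub>K\<^esub> \<epsilon> (wd v)" if v: "v \<in> L" for v
    by (rule words_eqI[OF mS lin_comp[OF bilin1[OF bprod_bilin word_closed[OF v]] eps_lin]
          l(1)[OF eps_closed[OF word_closed[OF v]]] _ s]) (rule w[OF _ v])
  show ?thesis
    by (rule words_eqI[OF mS lin_comp[OF bilin2[OF bprod_bilin s] eps_lin] l(2)[OF eps_closed[OF s]] _ t]) (rule 1)
qed

lemma msum_pairs:
  assumes "\<And>a. a \<in># M \<Longrightarrow> a \<in> L" "\<And>b. b \<in># N \<Longrightarrow> b \<in> L"
  shows "msum TT (\<lambda>r. pt (wd (fst r)) (wd (snd r))) (pairs M N) = pt (E M) (E N)"
proof -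
  note mT = words_module and mTT = TT.module_axioms
  have "pt (E M) (E N) = msum TT (\<lambda>a. pt (wd a) (E N)) M"
    by (rule bilin_msum1[OF mT mTT TP.pure_bilin T.msum_closed word_closed[OF assms(1)]])
  also have "\<dots> = msum TT (\<lambda>a. msum TT (\<lambda>b. pt (wd a) (wd b)) N) M"
    by (intro TT.msum_cong refl bilin_msum2[OF mT mTT TP.pure_bilin] word_closed assms)
  finally show ?thesis
    by (simp add: pairs_def TT.msum_sum_mset TT.msum_image_mset)
qed

text \<open>On words this is the image of \<open>splits_wprods\<close> in the tensor square, where a
  sum over \<open>pairs\<close> becomes the pure tensor of two products; bilinearity does the
  rest.\<close>

lemma Delta_bprod:
  assumes s: "s \<in> carrier T" and t: "t \<in> carrier T"
  shows "\<Delta> (bprod s t) = \<Delta> s \<otimes>\<^bsub>tensor_alg K (H bprod) (H bprod)\<^esub> \<Delta> t"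
proof -
  note mT = words_module and mTT = TT.module_axioms and b = tensor_alg_T_hopf(1)[OF bprod_bilin]
  have w: "\<Delta> (bprod (wd u) (wd v)) = \<Delta> (wd u) \<otimes>\<^bsub>tensor_alg K (H bprod) (H bprod)\<^esub> \<Delta> (wd v)"
    if u: "u \<in> L" and v: "v \<in> L" for u v
  proof -
    have "\<Delta> (bprod (wd u) (wd v)) = msum TT (\<lambda>w. \<Delta> (wd w)) (wprods br u v)"
      unfolding bprod_words[OF u v]
      by (rule lin_msum[OF mT mTT Delta_lin word_closed[OF wprods_L[OF u v]]])
    also have "\<dots> = msum TT (\<lambda>w. msum TT (\<lambda>p. pt (wd (fst p)) (wd (snd p))) (splits w)) (wprods br u v)"
      by (intro TT.msum_cong refl Delta_word wprods_L[OF u v])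
    also have "\<dots> = msum TT (\<lambda>p. msum TT (\<lambda>q. msum TT (\<lambda>r. pt (wd (fst r)) (wd (snd r)))
        (pairs (wprods br (fst p) (fst q)) (wprods br (snd p) (snd q)))) (splits v)) (splits u)"
      unfolding TT.msum_sum_mset[symmetric] splits_wprods ..
    also have "\<dots> = msum TT (\<lambda>p. msum TT (\<lambda>q. pt (bprod (wd (fst p)) (wd (fst q))) (bprod (wd (snd p)) (wd (snd q)))) (splits v)) (splits u)"
    proof (intro TT.msum_cong refl)
      fix p q assume p: "p \<in># splits u" and q: "q \<in># splits v"
      note pL = splits_L[OF p u] and qL = splits_L[OF q v]
      show "msum TT (\<lambda>r. pt (wd (fst r)) (wd (snd r)))
        (pairs (wprods br (fst p) (fst q)) (wprods br (snd p) (snd q))) =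
        pt (bprod (wd (fst p)) (wd (fst q))) (bprod (wd (snd p)) (wd (snd q)))"
        unfolding bprod_words[OF pL(1) qL(1)] bprod_words[OF pL(2) qL(2)]
        by (rule msum_pairs[OF wprods_L[OF pL(1) qL(1)] wprods_L[OF pL(2) qL(2)]])
    qed
    finally show ?thesis by (simp only: Delta_mult_Delta[OF bprod_bilin u v])
  qed
  have 1: "\<Delta> (bprod s (wd v)) = \<Delta> s \<otimes>\<^bsub>tensor_alg K (H bprod) (H bprod)\<^esub> \<Delta> (wd v)" if v: "v \<in> L" for v
    by (rule words_eqI[OF mTT lin_comp[OF bilin1[OF bprod_bilin word_closed[OF v]] Delta_lin]
          lin_comp[OF Delta_lin bilin1[OF b lin_closed[OF Delta_lin word_closed[OF v]]]] _ s])
      (rule w[OF _ v])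
  show ?thesis
    by (rule words_eqI[OF mTT lin_comp[OF bilin2[OF bprod_bilin s] Delta_lin]
          lin_comp[OF Delta_lin bilin2[OF b lin_closed[OF Delta_lin s]]] _ t])
      (rule 1)
qed

lemma ring_T_hopf: "ring (H bprod)"
proof (rule ringI)
  show "abelian_group (H bprod)" by (rule module.axioms(2)[OF module_T_hopf])
  show "monoid (H bprod)"
    by (rule monoidI) (simp_all add: bprod_closed bprod_assoc bprod_one empty_closed)
qed (simp_all add: lin_add[OF bilin1[OF bprod_bilin]] lin_add[OF bilin2[OF bprod_bilin]])

lemma bialgebra_T_hopf: "bialgebra K (H bprod)"
  unfolding bialgebra_def
proof (intro conjI)
  show "unital_assoc_algebra K (H bprod)"
    unfolding unital_assoc_algebra_def
    by (simp add: module_T_hopf ring_T_hopf lin_smult[OF bilin1[OF bprod_bilin]] lin_smult[OF bilin2[OF bprod_bilin]])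
  show "coalgebra K (H bprod)" by (rule coalgebra_T_hopf)
  have "\<Delta> (wd []) = pt (wd []) (wd [])"
    by (simp add: Delta_word pt_word_closed)
  then show "comult (H bprod) \<in> ring_hom (H bprod) (tensor_alg K (H bprod) (H bprod))"
    by (intro ring_hom_memI)
      (simp_all add: tensor_alg_simps Delta_bprod lin_add[OF Delta_lin] lin_closed[OF Delta_lin])
  show "counit (H bprod) \<in> ring_hom (H bprod) K"
    using lin_add[OF eps_lin]
    by (intro ring_hom_memI) (simp_all add: eps_closed eps_bprod scalars_def eps_word)
qed

section \<open>Convolution and the antipode\<close>

definition conv where "conv f g w = msum T (\<lambda>p. bprod (f (fst p)) (g (snd p))) (splits w)"

text \<open>The neutral element of convolution: the counit followed by the unit, on words.
  Convolution is formed for functions of words and not for linear maps, so that an inverse can be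
  defined by recursion on the length.\<close>

definition conv_one :: "'a list \<Rightarrow> ('a list \<Rightarrow> 'k) set"
  where "conv_one w = (if w = [] then wd [] else \<zero>\<^bsub>T\<^esub>)"

text \<open>
  The convolution inverse by recursion on the length of a word; the first argument bounds the
  length and serves termination only.
\<close>

primrec conv_inv_upto where
  "conv_inv_upto f 0 = conv_one"
| "conv_inv_upto f (Suc n) = (\<lambda>w. case w of [] \<Rightarrow> wd []
    | x # w \<Rightarrow> \<ominus>\<^bsub>T\<^esub> msum T (\<lambda>p. bprod (f (x # fst p)) (conv_inv_upto f n (snd p))) (splits w))"

definition conv_inv where "conv_inv f w = conv_inv_upto f (length w) w"

lemma conv_one_ml: "conv_one \<in> mlin_maps K R T"
  using lin_zero_map[OF words_module, of R] by (intro mlin_mapsI) (simp_all add: conv_one_def empty_closed)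

lemma bprod_ml_splits:
  assumes f: "f \<in> mlin_maps K R T" and g: "g \<in> mlin_maps K R T"
  shows "(\<lambda>w. msum T (\<lambda>p. bprod (f (fst p)) (g (snd p))) (splits w)) \<in> mlin_maps K R T"
proof (rule ml_splits[OF words_module, where h = "\<lambda>a b. bprod (f a) (g b)"])
  show "(\<lambda>a. bprod (f a) (g b)) \<in> mlin_maps K R T" if "b \<in> L" for b
    by (rule ml_lin_comp[OF f bilin1[OF bprod_bilin ml_closed[OF g that]]])
  show "(\<lambda>b. bprod (f a) (g b)) \<in> mlin_maps K R T" if "a \<in> L" for a
    by (rule ml_lin_comp[OF g bilin2[OF bprod_bilin ml_closed[OF f that]]])
qed

lemma conv_inv_upto_ml:
  assumes f: "f \<in> mlin_maps K R T"
  shows "conv_inv_upto f n \<in> mlin_maps K R T"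
proof (induction n)
  case 0
  then show ?case using conv_one_ml by simp
next
  case (Suc n)
  let ?S = "\<lambda>x w. msum T (\<lambda>p. bprod (f (x # fst p)) (conv_inv_upto f n (snd p))) (splits w)"
  show ?case
  proof (rule mlin_mapsI)
    fix u v assume u: "u \<in> L" and v: "v \<in> L"
    show "(\<lambda>y. conv_inv_upto f (Suc n) (u @ y # v)) \<in> lin_maps K R T"
    proof (cases u)
      case Nil
      have "(\<lambda>y. \<ominus>\<^bsub>T\<^esub> ?S y v) \<in> lin_maps K R T"
        by (intro lin_uminus_map words_module lin_msum_map
            lin_comp[OF ml_lin_hd[OF f] bilin1[OF bprod_bilin]] ml_closed[OF Suc] splits_L[OF _ v])
      then show ?thesis using Nil by simp
    next
      case (Cons x u')
      then have x: "x \<in> carrier R" and u': "u' \<in> L" using u by auto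
      have "(\<lambda>y. \<ominus>\<^bsub>T\<^esub> ?S x (u' @ y # v)) \<in> lin_maps K R T"
        by (rule lin_uminus_map[OF words_module ml_lin[OF bprod_ml_splits[OF ml_Cons[OF f x] Suc] u' v]])
      then show ?thesis using Cons by simp
    qed
  qed (simp add: empty_closed)
qed

text \<open>Every bound that reaches the length of the word gives the same value, so the bound
  carried by the recursion may be replaced by the length of the suffix at hand.\<close>

lemma conv_inv_upto_eq:
  "length w \<le> n \<Longrightarrow> length w \<le> m \<Longrightarrow> conv_inv_upto f n w = conv_inv_upto f m w"
proof (induction n arbitrary: m w)
  case 0
  then show ?case by (cases m) (simp_all add: conv_one_def)
next
  case (Suc n)
  show ?case
  proof (cases w)
    case Nil
    then show ?thesis by (cases m) (simp_all add: conv_one_def)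
  next
    case (Cons x v)
    then obtain m' where m: "m = Suc m'" using Suc.prems(2) by (cases m) auto
    have "msum T (\<lambda>p. bprod (f (x # fst p)) (conv_inv_upto f n (snd p))) (splits v) =
      msum T (\<lambda>p. bprod (f (x # fst p)) (conv_inv_upto f m' (snd p))) (splits v)"
    proof (rule T.msum_cong[OF refl])
      fix p assume p: "p \<in># splits v"
      have "conv_inv_upto f n (snd p) = conv_inv_upto f m' (snd p)"
        by (rule Suc.IH) (use splits_length_snd[OF p] Suc.prems Cons m in auto)
      then show "bprod (f (x # fst p)) (conv_inv_upto f n (snd p)) = bprod (f (x # fst p)) (conv_inv_upto f m' (snd p))"
        by simp
    qed
    then show ?thesis using Cons m by simp
  qed
qed

lemma conv_inv_ml:
  assumes f: "f \<in> mlin_maps K R T"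
  shows "conv_inv f \<in> mlin_maps K R T"
proof (rule mlin_mapsI)
  fix u v assume "u \<in> L" "v \<in> L"
  \<comment> \<open>The length of \<open>u @ y # v\<close> does not depend on \<open>y\<close>, so a
    single bound serves for all \<open>y\<close> and the multilinearity of
    \<open>conv_inv_upto\<close> applies.\<close>
  then show "(\<lambda>y. conv_inv f (u @ y # v)) \<in> lin_maps K R T"
    unfolding conv_inv_def using ml_lin[OF conv_inv_upto_ml[OF f], of u v "length u + Suc (length v)"] by simp
qed (simp add: conv_inv_def conv_one_def empty_closed)

lemma conv_inv_Nil: "conv_inv f [] = wd []"
  by (simp add: conv_inv_def conv_one_def)

text \<open>Since \<open>f []\<close> is the unit, the cut of \<open>x # v\<close> with empty left
  part contributes the value of the inverse at \<open>x # v\<close>, and this value was defined as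
  minus the sum over the other cuts.\<close>

lemma conv_conv_inv:
  assumes f: "f \<in> mlin_maps K R T" and f1: "f [] = wd []" and w: "w \<in> L"
  shows "conv f (conv_inv f) w = conv_one w"
proof (cases w)
  case Nil
  then show ?thesis
    by (simp add: conv_def conv_one_def f1 conv_inv_Nil bprod_one bprod_closed empty_closed)
next
  case (Cons x v)
  then have x: "x \<in> carrier R" and v: "v \<in> L" using w by auto
  let ?s = "msum T (\<lambda>p. bprod (f (x # fst p)) (conv_inv f (snd p))) (splits v)"
  have "msum T (\<lambda>p. bprod (f (x # fst p)) (conv_inv_upto f (length v) (snd p))) (splits v) = ?s"
  proof (rule T.msum_cong[OF refl])
    fix p assume p: "p \<in># splits v"
    show "bprod (f (x # fst p)) (conv_inv_upto f (length v) (snd p)) = bprod (f (x # fst p)) (conv_inv f (snd p))"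
      unfolding conv_inv_def using conv_inv_upto_eq[OF splits_length_snd[OF p] order_refl] by simp
  qed
  then have "conv_inv f (x # v) = \<ominus>\<^bsub>T\<^esub> ?s"
    unfolding conv_inv_def[of f "x # v"] by simp
  then show ?thesis
    using Cons by (simp add: conv_def conv_one_def T.msum_image_mset f1 bprod_one T.l_neg)
qed

lemma conv_assoc:
  assumes f: "f \<in> mlin_maps K R T" and g: "g \<in> mlin_maps K R T" and h: "h \<in> mlin_maps K R T" and w: "w \<in> L"
  shows "conv (conv f g) h w = conv f (conv g h) w"
proof -
  note mT = words_module
  note fc = ml_closed[OF f] and gc = ml_closed[OF g] and hc = ml_closed[OF h]
  let ?F = "\<lambda>a b c. bprod (f a) (bprod (g b) (h c))"
  have "conv (conv f g) h w = msum T (\<lambda>p. msum T (\<lambda>q. ?F (fst q) (snd q) (snd p)) (splits (fst p))) (splits w)"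
    unfolding conv_def
  proof (rule T.msum_cong[OF refl])
    fix p assume p: "p \<in># splits w"
    note pL = splits_L[OF p w]
    have "bprod (msum T (\<lambda>q. bprod (f (fst q)) (g (snd q))) (splits (fst p))) (h (snd p)) =
      msum T (\<lambda>q. bprod (bprod (f (fst q)) (g (snd q))) (h (snd p))) (splits (fst p))"
      by (rule bilin_msum1[OF mT mT bprod_bilin hc[OF pL(2)] bprod_closed[OF fc[OF splits_L(1)[OF _ pL(1)]] gc[OF splits_L(2)[OF _ pL(1)]]]])
    also have "\<dots> = msum T (\<lambda>q. ?F (fst q) (snd q) (snd p)) (splits (fst p))"
      by (rule T.msum_cong[OF refl])
        (rule bprod_assoc[OF fc[OF splits_L(1)[OF _ pL(1)]] gc[OF splits_L(2)[OF _ pL(1)]] hc[OF pL(2)]])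
    finally show "bprod (msum T (\<lambda>q. bprod (f (fst q)) (g (snd q))) (splits (fst p))) (h (snd p)) = \<dots>" .
  qed
  also have "\<dots> = msum T (\<lambda>p. msum T (\<lambda>q. ?F (fst p) (fst q) (snd q)) (splits (snd p))) (splits w)"
    using arg_cong[OF splits_coassoc[of w], of "msum T (\<lambda>t. ?F (fst t) (fst (snd t)) (snd (snd t)))"]
    by (simp add: T.msum_sum_mset T.msum_image_mset)
  also have "\<dots> = conv f (conv g h) w"
    unfolding conv_def
  proof (rule T.msum_cong[OF refl])
    fix p assume p: "p \<in># splits w"
    note pL = splits_L[OF p w]
    show "msum T (\<lambda>q. ?F (fst p) (fst q) (snd q)) (splits (snd p)) =
      bprod (f (fst p)) (msum T (\<lambda>q. bprod (g (fst q)) (h (snd q))) (splits (snd p)))"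
      by (rule bilin_msum2[OF mT mT bprod_bilin fc[OF pL(1)] bprod_closed[OF gc[OF splits_L(1)[OF _ pL(2)]] hc[OF splits_L(2)[OF _ pL(2)]]], symmetric])
  qed
  finally show ?thesis .
qed

lemma conv_one_left:
  assumes f: "f \<in> mlin_maps K R T" and w: "w \<in> L"
  shows "conv conv_one f w = f w"
proof -
  have "conv conv_one f w = bprod (conv_one []) (f w)"
    unfolding conv_def
  proof (rule T.msum_splits_fst[where h = "\<lambda>a b. bprod (conv_one a) (f b)"])
    fix a b assume "a \<noteq> []" "a @ b = w"
    moreover from this have "b \<in> L" using w by auto
    ultimately show "bprod (conv_one a) (f b) = \<zero>\<^bsub>T\<^esub>"
      using lin_zero[OF words_module words_module bilin1[OF bprod_bilin ml_closed[OF f]]]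
      by (simp add: conv_one_def)
  qed (simp add: conv_one_def bprod_closed empty_closed ml_closed[OF f w])
  then show ?thesis by (simp add: conv_one_def bprod_one ml_closed[OF f w])
qed

lemma conv_one_right:
  assumes f: "f \<in> mlin_maps K R T" and w: "w \<in> L"
  shows "conv f conv_one w = f w"
proof -
  have "conv f conv_one w = bprod (f w) (conv_one [])"
    unfolding conv_def
  proof (rule T.msum_splits_snd[where h = "\<lambda>a b. bprod (f a) (conv_one b)"])
    fix a b assume "b \<noteq> []" "a @ b = w"
    moreover from this have "a \<in> L" using w by auto
    ultimately show "bprod (f a) (conv_one b) = \<zero>\<^bsub>T\<^esub>"
      using lin_zero[OF words_module words_module bilin2[OF bprod_bilin ml_closed[OF f]]]
      by (simp add: conv_one_def)
  qed (simp add: conv_one_def bprod_closed empty_closed ml_closed[OF f w])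
  then show ?thesis by (simp add: conv_one_def bprod_one ml_closed[OF f w])
qed

lemma conv_cong:
  assumes "w \<in> L" "\<And>u. u \<in> L \<Longrightarrow> f u = f' u" "\<And>u. u \<in> L \<Longrightarrow> g u = g' u"
  shows "conv f g w = conv f' g' w"
  unfolding conv_def
  by (rule T.msum_cong[OF refl]) (simp only: assms(2,3) splits_L[OF _ assms(1)])

text \<open>The right inverse has a right inverse itself, so it is two-sided.\<close>

lemma conv_inv_conv:
  assumes f: "f \<in> mlin_maps K R T" and f1: "f [] = wd []" and w: "w \<in> L"
  shows "conv (conv_inv f) f w = conv_one w"
proof -
  let ?g = "conv_inv f" let ?h = "conv_inv ?g"
  note g = conv_inv_ml[OF f]
  note h = conv_inv_ml[OF g]
  have gh: "conv ?g ?h u = conv_one u" if "u \<in> L" for u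
    by (rule conv_conv_inv[OF g conv_inv_Nil that])
  have "f u = ?h u" if u: "u \<in> L" for u
  proof -
    have "f u = conv f (conv ?g ?h) u"
      using conv_cong[OF u, of f f "conv ?g ?h" conv_one] gh conv_one_right[OF f u] by simp
    also have "\<dots> = conv (conv f ?g) ?h u" by (rule conv_assoc[OF f g h u, symmetric])
    also have "\<dots> = conv conv_one ?h u"
      by (rule conv_cong[OF u conv_conv_inv[OF f f1] refl])
    also have "\<dots> = ?h u" by (rule conv_one_left[OF h u])
    finally show ?thesis .
  qed
  then have "conv ?g f w = conv ?g ?h w" by (rule conv_cong[OF w refl])
  then show ?thesis using gh[OF w] by simp
qed

text \<open>Brings a convolution identity for functions of words into the form of the antipode
  axiom.\<close>

lemma lift_Delta_conv:
  assumes f: "f \<in> lin_maps K T T" and g: "g \<in> lin_maps K T T" 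
    and fg: "\<And>w. w \<in> L \<Longrightarrow> conv (\<lambda>w. f (wd w)) (\<lambda>w. g (wd w)) w = conv_one w"
    and t: "t \<in> carrier T"
  shows "lift K T (\<lambda>(a, b). bprod (f a) (g b)) (\<Delta> t) = \<epsilon> t \<odot>\<^bsub>T\<^esub> wd []"
proof -
  have b: "(\<lambda>a b. bprod (f a) (g b)) \<in> bilin_maps K T T T"
    by (intro bilin_mapsI lin_comp[OF f bilin1[OF bprod_bilin]] lin_comp[OF g bilin2[OF bprod_bilin]]
        lin_closed[OF f] lin_closed[OF g])
  note l = TP.tensor_lift_lin[OF words_module b]
  show ?thesis
  proof (rule words_eqI[OF words_module lin_comp[OF Delta_lin l] eps_smult_lin[OF empty_closed] _ t])
    fix w assume w: "w \<in> L"
    have "lift K T (\<lambda>(a, b). bprod (f a) (g b)) (\<Delta> (wd w)) = conv (\<lambda>w. f (wd w)) (\<lambda>w. g (wd w)) w"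
      unfolding conv_def by (rule lift_Delta_word[OF words_module b w])
    also have "\<dots> = \<epsilon> (wd w) \<odot>\<^bsub>T\<^esub> wd []"
      using fg[OF w] w empty_closed by (simp add: conv_one_def eps_word T.smult_l_null)
    finally show "lift K T (\<lambda>(a, b). bprod (f a) (g b)) (\<Delta> (wd w)) = \<epsilon> (wd w) \<odot>\<^bsub>T\<^esub> wd []" .
  qed
qed

text \<open>The antipode is the convolution inverse of the identity, and the identity of T^c(R), as
  a function of words, is \<open>wd\<close>.\<close>

lemma antipode_T_hopf: "antipode K (H bprod) (lift K T (conv_inv wd))"
proof -
  let ?S = "lift K T (conv_inv wd)"
  note ml = conv_inv_ml[OF word_ml]
  note S = words_lift_lin[OF words_module ml] and Sw = words_lift_word[OF words_module ml]
  have 1: "conv (\<lambda>w. ?S (wd w)) (\<lambda>w. wd w) w = conv_one w" if w: "w \<in> L" for w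
  proof -
    have "conv (\<lambda>w. ?S (wd w)) (\<lambda>w. wd w) w = conv (conv_inv wd) wd w"
      by (rule conv_cong[OF w Sw refl])
    then show ?thesis using conv_inv_conv[OF word_ml refl w] by simp
  qed
  have 2: "conv (\<lambda>w. wd w) (\<lambda>w. ?S (wd w)) w = conv_one w" if w: "w \<in> L" for w
  proof -
    have "conv (\<lambda>w. wd w) (\<lambda>w. ?S (wd w)) w = conv wd (conv_inv wd) w"
      by (rule conv_cong[OF w refl Sw])
    then show ?thesis using conv_conv_inv[OF word_ml refl w] by simp
  qed
  show ?thesis
    unfolding antipode_def
    using S lift_Delta_conv[OF S lin_id 1] lift_Delta_conv[OF lin_id S 2] by simp
qed

section \<open>Right-sidedness and recovery of the braces\<close>

lemma submodule_msum:
  assumes "submodule N K T" "\<And>i. i \<in># M \<Longrightarrow> g i \<in> N"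
  shows "msum T g M \<in> N"
proof -
  have N: "N \<subseteq> carrier T" by (rule T.submoduleE(1)[OF assms(1)])
  have z: "\<zero>\<^bsub>T\<^esub> \<in> N"
    using subgroup.one_closed[OF submodule.axioms(1)[OF assms(1)]] by simp
  show ?thesis
    using assms(2)
  proof (induction M)
    case (add i M)
    then have "g i \<in> N" "msum T g M \<in> N" by auto
    then show ?case
      using T.submoduleE(5)[OF assms(1)] N by (auto simp: subset_eq)
  qed (simp add: z)
qed

lemma tensor_part_right_ideal: "right_ideal (H bprod) (tensor_part K R {n. q \<le> int n})"
proof -
  let ?N = "{n. q \<le> int n}"
  let ?I = "tensor_part K R ?N"
  note I = tensor_part_submodule[of ?N]
  note IE = T.submoduleE[OF I]
  have z: "\<zero>\<^bsub>T\<^esub> \<in> ?I"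
    using subgroup.one_closed[OF submodule.axioms(1)[OF I]] by simp
  interpret HM: module K "H bprod" by (rule module_T_hopf)
  have "submodule ?I K (H bprod)"
  proof (rule HM.submoduleI)
    fix a assume a: "a \<in> ?I"
    \<comment> \<open>The additive inverse is written as a scalar multiple, because the scalar
      multiplication is visibly the same in the Hopf record and in \<open>T\<close>.\<close>
    then have "\<ominus>\<^bsub>H bprod\<^esub> a = (\<ominus>\<^bsub>K\<^esub> \<one>\<^bsub>K\<^esub>) \<odot>\<^bsub>T\<^esub> a"
      using HM.smult_l_minus[of "\<one>\<^bsub>K\<^esub>" a] IE(1) HM.smult_one[of a] by (auto simp: subset_eq)
    then show "\<ominus>\<^bsub>H bprod\<^esub> a \<in> ?I"
      using IE(4)[of "\<ominus>\<^bsub>K\<^esub> \<one>\<^bsub>K\<^esub>"] a by simp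
  qed (use IE z in auto)
  then have sub: "additive_subgroup ?I (H bprod)"
    by (simp add: additive_subgroup_def submodule_def)
  have word: "bprod (wd u) t \<in> ?I" if u: "u \<in> L" "length u \<in> ?N" and t: "t \<in> carrier T" for u t
    using t
  proof (induction rule: words_induct)
    case (word v)
    have "wd w \<in> ?I" if "w \<in># wprods br u v" for w
      by (rule tensor_part_word[OF wprods_L[OF u(1) word that]]) (use wprods_length[OF that] u(2) in auto)
    then show ?case unfolding bprod_words[OF u(1) word] by (rule submodule_msum[OF I])
  next
    case zero
    show ?case
      using z lin_zero[OF words_module words_module bilin2[OF bprod_bilin word_closed[OF u(1)]]] by simp
  next
    case (add s t)
    then show ?case
      using IE(5) lin_add[OF bilin2[OF bprod_bilin word_closed[OF u(1)]]] by simp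
  next
    case (smult a s)
    then show ?case
      using IE(4) lin_smult[OF bilin2[OF bprod_bilin word_closed[OF u(1)]]] by simp
  qed
  \<comment> \<open>The elements whose right multiples all lie in \<open>?I\<close> form a
    submodule, so it is enough to know that the generating words belong to it; for these,
    \<open>wprods_length\<close> decides.\<close>
  have "?I \<subseteq> {s \<in> carrier T. \<forall>t \<in> carrier T. bprod s t \<in> ?I}"
  proof (rule tensor_part_minimal)
    show "wd w \<in> {s \<in> carrier T. \<forall>t \<in> carrier T. bprod s t \<in> ?I}" if "w \<in> L" "length w \<in> ?N" for w
      using word[OF that] word_closed[OF that(1)] by simp
    show "submodule {s \<in> carrier T. \<forall>t \<in> carrier T. bprod s t \<in> ?I} K T"
    proof (rule T.submoduleI)
      show "\<zero>\<^bsub>T\<^esub> \<in> {s \<in> carrier T. \<forall>t \<in> carrier T. bprod s t \<in> ?I}"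
        using z by (simp add: lin_zero[OF words_module words_module bilin1[OF bprod_bilin]])
    qed (use IE(3-5) in \<open>simp_all add: lin_add[OF bilin1[OF bprod_bilin]] lin_smult[OF bilin1[OF bprod_bilin]]
        lin_uminus[OF words_module words_module bilin1[OF bprod_bilin]] subset_eq\<close>)
  qed
  then show ?thesis
    unfolding right_ideal_def using sub by auto
qed

lemma right_sided_bprod: "right_sided K R bprod"
  using R bialgebra_T_hopf antipode_T_hopf tensor_part_right_ideal
  by (intro right_sided.intro right_sided_axioms.intro tensor_coalgebra_axioms)
    (auto simp: right_sided_CHA_def CHA_def hopf_algebra_def)

text \<open>The brace is the only contribution of length one to the product of \<open>[x]\<close>
  and \<open>ys\<close>. The braces are recovered on the carrier; elsewhere \<open>br\<close> is
  arbitrary and the two sides may differ.\<close>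

lemma CHA_brace_bprod:
  assumes x: "x \<in> carrier R" and ys: "ys \<in> L"
  shows "CHA_brace K R bprod x ys = br x ys"
proof -
  have xL: "[x] \<in> L" using x by simp
  have c: "[br x ys] \<in> L" using br_closed[OF x ys] by simp
  have "CHA_brace K R bprod x ys = \<pi> (E (wprods br [x] ys))"
    using right_sided.brace_eq[OF right_sided_bprod x ys] bprod_words[OF xL ys] by simp
  also have "\<dots> = msum R (\<lambda>w. \<pi> (wd w)) (wprods br [x] ys)"
    by (rule pi_E[OF wprods_L[OF xL ys]])
  also have "\<dots> = \<pi> (wd [br x ys])"
  proof (rule msum_wprods_single)
    show "abelian_monoid R" by (rule R.abelian_monoid_axioms)
    show "\<pi> (wd [br x ys]) \<in> carrier R" by (rule lin_closed[OF pi_lin word_closed[OF c]])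
    show "\<pi> (wd w) = \<zero>\<^bsub>R\<^esub>" if "w \<in># wprods br [x] ys" "length w \<noteq> 1" for w
      using pi_word[OF wprods_L[OF xL ys that(1)]] that(2) by simp
  qed
  also have "\<dots> = br x ys" using c by (simp add: pi_word)
  finally show ?thesis .
qed

end

section \<open>Naturality: maps of letters and morphisms of Hopf algebras\<close>

lemma splits_map: "splits (map f w) = image_mset (\<lambda>p. (map f (fst p), map f (snd p))) (splits w)"
  by (induction w) (auto simp: multiset.map_comp comp_def)

text \<open>A map that respects the braces passes through the recursion clause by clause. The empty
  list of arguments is included in the assumption, since a letter of \<open>u\<close> may absorb
  nothing.\<close>

lemma wprods_map:
  assumes "\<And>x ys. x \<in> C \<Longrightarrow> ys \<in> lists C \<Longrightarrow> f (br x ys) = br' (f x) (map f ys)"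
  shows "u \<in> lists C \<Longrightarrow> v \<in> lists C \<Longrightarrow>
    image_mset (map f) (wprods br u v) = wprods br' (map f u) (map f v)"
  using assms
proof (induction br u v rule: wprods.induct)
  case (1 br v)
  then show ?case by simp
next
  case (2 br x u)
  then have IH: "image_mset (map f) (wprods br u []) = wprods br' (map f u) []" by simp
  have "image_mset (map f) (wprods br (x # u) []) = image_mset ((#) (f (br x []))) (image_mset (map f) (wprods br u []))"
    by (simp add: multiset.map_comp comp_def)
  also have "f (br x []) = br' (f x) []" using 2 by simp
  finally show ?case unfolding IH by simp
next
  case (3 br x u z v)
  have x: "x \<in> C" and u: "u \<in> lists C" and zv: "z # v \<in> lists C" and v: "v \<in> lists C"
    using 3(3,4) by auto
  have IH1: "image_mset (map f) (wprods br (x # u) v) = wprods br' (map f (x # u)) (map f v)"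
    by (rule 3(1)[OF 3(3) v 3(5)])
  have IH2: "image_mset (map f) (wprods br u (snd p)) = wprods br' (map f u) (map f (snd p))"
    if p: "p \<in># splits (z # v)" for p
    by (rule 3(2)[OF p u _ 3(5)]) (use splits_lists[OF p zv] in auto)
  have comm: "image_mset (map f) (image_mset ((#) c) M) = image_mset ((#) (f c)) (image_mset (map f) M)" for c M
    by (simp add: multiset.map_comp comp_def)
  have "(\<Sum>p \<in># splits (z # v). image_mset (map f) (image_mset ((#) (br x (fst p))) (wprods br u (snd p)))) =
     (\<Sum>p \<in># splits (z # v). image_mset ((#) (br' (f x) (map f (fst p)))) (wprods br' (map f u) (map f (snd p))))"
  proof (rule arg_cong[of _ _ sum_mset], rule image_mset_cong)
    fix p assume p: "p \<in># splits (z # v)"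
    show "image_mset (map f) (image_mset ((#) (br x (fst p))) (wprods br u (snd p))) =
      image_mset ((#) (br' (f x) (map f (fst p)))) (wprods br' (map f u) (map f (snd p)))"
      unfolding comm IH2[OF p] 3(5)[OF x conjunct1[OF splits_lists[OF p zv]]] ..
  qed
  also have "\<dots> = (\<Sum>p \<in># splits (map f (z # v)). image_mset ((#) (br' (f x) (fst p))) (wprods br' (map f u) (snd p)))"
    by (simp only: splits_map multiset.map_comp comp_def fst_conv snd_conv)
  finally have S: "(\<Sum>p \<in># splits (z # v). image_mset (map f) (image_mset ((#) (br x (fst p))) (wprods br u (snd p)))) = \<dots>" .
  show ?case
    unfolding wprods.simps(3) image_mset_union image_mset_sum_mset comm[of z] IH1 S list.map ..
qed

locale right_sided_pair = A: right_sided K R mul + B: right_sided K R' mul'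
  for K :: "('k, 'm) ring_scheme" and R :: "('k, 'a, 'n) module_scheme" and mul
    and R' :: "('k, 'b, 'o) module_scheme" and mul'
begin

lemma T_map_ml:
  assumes "\<phi> \<in> lin_maps K R R'"
  shows "(\<lambda>w. B.wd (map \<phi> w)) \<in> mlin_maps K R B.T"
proof (rule mlin_mapsI)
  fix u v assume "u \<in> lists (carrier R)" "v \<in> lists (carrier R)"
  then have "map \<phi> u \<in> lists (carrier R')" "map \<phi> v \<in> lists (carrier R')"
    using lin_closed[OF assms] by auto
  then show "(\<lambda>y. B.wd (map \<phi> (u @ y # v))) \<in> lin_maps K R B.T"
    using lin_comp[OF assms ml_lin[OF B.word_ml, of "map \<phi> u" "map \<phi> v"]] by simp
qed (simp add: B.empty_closed)

context
  fixes \<phi> assumes phi: "\<phi> \<in> lin_maps K R R'"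
begin

lemma map_L: "w \<in> lists (carrier R) \<Longrightarrow> map \<phi> w \<in> lists (carrier R')"
  using lin_closed[OF phi] by auto

lemma T_map_lin: "T_map K R' \<phi> \<in> lin_maps K A.T B.T"
  and T_map_word: "w \<in> lists (carrier R) \<Longrightarrow> T_map K R' \<phi> (A.wd w) = B.wd (map \<phi> w)"
  unfolding T_map_def
  by (rule A.words_lift_lin[OF B.words_module T_map_ml[OF phi]],
      rule A.words_lift_word[OF B.words_module T_map_ml[OF phi]])

lemma T_proj_T_map:
  assumes "t \<in> carrier A.T"
  shows "B.\<pi> (T_map K R' \<phi> t) = \<phi> (A.\<pi> t)"
proof (rule A.words_eqI[OF B.R lin_comp[OF T_map_lin B.pi_lin] lin_comp[OF A.pi_lin phi] _ assms])
  fix w assume w: "w \<in> lists (carrier R)"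
  show "B.\<pi> (T_map K R' \<phi> (A.wd w)) = \<phi> (A.\<pi> (A.wd w))"
    unfolding T_map_word[OF w] B.pi_word[OF map_L[OF w]] A.pi_word[OF w]
    using lin_zero[OF A.R B.R phi] by (cases w) auto
qed

lemma brace_hom_of_hopf_morphism:
  assumes "T_map K R' \<phi> \<in> hopf_morphisms K (A.H mul) (B.H mul')"
    and x: "x \<in> carrier R" and ys: "ys \<in> lists (carrier R)"
  shows "\<phi> (A.br x ys) = B.br (\<phi> x) (map \<phi> ys)"
proof -
  have xL: "[x] \<in> lists (carrier R)" using x by simp
  have "T_map K R' \<phi> \<in> ring_hom (A.H mul) (B.H mul')"
    using assms(1) by (simp add: hopf_morphisms_def)
  then have "T_map K R' \<phi> (mul (A.wd [x]) (A.wd ys)) = mul' (T_map K R' \<phi> (A.wd [x])) (T_map K R' \<phi> (A.wd ys))"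
    using ring_hom_mult[of "T_map K R' \<phi>" "A.H mul" "B.H mul'" "A.wd [x]" "A.wd ys"]
      A.word_closed[OF xL] A.word_closed[OF ys] by simp
  also have "\<dots> = mul' (B.wd [\<phi> x]) (B.wd (map \<phi> ys))"
    using T_map_word[OF xL] T_map_word[OF ys] by simp
  finally have "B.\<pi> (T_map K R' \<phi> (mul (A.wd [x]) (A.wd ys))) = B.br (\<phi> x) (map \<phi> ys)"
    using B.brace_eq[OF lin_closed[OF phi x] map_L[OF ys]] by simp
  then show ?thesis
    using A.brace_eq[OF x ys] T_proj_T_map[OF A.mul_closed[OF A.word_closed[OF xL] A.word_closed[OF ys]]] by simp
qed

text \<open>By \<open>mul_words\<close> both products are determined by their braces, so respect for
  the braces carries over to products of words by \<open>wprods_map\<close> and then to all elements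
  by linearity.\<close>

lemma T_map_mul:
  assumes hom: "\<And>x ys. x \<in> carrier R \<Longrightarrow> ys \<in> lists (carrier R) \<Longrightarrow> \<phi> (A.br x ys) = B.br (\<phi> x) (map \<phi> ys)"
    and s: "s \<in> carrier A.T" and t: "t \<in> carrier A.T"
  shows "T_map K R' \<phi> (mul s t) = mul' (T_map K R' \<phi> s) (T_map K R' \<phi> t)"
proof -
  let ?f = "T_map K R' \<phi>"
  note mB = B.words_module and fl = T_map_lin and fc = lin_closed[OF T_map_lin]
  have w: "?f (mul (A.wd u) (A.wd v)) = mul' (?f (A.wd u)) (?f (A.wd v))"
    if u: "u \<in> lists (carrier R)" and v: "v \<in> lists (carrier R)" for u v
  proof -
    have "?f (mul (A.wd u) (A.wd v)) = msum B.T (\<lambda>w. ?f (A.wd w)) (wprods A.br u v)"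
      unfolding A.mul_words[OF u v]
      by (rule lin_msum[OF A.words_module mB fl A.word_closed[OF A.wprods_brace_L[OF u v]]])
    also have "\<dots> = msum B.T (\<lambda>w. B.wd (map \<phi> w)) (wprods A.br u v)"
      by (rule B.T.msum_cong[OF refl]) (rule T_map_word[OF A.wprods_brace_L[OF u v]])
    also have "\<dots> = B.E (image_mset (map \<phi>) (wprods A.br u v))"
      by (rule B.T.msum_image_mset[symmetric])
    also have "\<dots> = B.E (wprods B.br (map \<phi> u) (map \<phi> v))"
      by (rule arg_cong[OF wprods_map[of "carrier R" \<phi> A.br B.br, OF hom u v]])
    also have "\<dots> = mul' (?f (A.wd u)) (?f (A.wd v))"
      unfolding T_map_word[OF u] T_map_word[OF v] by (rule B.mul_words[OF map_L[OF u] map_L[OF v], symmetric])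
    finally show ?thesis .
  qed
  note A1 = bilin1[OF A.mul_bilin] and A2 = bilin2[OF A.mul_bilin]
    and B1 = bilin1[OF B.mul_bilin] and B2 = bilin2[OF B.mul_bilin]
  have 1: "?f (mul s (A.wd v)) = mul' (?f s) (?f (A.wd v))" if v: "v \<in> lists (carrier R)" for v
    by (rule A.words_eqI[OF mB lin_comp[OF A1[OF A.word_closed[OF v]] fl]
          lin_comp[OF fl B1[OF fc[OF A.word_closed[OF v]]]] _ s]) (rule w[OF _ v])
  show ?thesis
    by (rule A.words_eqI[OF mB lin_comp[OF A2[OF s] fl] lin_comp[OF fl B2[OF fc[OF s]]] _ t]) (rule 1)
qed

lemma Delta_T_map:
  assumes t: "t \<in> carrier A.T"
  shows "B.\<Delta> (T_map K R' \<phi> t) = tensor_map K B.T B.T (T_map K R' \<phi>) (T_map K R' \<phi>) (A.\<Delta> t)"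
proof -
  let ?f = "T_map K R' \<phi>"
  note mA = A.words_module and mB = B.words_module and fl = T_map_lin
  note ml = tensor_map_in_lin[OF mA mA mB mB fl fl] and mv = tensor_map_pure[OF mA mA mB mB fl fl]
  show ?thesis
  proof (rule A.words_eqI[OF B.TT.module_axioms lin_comp[OF fl B.Delta_lin] lin_comp[OF A.Delta_lin ml] _ t])
    fix w assume w: "w \<in> lists (carrier R)"
    have "tensor_map K B.T B.T ?f ?f (A.\<Delta> (A.wd w)) =
      msum B.TT (\<lambda>p. tensor_map K B.T B.T ?f ?f (A.pt (A.wd (fst p)) (A.wd (snd p)))) (splits w)"
      unfolding A.Delta_word[OF w]
      by (rule lin_msum[OF A.TT.module_axioms B.TT.module_axioms ml A.pt_word_closed[OF A.splits_L[OF _ w]]])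
    also have "\<dots> = msum B.TT (\<lambda>p. B.pt (B.wd (map \<phi> (fst p))) (B.wd (map \<phi> (snd p)))) (splits w)"
      by (rule B.TT.msum_cong[OF refl]) (simp only: mv A.word_closed A.splits_L[OF _ w] T_map_word)
    also have "\<dots> = B.\<Delta> (?f (A.wd w))"
      unfolding T_map_word[OF w] B.Delta_word[OF map_L[OF w]] splits_map B.TT.msum_image_mset by simp
    finally show "B.\<Delta> (?f (A.wd w)) = tensor_map K B.T B.T ?f ?f (A.\<Delta> (A.wd w))" ..
  qed
qed

lemma eps_T_map:
  assumes t: "t \<in> carrier A.T"
  shows "B.\<epsilon> (T_map K R' \<phi> t) = A.\<epsilon> t"
  by (rule A.words_eqI[OF module_scalars[OF A.cringK] lin_comp[OF T_map_lin B.eps_lin] A.eps_lin _ t])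
    (simp only: T_map_word B.eps_word[OF map_L] A.eps_word map_is_Nil_conv)

text \<open>Full faithfulness of the functor. The coproduct and the counit are preserved by the
  extension of any linear map, so the product alone imposes a condition; the case of no arguments
  follows from \<open>brace_empty\<close>.\<close>

lemma T_map_hopf_morphism_iff:
  "T_map K R' \<phi> \<in> hopf_morphisms K (A.H mul) (B.H mul') \<longleftrightarrow>
    (\<forall>x \<in> carrier R. \<forall>ys \<in> lists (carrier R). ys \<noteq> [] \<longrightarrow> \<phi> (A.br x ys) = B.br (\<phi> x) (map \<phi> ys))"
  (is "?L \<longleftrightarrow> ?R")
proof
  assume ?L
  then show ?R using brace_hom_of_hopf_morphism by blast
next
  assume r: ?R
  have hom: "\<phi> (A.br x ys) = B.br (\<phi> x) (map \<phi> ys)" if "x \<in> carrier R" "ys \<in> lists (carrier R)" for x ys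
    using r that lin_closed[OF phi that(1)] by (cases "ys = []") (auto simp: A.brace_empty B.brace_empty)
  have "T_map K R' \<phi> \<in> ring_hom (A.H mul) (B.H mul')"
    by (rule ring_hom_memI)
      (simp_all add: lin_closed[OF T_map_lin] T_map_mul[OF hom] lin_add[OF T_map_lin] T_map_word)
  then show ?L
    by (simp add: hopf_morphisms_def T_map_lin Delta_T_map eps_T_map)
qed

end

end

section \<open>The equivalence of categories\<close>

text \<open>The hom-sets of \<open>brace_cat\<close>, written with projections so that they can be
  compared for objects that are images under the functors and not literal pairs.\<close>

definition brace_homs ::
    "('k, 'm) ring_scheme \<Rightarrow> ('k, 'a) module \<times> ('a \<Rightarrow> 'a list \<Rightarrow> 'a) \<Rightarrow>
      ('k, 'a) module \<times> ('a \<Rightarrow> 'a list \<Rightarrow> 'a) \<Rightarrow> ('a \<Rightarrow> 'a) set"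
  where "brace_homs K A B = {\<phi> \<in> lin_maps K (fst A) (fst B). \<phi> \<in> extensional (carrier (fst A)) \<and>
    (\<forall>x \<in> carrier (fst A). \<forall>ys \<in> lists (carrier (fst A)). ys \<noteq> [] \<longrightarrow>
      \<phi> (snd A x ys) = snd B (\<phi> x) (map \<phi> ys))}"

lemma brace_cat_simps:
  "Obj (brace_cat K) = {A. brace_algebra K (fst A) (snd A)}"
  "Hom (brace_cat K) = brace_homs K"
  "Idt (brace_cat K) A = (\<lambda>x \<in> carrier (fst A). x)"
  "Cmp (brace_cat K) A B C \<psi> \<phi> = compose (carrier (fst A)) \<psi> \<phi>"
  by (auto simp: brace_cat_def brace_homs_def fun_eq_iff split_def)

text \<open>A morphism meets the operations only at arguments from the carriers. Going to Hopf
  algebras and back changes the operations at most outside the carriers, and so changes no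
  hom-set.\<close>

lemma brace_homs_cong:
  assumes "fst A' = fst A" "fst B' = fst B"
    and "brace_algebra K (fst B) (snd B)"
    and "\<And>x ys. x \<in> carrier (fst A) \<Longrightarrow> ys \<in> lists (carrier (fst A)) \<Longrightarrow> snd A' x ys = snd A x ys"
    and "\<And>x ys. x \<in> carrier (fst B) \<Longrightarrow> ys \<in> lists (carrier (fst B)) \<Longrightarrow> snd B' x ys = snd B x ys"
  shows "brace_homs K A' B' = brace_homs K A B"
proof -
  have "snd B' (\<phi> x) (map \<phi> ys) = snd B (\<phi> x) (map \<phi> ys)"
    if "\<phi> \<in> lin_maps K (fst A) (fst B)" "x \<in> carrier (fst A)" "ys \<in> lists (carrier (fst A))" for \<phi> x ys
    using that lin_closed[OF that(1)] by (intro assms(5)) auto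
  then show ?thesis
    unfolding brace_homs_def assms(1,2)
    by (intro Collect_cong conj_cong ball_cong imp_cong refl) (simp only: assms(4))
qed

lemma braceI: "brace_algebra K R br \<Longrightarrow> brace K R br"
  by (intro brace.intro tensor_coalgebra.intro brace_axioms.intro) (simp_all add: brace_algebra_def)

lemma brace_homs_id:
  assumes "brace_algebra K (fst A) (snd A)"
  shows "(\<lambda>x \<in> carrier (fst A). x) \<in> brace_homs K A A"
proof -
  interpret brace K "fst A" "snd A"
    using assms by (rule braceI)
  have "map (\<lambda>x \<in> carrier (fst A). x) ys = ys" if "ys \<in> lists (carrier (fst A))" for ys
    using that by (induction ys) auto
  then show ?thesis
    using lin_cong[OF R lin_id, of "\<lambda>x \<in> carrier (fst A). x"] br_closed
    by (auto simp: brace_homs_def simp del: in_lists_conv_set)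
qed

lemma brace_homs_compose:
  assumes A: "brace_algebra K (fst A) (snd A)" and f: "\<phi> \<in> brace_homs K A B" and g: "\<psi> \<in> brace_homs K B C"
  shows "compose (carrier (fst A)) \<psi> \<phi> \<in> brace_homs K A C"
proof -
  interpret brace K "fst A" "snd A"
    using A by (rule braceI)
  have fl: "\<phi> \<in> lin_maps K (fst A) (fst B)" and gl: "\<psi> \<in> lin_maps K (fst B) (fst C)"
    using f g by (simp_all add: brace_homs_def)
  have "compose (carrier (fst A)) \<psi> \<phi> \<in> lin_maps K (fst A) (fst C)"
    by (rule lin_cong[OF R lin_comp[OF fl gl]]) (simp add: compose_eq)
  moreover have "compose (carrier (fst A)) \<psi> \<phi> (snd A x ys) =
      snd C (compose (carrier (fst A)) \<psi> \<phi> x) (map (compose (carrier (fst A)) \<psi> \<phi>) ys)"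
    if x: "x \<in> carrier (fst A)" and ys: "ys \<in> lists (carrier (fst A))" "ys \<noteq> []" for x ys
  proof -
    have m: "map (compose (carrier (fst A)) \<psi> \<phi>) ys = map \<psi> (map \<phi> ys)"
      using ys(1) by (auto simp: compose_eq)
    have "compose (carrier (fst A)) \<psi> \<phi> (snd A x ys) = \<psi> (snd B (\<phi> x) (map \<phi> ys))"
      using f x ys br_closed[OF x ys(1)] by (simp add: compose_eq brace_homs_def)
    also have "\<dots> = snd C (\<psi> (\<phi> x)) (map \<psi> (map \<phi> ys))"
    proof -
      have "\<phi> x \<in> carrier (fst B)" "map \<phi> ys \<in> lists (carrier (fst B))" "map \<phi> ys \<noteq> []"
        using lin_closed[OF fl] x ys by auto
      then show ?thesis using g unfolding brace_homs_def by blast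
    qed
    finally show ?thesis using x by (simp only: m compose_eq)
  qed
  ultimately show ?thesis
    unfolding brace_homs_def by (auto simp: compose_extensional simp del: in_lists_conv_set)
qed

lemma brace_homs_fun: "\<phi> \<in> brace_homs K A B \<Longrightarrow> \<phi> \<in> carrier (fst A) \<rightarrow> carrier (fst B)"
  and brace_homs_ext: "\<phi> \<in> brace_homs K A B \<Longrightarrow> \<phi> \<in> extensional (carrier (fst A))"
  by (auto simp: brace_homs_def lin_maps_def)

lemma category_brace: "category (brace_cat K)"
  unfolding category_def brace_cat_simps
  by (auto simp: brace_homs_id brace_homs_compose compose_assoc[OF brace_homs_fun]
      Id_compose[OF brace_homs_fun brace_homs_ext] compose_Id[OF brace_homs_fun brace_homs_ext])

lemma brace_functor_simps:
  "fst (brace_functor K) A = (fst A, CHA_brace K (fst A) (snd A))"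
  "snd (brace_functor K) A B \<phi> = \<phi>"
  by (auto simp: brace_functor_def split_def)

lemma CHA_cat_simps:
  "Obj (CHA_cat K) = {A. right_sided_CHA K (fst A) (snd A)}"
  "Idt (CHA_cat K) A = (\<lambda>x \<in> carrier (fst A). x)"
  "Cmp (CHA_cat K) A B C \<psi> \<phi> = compose (carrier (fst A)) \<psi> \<phi>"
  by (auto simp: CHA_cat_def split_def)

lemma right_sidedI: "right_sided_CHA K R mul \<Longrightarrow> right_sided K R mul"
  by (intro right_sided.intro tensor_coalgebra.intro right_sided_axioms.intro)
    (simp_all add: right_sided_CHA_def CHA_def)

text \<open>Both categories take linear functions between the same spaces as morphisms and the
  functor leaves them unchanged, so full faithfulness becomes an equality of hom-sets.\<close>

lemma Hom_CHA:
  assumes A: "right_sided_CHA K (fst A) (snd A)" and B: "right_sided_CHA K (fst B) (snd B)"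
  shows "Hom (CHA_cat K) A B = brace_homs K (fst (brace_functor K) A) (fst (brace_functor K) B)"
proof -
  interpret right_sided_pair K "fst A" "snd A" "fst B" "snd B"
    using A B by (intro right_sided_pair.intro right_sidedI)
  show ?thesis
    using T_map_hopf_morphism_iff
    by (auto simp: CHA_cat_def split_def brace_homs_def brace_functor_simps simp del: in_lists_conv_set)
qed

lemma brace_functor_Obj:
  "right_sided_CHA K R mul \<Longrightarrow> brace_algebra K R (CHA_brace K R mul)"
  by (rule right_sided.brace_algebra_CHA[OF right_sidedI])

definition brace_hopf ::
    "('k, 'm) ring_scheme \<Rightarrow>
      (('k, 'a) module \<times> ('a \<Rightarrow> 'a list \<Rightarrow> 'a), 'a \<Rightarrow> 'a,
       ('k, 'a) module \<times> ('k, 'a) T_product, 'a \<Rightarrow> 'a) func"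
  where "brace_hopf K = ((\<lambda>A. (fst A, brace.bprod K (fst A) (snd A))), (\<lambda>A B \<phi>. \<phi>))"

lemma brace_hopf_simps:
  "fst (brace_hopf K) A = (fst A, brace.bprod K (fst A) (snd A))"
  "snd (brace_hopf K) A B \<phi> = \<phi>"
  by (simp_all add: brace_hopf_def)

lemma brace_hopf_Obj:
  "brace_algebra K R br \<Longrightarrow> right_sided_CHA K R (brace.bprod K R br)"
  using right_sided.cha[OF brace.right_sided_bprod[OF braceI]] .

lemma brace_homs_hopf:
  assumes "brace_algebra K (fst A) (snd A)" "brace_algebra K (fst B) (snd B)"
  defines "FG \<equiv> \<lambda>A. fst (brace_functor K) (fst (brace_hopf K) A)"
  shows "brace_homs K (FG A) (FG B) = brace_homs K A B"
    and "brace_homs K A (FG B) = brace_homs K A B"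
    and "brace_homs K (FG A) B = brace_homs K A B"
  unfolding FG_def
  by (rule brace_homs_cong;
      simp add: brace_functor_simps brace_hopf_simps assms brace.CHA_brace_bprod[OF braceI] del: in_lists_conv_set)+

text \<open>Hom-sets, identities and composition that are induced along a map of objects inherit the
  axioms. Applied to the brace functor, this saves a direct verification for the Hopf
  algebras.\<close>

lemma category_pullback:
  assumes D: "category \<D>"
    and Obj: "\<And>A. A \<in> Obj \<C> \<Longrightarrow> F A \<in> Obj \<D>"
    and Hom: "\<And>A B. A \<in> Obj \<C> \<Longrightarrow> B \<in> Obj \<C> \<Longrightarrow> Hom \<C> A B = Hom \<D> (F A) (F B)"
    and Idt: "\<And>A. Idt \<C> A = Idt \<D> (F A)"
    and Cmp: "\<And>A B C. Cmp \<C> A B C = Cmp \<D> (F A) (F B) (F C)"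
  shows "category \<C>"
proof -
  have i: "Idt \<D> A \<in> Hom \<D> A A" if "A \<in> Obj \<D>" for A
    using D that unfolding category_def by blast
  have c: "Cmp \<D> A B C g f \<in> Hom \<D> A C"
    if "A \<in> Obj \<D>" "B \<in> Obj \<D>" "C \<in> Obj \<D>" "f \<in> Hom \<D> A B" "g \<in> Hom \<D> B C" for A B C f g
    using D that unfolding category_def by blast
  have u: "Cmp \<D> A A B f (Idt \<D> A) = f" "Cmp \<D> A B B (Idt \<D> B) f = f"
    if "A \<in> Obj \<D>" "B \<in> Obj \<D>" "f \<in> Hom \<D> A B" for A B f
    using D that unfolding category_def by blast+
  have a: "Cmp \<D> A C E h (Cmp \<D> A B C g f) = Cmp \<D> A B E (Cmp \<D> B C E h g) f"
    if "A \<in> Obj \<D>" "B \<in> Obj \<D>" "C \<in> Obj \<D>" "E \<in> Obj \<D>"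
      "f \<in> Hom \<D> A B" "g \<in> Hom \<D> B C" "h \<in> Hom \<D> C E" for A B C E f g h
    using D that unfolding category_def by blast
  show ?thesis
    unfolding category_def Idt Cmp
    by (intro conjI ballI) (simp_all add: Hom Obj i c u a)
qed

lemma category_CHA: "category (CHA_cat K)"
proof (rule category_pullback[OF category_brace, where F = "fst (brace_functor K)"])
  show "fst (brace_functor K) A \<in> Obj (brace_cat K)" if "A \<in> Obj (CHA_cat K)" for A
    using that brace_functor_Obj by (simp add: CHA_cat_simps brace_cat_simps brace_functor_simps)
  show "Hom (CHA_cat K) A B = Hom (brace_cat K) (fst (brace_functor K) A) (fst (brace_functor K) B)"
    if "A \<in> Obj (CHA_cat K)" "B \<in> Obj (CHA_cat K)" for A B
    using that Hom_CHA by (simp add: CHA_cat_simps brace_cat_simps)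
qed (simp_all add: fun_eq_iff CHA_cat_simps brace_cat_simps brace_functor_simps)

lemma equivalence: "is_equivalence (CHA_cat K) (brace_cat K) (brace_functor K)"
proof -
  let ?C = "CHA_cat K" and ?D = "brace_cat K" and ?F = "brace_functor K" and ?G = "brace_hopf K"
  have FO: "fst ?F A \<in> Obj ?D" if "A \<in> Obj ?C" for A
    using that brace_functor_Obj by (simp add: CHA_cat_simps brace_cat_simps brace_functor_simps)
  have GO: "fst ?G A \<in> Obj ?C" if "A \<in> Obj ?D" for A
    using that brace_hopf_Obj by (simp add: CHA_cat_simps brace_cat_simps brace_hopf_simps)
  have HC: "Hom ?C A B = brace_homs K (fst ?F A) (fst ?F B)" if "A \<in> Obj ?C" "B \<in> Obj ?C" for A B
    using that Hom_CHA by (simp add: CHA_cat_simps)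
  have HD: "Hom ?D = brace_homs K" by (simp add: brace_cat_simps)
  have FG: "brace_homs K (fst ?F (fst ?G A)) (fst ?F (fst ?G B)) = brace_homs K A B"
    "brace_homs K A (fst ?F (fst ?G B)) = brace_homs K A B"
    "brace_homs K (fst ?F (fst ?G A)) B = brace_homs K A B" if "A \<in> Obj ?D" "B \<in> Obj ?D" for A B
    using brace_homs_hopf[of K A B] that by (simp_all add: brace_cat_simps)
  have id: "(\<lambda>x \<in> carrier (fst A). x) \<in> brace_homs K A A" if "A \<in> Obj ?D" for A
    using that brace_homs_id by (simp add: brace_cat_simps)
  have cId: "compose (carrier (fst A)) \<phi> (\<lambda>x \<in> carrier (fst A). x) = \<phi>"
    "compose (carrier (fst A)) (\<lambda>x \<in> carrier (fst B). x) \<phi> = \<phi>" if "\<phi> \<in> brace_homs K A B" for A B \<phi>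
    using compose_Id[OF brace_homs_fun brace_homs_ext] Id_compose[OF brace_homs_fun brace_homs_ext] that by blast+
  note s = CHA_cat_simps(2,3) brace_cat_simps(3,4) brace_functor_simps(2) brace_hopf_simps(2)
  have fstF: "fst (fst ?F A) = fst A" "fst (fst ?G B) = fst B" for A B
    by (simp_all add: brace_functor_simps brace_hopf_simps)
  have F: "is_functor ?C ?D ?F"
    unfolding is_functor_def by (auto simp: FO HC HD s fstF)
  have G: "is_functor ?D ?C ?G"
    unfolding is_functor_def by (auto simp: GO HC HD s fstF FG)
  have GF: "naturally_isomorphic ?C ?C id_func (comp_func ?G ?F)"
    unfolding naturally_isomorphic_def
  proof (intro exI[of _ "\<lambda>A. \<lambda>x \<in> carrier (fst A). x"] conjI ballI)
    fix A assume A: "A \<in> Obj ?C"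
    note FA = FO[OF A] note GFA = GO[OF FA]
    \<comment> \<open>The object \<open>A\<close> and its image under both functors may differ
      outside the carriers. Their hom-sets are nevertheless the same, by \<open>HC\<close> and
      \<open>FG\<close>, so the identity map is a morphism in either direction and its own
      inverse.\<close>
    have h: "(\<lambda>x \<in> carrier (fst A). x) \<in> brace_homs K (fst ?F A) (fst ?F A)"
      using id[OF FA] by (simp add: fstF)
    show "is_iso ?C (fst id_func A) (fst (comp_func ?G ?F) A) (\<lambda>x \<in> carrier (fst A). x)"
      unfolding is_iso_def id_func_def comp_func_def fst_conv
      using h cId(1)[OF h] A GFA FA
      by (auto intro!: bexI[of _ "\<lambda>x \<in> carrier (fst A). x"] simp: HC FG s fstF)
  next
    fix A B f assume A: "A \<in> Obj ?C" and B: "B \<in> Obj ?C" and f: "f \<in> Hom ?C A B"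
    then have f: "f \<in> brace_homs K (fst ?F A) (fst ?F B)" by (simp add: HC)
    show "Cmp ?C (fst id_func A) (fst id_func B) (fst (comp_func ?G ?F) B) (\<lambda>x \<in> carrier (fst B). x) (snd id_func A B f) =
      Cmp ?C (fst id_func A) (fst (comp_func ?G ?F) A) (fst (comp_func ?G ?F) B) (snd (comp_func ?G ?F) A B f)
        (\<lambda>x \<in> carrier (fst A). x)"
      using cId[OF f] by (simp add: id_func_def comp_func_def s fstF)
  qed
  have FG': "naturally_isomorphic ?D ?D (comp_func ?F ?G) id_func"
    unfolding naturally_isomorphic_def
  proof (intro exI[of _ "\<lambda>A. \<lambda>x \<in> carrier (fst A). x"] conjI ballI)
    fix A assume A: "A \<in> Obj ?D"
    note h = id[OF A]
    show "is_iso ?D (fst (comp_func ?F ?G) A) (fst id_func A) (\<lambda>x \<in> carrier (fst A). x)"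
      unfolding is_iso_def id_func_def comp_func_def fst_conv
      using h cId(1)[OF h] A
      by (auto intro!: bexI[of _ "\<lambda>x \<in> carrier (fst A). x"] simp: HD FG s fstF)
  next
    fix A B f assume A: "A \<in> Obj ?D" and B: "B \<in> Obj ?D" and f: "f \<in> Hom ?D A B"
    then have f: "f \<in> brace_homs K A B" by (simp add: HD)
    show "Cmp ?D (fst (comp_func ?F ?G) A) (fst (comp_func ?F ?G) B) (fst id_func B) (\<lambda>x \<in> carrier (fst B). x)
        (snd (comp_func ?F ?G) A B f) =
      Cmp ?D (fst (comp_func ?F ?G) A) (fst id_func A) (fst id_func B) (snd id_func A B f)
        (\<lambda>x \<in> carrier (fst A). x)"
      using cId[OF f] by (simp add: id_func_def comp_func_def s fstF)
  qed
  show ?thesis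
    unfolding is_equivalence_def using category_CHA category_brace F G GF FG' by blast
qed

theorem theorem3p5:
  fixes K :: "('k, 'm) ring_scheme"
  assumes "field K"
  shows "(\<forall>(R :: ('k, 'a) module) mul. right_sided_CHA K R mul \<longrightarrow>
            bij_betw (\<lambda>x. word K R [x]) (carrier R) (primitives K (T_hopf K R mul)) \<and>
            brace_algebra K R (CHA_brace K R mul)) \<and>
         is_equivalence
           (CHA_cat K :: (('k, 'a) module \<times> ('k, 'a) T_product, 'a \<Rightarrow> 'a) cat)
           (brace_cat K)
           (brace_functor K)"
proof (intro conjI allI impI)
  fix R :: "('k, 'a) module" and mul
  assume "right_sided_CHA K R mul"
  then interpret right_sided K R mul by (rule right_sidedI)
  show "bij_betw (\<lambda>x. word K R [x]) (carrier R) (primitives K (T_hopf K R mul))"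
    by (rule primitives_bij)
  show "brace_algebra K R (CHA_brace K R mul)"
    by (rule brace_algebra_CHA)
qed (rule equivalence)

end
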